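(* Let $\kappa\in(0,1)$, let $\mu$ be a $\kappa$-regular distribution on environments, let $\tau$ be a cooling map, and let $(X_n)_{n\ge0}$ be the corresponding random walk in cooling random environment under its annealed law. Assume in addition that the cooling map is such that $$\lim_{n\to\infty}\frac{\operatorname{Var}(X_n)}{\sum_k(T_{k,n})^{2\kappa}}=\sigma_{\mathfrak{M}}^2 .$$ Define the vector $\tilde\lambda_{\tau,n}=(\tilde\lambda_{\tau,n}(k))_{k\ge1}$ by $$\tilde\lambda_{\tau,n}(k)=\frac{(T_{k,n})^\kappa}{V_n},\qquad V_n=\sqrt{\sum_j(T_{j,n})^{2\kappa}} .$$ If $n_j\to\infty$ is a subsequence such that $\lim_{j\to\infty}\tilde\lambda^{\downarrow}_{\tau,n_j}(k)=\lambda_*(k)$ for all $k\ge1$, for some $\lambda_*\in\ell^2$, then $$\frac{X_{n_j}-\mathbb{E}[X_{n_j}]}{\sqrt{\operatorname{Var}(X_{n_j})}}\ \underset{j\to\infty}{\Longrightarrow}\ \big(\widehat{\mathfrak{M}}_\kappa\big)^{\otimes\lambda_*}+a(\lambda_* )\Phi,$$ where $a(\lambda_* ):=\big(1-\sum_k\lambda_*^2(k)\big)^{1/2}\in[0,1]$ and $\Phi$ is a standard Gaussian random variable independent of $\big(\widehat{\mathfrak{M}}_\kappa\big)^{\otimes\lambda_*}$; moreover the convergence in law also holds in $L^p$ for all $p>0$.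
   Context: RWRE. Let $\alpha$ be a probability distribution on $[0,1]$ and $\mu=\alpha^{\mathbb{Z}}$ the product law on environments $\omega=(\omega(x))_{x\in\mathbb{Z}}\in[0,1]^{\mathbb{Z}}$. Given $\omega$, the walk $(Z_n)_{n\ge0}$ is the Markov chain on $\mathbb{Z}$ with $Z_0=0$ that jumps from $x$ to $x+1$ with probability $\omega(x)$ and to $x-1$ with probability $1-\omega(x)$. The annealed law of the walk is obtained by averaging over $\omega\sim\mu$; $\mathbb{P},\mathbb{E},\operatorname{Var}$ refer to annealed laws. Let $\rho_0=\frac{1-\omega(0)}{\omega(0)}$ and let $\langle\cdot\rangle$ denote expectation with respect to $\alpha$. The measure $\mu$ is $\kappa$-regular ($\kappa>0$) if $\mu=\alpha^{\mathbb{Z}}$, $\langle\log\rho_0\rangle<0$, the distribution of $\log\rho_0$ is non-lattice, $\langle\rho_0^\kappa\rangle=1$, and $\langle\rho_0^{\kappa+\varepsilon}\rangle<\infty$ for some $\varepsilon>0$. RWCRE. A cooling map $\tau$ is given by a sequence $(T_k)_{k\ge1}$ of positive integers via $\tau(0)=0$, $\tau(k)=\sum_{i=1}^kT_i$. Let $(\omega^{(k)})_{k\ge1}$ be i.i.d. environments with law $\mu$. Given these, the walk $X$ starts at $X_0=0$ and at each time $n$ with $\tau(k-1)\le n<\tau(k)$ it jumps from $x$ to $x+1$ with probability $\omega^{(k)}(x)$ and to $x-1$ with probability $1-\omega^{(k)}(x)$; the annealed law averages over $(\omega^{(k)})_{k\geq 1}$. Let $\ell_n=\sup\{\ell:\tau(\ell)\le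 n\}$ and $T_{k,n}=T_k$ if $k\le\ell_n$, $T_{\ell_n+1,n}=n-\tau(\ell_n)$, and $T_{k,n}=0$ if $k>\ell_n+1$. Notation. $\ell^2$ is the space of square-summable real sequences. For a non-negative sequence $\mathbf{x}\in\ell^2$, $\mathbf{x}^{\downarrow}$ denotes its non-increasing reordering. For a random variable $Z$ with finite variance, $\widehat Z=\frac{Z-E[Z]}{\sqrt{\operatorname{Var}(Z)}}$, and for $\mathbf{x}\in\ell^2$, $(\widehat Z)^{\otimes\mathbf{x}}=\sum_{k\ge1}x(k)\widehat Z_k$ with $\widehat Z_1,\widehat Z_2,\dots$ i.i.d. copies of $\widehat Z$. $\mathfrak{M}_\kappa$ is the (Mittag-Leffler) non-negative random variable with Laplace transform $E[e^{-\lambda\mathfrak{M}_\kappa}]=\sum_{n=0}^\infty\frac{(-b\lambda)^n}{\Gamma(1+\kappa n)}$, $\lambda>0$, where $b=b(\mu)>0$ is the constant (known to exist) for which $Z_n/n^\kappa\Rightarrow\mathfrak{M}_\kappa$ under the annealed law; $\sigma_{\mathfrak{M}}^2=\operatorname{Var}(\mathfrak{M}_\kappa)=b^2\left(\frac{2}{\Gamma(1+2\kappa)}-\frac1{\Gamma(1+\kappa)^2}\right)$. $\Longrightarrow$ denotes convergence in distribution. A convergence in law $W_j\Rightarrow W$ is said to hold in $L^p$ if moreover $\{|W_j|^p\}_j$ is uniformly integrable (equivalently $E|W_j|^p\to E|W|^p<\infty$). *)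

theory Defs
  imports "HOL-Probability.Probability"
begin

text \<open>Sequences indexed by \<open>k \<ge> 1\<close> on paper (cooling increments, environments, vectors in
  \<open>\<ell>\<^sup>2\<close>) are functions on \<^typ>\<open>nat\<close> shifted by one: index \<open>k\<close> here is index \<open>k + 1\<close> there.\<close>

definition distribution_on_unit_interval :: "real measure \<Rightarrow> bool" where
  "distribution_on_unit_interval \<alpha> \<longleftrightarrow>
     prob_space \<alpha> \<and> sets \<alpha> = sets borel \<and> (AE w in \<alpha>. 0 \<le> w \<and> w \<le> 1)"

text \<open>For \<open>\<rho> = (1 - w) / w\<close> with \<open>w\<close> in \<open>[0,1]\<close> the values at the end points are taken in the
  extended sense: \<open>\<rho> = \<infinity>\<close> for \<open>w = 0\<close>, and \<open>log \<rho> = -\<infinity>\<close> for \<open>w = 1\<close>.\<close>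

definition log_rho :: "real \<Rightarrow> ereal" where
  "log_rho w = (if w \<le> 0 then \<infinity> else if 1 \<le> w then -\<infinity> else ereal (ln ((1 - w) / w)))"

definition rho_powr :: "real \<Rightarrow> real \<Rightarrow> ennreal" where
  "rho_powr s w = (if w \<le> 0 then \<infinity> else ennreal (((1 - w) / w) powr s))"

text \<open>Negative mean of \<open>log \<rho>\<close>, the value \<open>-\<infinity>\<close> being allowed: the integral of the positive part
  is smaller than that of the negative part (\<^const>\<open>e2ennreal\<close> truncates at \<open>0\<close>); the former is
  then automatically finite.\<close>

definition neg_mean_log_rho :: "real measure \<Rightarrow> bool" where
  "neg_mean_log_rho \<alpha> \<longleftrightarrow>
     (\<integral>\<^sup>+ w. e2ennreal (log_rho w) \<partial>\<alpha>) < (\<integral>\<^sup>+ w. e2ennreal (- log_rho w) \<partial>\<alpha>)"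

text \<open>Non-lattice is understood as in renewal theory: apart from a possible atom at \<open>-\<infinity>\<close>, the law
  is not carried by any \<open>h\<int>\<close> with \<open>h > 0\<close>.  It is implied by the version in which shifted
  lattices \<open>a + h\<int>\<close> are excluded as well.\<close>

definition non_lattice_log_rho :: "real measure \<Rightarrow> bool" where
  "non_lattice_log_rho \<alpha> \<longleftrightarrow>
     \<not> (\<exists>h>0. AE w in \<alpha>. log_rho w = -\<infinity> \<or> (\<exists>m::int. log_rho w = ereal (h * of_int m)))"

definition kappa_regular :: "real \<Rightarrow> real measure \<Rightarrow> bool" where
  "kappa_regular \<kappa> \<alpha> \<longleftrightarrow>
     0 < \<kappa> \<and> distribution_on_unit_interval \<alpha> \<and>
     neg_mean_log_rho \<alpha> \<and> non_lattice_log_rho \<alpha> \<and>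
     (\<integral>\<^sup>+ w. rho_powr \<kappa> w \<partial>\<alpha>) = 1 \<and>
     (\<exists>\<epsilon>>0. (\<integral>\<^sup>+ w. rho_powr (\<kappa> + \<epsilon>) w \<partial>\<alpha>) < \<infinity>)"

definition jump_prob :: "real \<Rightarrow> int \<Rightarrow> int \<Rightarrow> real" where
  "jump_prob p x y = (if y = x + 1 then p else if y = x - 1 then 1 - p else 0)"

text \<open>\<open>\<omega>\<close> is an i.i.d. field with marginal \<open>\<alpha>\<close>; \<open>e n x\<close> is the index of the field variable used when
  jumping from site \<open>x\<close> at time \<open>n\<close>.  The last clause says that, conditionally on \<open>\<omega>\<close>, the process
  \<open>X\<close> is the Markov chain started at \<open>0\<close> with these jump probabilities.\<close>

definition annealed_walk ::
  "real measure \<Rightarrow> (nat \<Rightarrow> int \<Rightarrow> 'i) \<Rightarrow> 's measure \<Rightarrow> ('i \<Rightarrow> 's \<Rightarrow> real) \<Rightarrow> (nat \<Rightarrow> 's \<Rightarrow> int) \<Rightarrow> bool"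
where
  "annealed_walk \<alpha> e M \<omega> X \<longleftrightarrow>
     prob_space M \<and>
     prob_space.indep_vars M (\<lambda>_. borel) \<omega> UNIV \<and>
     (\<forall>i. distr M borel (\<omega> i) = \<alpha>) \<and>
     (\<forall>n. X n \<in> measurable M (count_space UNIV)) \<and>
     (\<forall>n. \<forall>z :: nat \<Rightarrow> int. \<forall>B \<in> sets (PiM UNIV (\<lambda>_. borel)).
        measure M {s \<in> space M. (\<lambda>i. \<omega> i s) \<in> B \<and> (\<forall>m\<le>n. X m s = z m)} =
        (\<integral> s. indicator B (\<lambda>i. \<omega> i s) * of_bool (z 0 = 0) *
               (\<Prod>m<n. jump_prob (\<omega> (e m (z m)) s) (z m) (z (Suc m))) \<partial>M))"

definition rwre ::
  "real measure \<Rightarrow> 's measure \<Rightarrow> (int \<Rightarrow> 's \<Rightarrow> real) \<Rightarrow> (nat \<Rightarrow> 's \<Rightarrow> int) \<Rightarrow> bool"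
where
  "rwre \<alpha> M \<omega> Z \<longleftrightarrow> annealed_walk \<alpha> (\<lambda>_ x. x) M \<omega> Z"

definition cooling_increments :: "(nat \<Rightarrow> nat) \<Rightarrow> bool" where
  "cooling_increments T \<longleftrightarrow> (\<forall>k. 0 < T k)"

definition cooling_map :: "(nat \<Rightarrow> nat) \<Rightarrow> nat \<Rightarrow> nat" where
  "cooling_map T k = (\<Sum>i<k. T i)"

definition cooling_index :: "(nat \<Rightarrow> nat) \<Rightarrow> nat \<Rightarrow> nat" where
  "cooling_index T n = Sup {l. cooling_map T l \<le> n}"

text \<open>The environment in force at time \<open>n\<close> is the one with (shifted) index \<open>cooling_index T n\<close>, as
  \<open>cooling_map T l \<le> n < cooling_map T (l + 1)\<close> for \<open>l = cooling_index T n\<close>.\<close>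

definition rwcre ::
  "real measure \<Rightarrow> (nat \<Rightarrow> nat) \<Rightarrow> 's measure \<Rightarrow> (nat \<times> int \<Rightarrow> 's \<Rightarrow> real) \<Rightarrow> (nat \<Rightarrow> 's \<Rightarrow> int) \<Rightarrow> bool"
where
  "rwcre \<alpha> T M \<omega> X \<longleftrightarrow> annealed_walk \<alpha> (\<lambda>n x. (cooling_index T n, x)) M \<omega> X"

definition truncated_increment :: "(nat \<Rightarrow> nat) \<Rightarrow> nat \<Rightarrow> nat \<Rightarrow> nat" where
  "truncated_increment T n k =
     (if k < cooling_index T n then T k
      else if k = cooling_index T n then n - cooling_map T (cooling_index T n)
      else 0)"

definition sum_sq :: "real \<Rightarrow> (nat \<Rightarrow> nat) \<Rightarrow> nat \<Rightarrow> real" where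
  "sum_sq \<kappa> T n = (\<Sum>k. real (truncated_increment T n k) powr (2 * \<kappa>))"

definition weights :: "real \<Rightarrow> (nat \<Rightarrow> nat) \<Rightarrow> nat \<Rightarrow> nat \<Rightarrow> real" where
  "weights \<kappa> T n k = real (truncated_increment T n k) powr \<kappa> / sqrt (sum_sq \<kappa> T n)"

text \<open>If infinitely many entries of \<open>x\<close> are positive, then its zeros do not appear in the reordering;
  hence the bijection is between supports.\<close>

definition is_decr_reordering :: "(nat \<Rightarrow> real) \<Rightarrow> (nat \<Rightarrow> real) \<Rightarrow> bool" where
  "is_decr_reordering x y \<longleftrightarrow>
     antimono y \<and> (\<forall>k. 0 \<le> y k) \<and>
     (\<exists>f. bij_betw f {k. y k \<noteq> 0} {k. x k \<noteq> 0} \<and> (\<forall>k. y k \<noteq> 0 \<longrightarrow> x (f k) = y k))"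

definition decr_reordering :: "(nat \<Rightarrow> real) \<Rightarrow> nat \<Rightarrow> real" where
  "decr_reordering x = (THE y. is_decr_reordering x y)"

lemma superlevel_set_eq:
  fixes x y :: "nat \<Rightarrow> real"
  assumes fin: "finite {k. x k \<noteq> 0}" and y: "is_decr_reordering x y" and t: "0 \<le> t"
  shows "{k. t < y k} = {..<card {k. t < x k}}"
proof -
  obtain f where bij: "bij_betw f {k. y k \<noteq> 0} {k. x k \<noteq> 0}"
    and f: "\<And>k. y k \<noteq> 0 \<Longrightarrow> x (f k) = y k"
    using y unfolding is_decr_reordering_def by blast
  have "f ` {k. t < y k} = {k. t < x k}"
  proof
    show "f ` {k. t < y k} \<subseteq> {k. t < x k}"
      using f t by (smt (verit) image_subsetI mem_Collect_eq)
    show "{k. t < x k} \<subseteq> f ` {k. t < y k}"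
    proof
      fix j assume j: "j \<in> {k. t < x k}"
      then have "j \<in> f ` {k. y k \<noteq> 0}" using bij t by (auto simp: bij_betw_def)
      then show "j \<in> f ` {k. t < y k}" using f j by auto
    qed
  qed
  then have b: "bij_betw f {k. t < y k} {k. t < x k}"
    using bij t by (auto simp: bij_betw_def intro: inj_on_subset)
  have "finite {k. t < x k}" using fin by (rule finite_subset[rotated]) (use t in auto)
  then have fin': "finite {k. t < y k}" and c: "card {k. t < y k} = card {k. t < x k}"
    using b bij_betw_finite bij_betw_same_card by blast+
  have anti: "antimono y" using y unfolding is_decr_reordering_def by blast
  have down: "j \<in> {k. t < y k}" if "j \<le> k" "k \<in> {k. t < y k}" for j k
    using antimonoD[OF anti that(1)] that(2) by auto
  have "\<exists>m. {k. t < y k} = {..<m}"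
  proof (cases "{k. t < y k} = {}")
    case True then show ?thesis by (intro exI[of _ 0]) simp
  next
    case False
    then have "Max {k. t < y k} \<in> {k. t < y k}" using fin' Max_in by blast
    then have "{k. t < y k} = {..<Suc (Max {k. t < y k})}"
      using fin' down by (auto simp: less_Suc_eq_le)
    then show ?thesis by blast
  qed
  then obtain m where m: "{k. t < y k} = {..<m}" by blast
  with c have "m = card {k. t < x k}" by simp
  with m show ?thesis by simp
qed

lemma decr_reordering_ex1:
  fixes x :: "nat \<Rightarrow> real"
  assumes nonneg: "\<And>k. 0 \<le> x k" and fin: "finite {k. x k \<noteq> 0}"
  shows "\<exists>!y. is_decr_reordering x y"
proof -
  define ks where "ks = sort_key (\<lambda>k. - x k) (sorted_list_of_set {k. x k \<noteq> 0})"
  define y where "y = (\<lambda>k. if k < length ks then x (ks ! k) else 0)"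
  have set_ks: "set ks = {k. x k \<noteq> 0}" and dist: "distinct ks"
    using fin by (simp_all add: ks_def)
  have sorted: "sorted (map (\<lambda>k. - x k) ks)" by (simp add: ks_def)
  have ne: "x (ks ! k) \<noteq> 0" if "k < length ks" for k
    using set_ks nth_mem[OF that] by auto
  have supp: "{k. y k \<noteq> 0} = {..<length ks}" using ne by (auto simp: y_def)
  have "antimono y"
  proof (rule antimonoI)
    fix i j :: nat assume ij: "i \<le> j"
    show "y j \<le> y i"
    proof (cases "j < length ks")
      case True
      then have "map (\<lambda>k. - x k) ks ! i \<le> map (\<lambda>k. - x k) ks ! j"
        using sorted ij by (intro sorted_nth_mono) auto
      then show ?thesis using True ij by (simp add: y_def)
    next
      case False
      then show ?thesis by (simp add: y_def nonneg)
    qed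
  qed
  moreover have "bij_betw ((!) ks) {k. y k \<noteq> 0} {k. x k \<noteq> 0}"
    unfolding supp by (intro bij_betw_nth) (simp_all add: dist set_ks)
  moreover have "\<forall>k. y k \<noteq> 0 \<longrightarrow> x (ks ! k) = y k" by (auto simp: y_def)
  moreover have "\<forall>k. 0 \<le> y k" by (simp add: y_def nonneg)
  ultimately have ex: "is_decr_reordering x y" unfolding is_decr_reordering_def by blast
  have "u = v" if u: "is_decr_reordering x u" and v: "is_decr_reordering x v" for u v
  proof
    fix k
    have nn: "0 \<le> u k" "0 \<le> v k" using u v unfolding is_decr_reordering_def by auto
    have "{k. t < u k} = {k. t < v k}" if "0 \<le> t" for t
      using superlevel_set_eq[OF fin u that] superlevel_set_eq[OF fin v that] by simp
    then have "\<not> u k < v k" "\<not> v k < u k" using nn by blast+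
    then show "u k = v k" by simp
  qed
  with ex show ?thesis by blast
qed

definition mittag_leffler_law :: "real \<Rightarrow> real \<Rightarrow> real measure \<Rightarrow> bool" where
  "mittag_leffler_law \<kappa> b N \<longleftrightarrow>
     prob_space N \<and> sets N = sets borel \<and> (AE x in N. 0 \<le> x) \<and>
     (\<forall>l>0. (\<integral> x. exp (- l * x) \<partial>N) = (\<Sum>n. (- b * l) ^ n / Gamma (1 + \<kappa> * real n)))"

definition standardized :: "'s measure \<Rightarrow> ('s \<Rightarrow> real) \<Rightarrow> 's \<Rightarrow> real" where
  "standardized M Z s =
     (Z s - prob_space.expectation M Z) / sqrt (prob_space.variance M Z)"

text \<open>For i.i.d. square-integrable \<open>Y\<^sub>k\<close> and square-summable \<open>x\<close> the series converges almost surely.\<close>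

definition tensor_sum :: "'s measure \<Rightarrow> (nat \<Rightarrow> 's \<Rightarrow> real) \<Rightarrow> (nat \<Rightarrow> real) \<Rightarrow> 's \<Rightarrow> real" where
  "tensor_sum M Y x s = (\<Sum>k. x k * standardized M (Y k) s)"

definition gauss_coeff :: "(nat \<Rightarrow> real) \<Rightarrow> real" where
  "gauss_coeff x = sqrt (1 - (\<Sum>k. (x k)\<^sup>2))"

definition converges_in_law ::
  "'s measure \<Rightarrow> (nat \<Rightarrow> 's \<Rightarrow> real) \<Rightarrow> 'q measure \<Rightarrow> ('q \<Rightarrow> real) \<Rightarrow> bool"
where
  "converges_in_law M W Q W' \<longleftrightarrow>
     weak_conv_m (\<lambda>j. distr M borel (W j)) (distr Q borel W')"

definition uniformly_integrable :: "'s measure \<Rightarrow> (nat \<Rightarrow> 's \<Rightarrow> real) \<Rightarrow> bool" where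
  "uniformly_integrable M f \<longleftrightarrow>
     (\<forall>j. integrable M (f j)) \<and>
     (\<forall>\<epsilon>>0. \<exists>K. \<forall>j. (\<integral> s. \<bar>f j s\<bar> * indicator {s. K < \<bar>f j s\<bar>} s \<partial>M) < \<epsilon>)"

definition converges_in_law_Lp ::
  "real \<Rightarrow> 's measure \<Rightarrow> (nat \<Rightarrow> 's \<Rightarrow> real) \<Rightarrow> 'q measure \<Rightarrow> ('q \<Rightarrow> real) \<Rightarrow> bool"
where
  "converges_in_law_Lp p M W Q W' \<longleftrightarrow>
     converges_in_law M W Q W' \<and> uniformly_integrable M (\<lambda>j s. \<bar>W j s\<bar> powr p)"

end

theory Submission
  imports Defs "HOL-Complex_Analysis.Cauchy_Integral_Formula" "HOL-Real_Asymp.Real_Asymp"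
begin

text \<open>
  Averaging over the independent environments turns \<open>X\<^sub>n\<close> into a sum of independent increments, the
  \<open>k\<close>-th one distributed as \<open>Z\<close> at time \<open>T\<^sub>k\<^sub>,\<^sub>n\<close>. Hence the characteristic function of the normalized
  walk is a product over \<open>k\<close>. After reordering, the finitely many largest weights give the factors of
  the Mittag-Leffler series, because there \<open>T\<^sub>k\<^sub>,\<^sub>n \<rightarrow> \<infinity>\<close>; the remaining weights are uniformly small and
  their factors combine to a Gaussian one, whose variance is found from the assumption on
  \<open>Var(X\<^sub>n)\<close>. Levy's continuity theorem concludes.

  All moment control comes from a uniform bound on \<open>E[exp(a|Z\<^sub>n|/n\<^sup>\<kappa>)]\<close>. To the left, the scale function
  and \<open>E[\<rho>\<^bsup>\<kappa>/2\<^esup>] < 1\<close> (non-lattice and Cauchy-Schwarz) make the probability of backtracking a distance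
  \<open>d\<close> exponentially small in \<open>d\<close>. To the right, \<open>P(Z\<^sub>n \<ge> m L)\<close> is compared with the Laplace transform
  of the crossing times of \<open>m\<close> blocks of length \<open>L \<sim> K n\<^sup>\<kappa>\<close> by walks reflected at the left end of each
  block. These are independent, and each contributes a factor bounded away from \<open>1\<close>: with positive
  probability the walk does not backtrack at the start, and then by tightness of \<open>Z\<^sub>n / n\<^sup>\<kappa>\<close> it needs a
  time of order \<open>n\<close> to cross the block.
\<close>

section \<open>Annealed walks and their increments\<close>

text \<open>Two kinds of increments have to be separated. One of asymptotically positive relative
  weight is long, because \<open>V n\<close> tends to infinity, and is governed by the limit law of
  the walk. One of small weight may have bounded length, and then its normalized variance need not
  be close to that of the limit. Only the weighted average of all these variances is prescribed, by
  the hypothesis on Var(X_n), and this is exactly what the Gaussian factor needs.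

  For \<kappa> < 1, Jensen's inequality and E[\<rho>^\<kappa>] = 1 give E[\<rho>] \<ge> 1, so mean
  values of scale functions do not decay. Their powers of order \<kappa>/2 do, at the rate
  \<open>\<theta>\<close> = E[\<rho>^(\<kappa>/2)].

  All estimates of the walk are comparisons, in a fixed environment, of the backward recursion with
  a super- or subsolution, by induction on the number of steps; the average over the environment
  comes last. The exponential moment is then used three times: for convergence of mean and variance,
  which weak convergence alone does not give, for a uniform Taylor expansion of the characteristic
  functions, and for uniform integrability of all powers.\<close>

primrec quenched :: "(nat \<Rightarrow> int \<Rightarrow> real) \<Rightarrow> nat \<Rightarrow> nat \<Rightarrow> (int \<Rightarrow> 'b::real_vector) \<Rightarrow> int \<Rightarrow> 'b" where
  "quenched w m 0 g x = g x"
| "quenched w m (Suc n) g x =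
     w m x *\<^sub>R quenched w (Suc m) n g (x + 1) + (1 - w m x) *\<^sub>R quenched w (Suc m) n g (x - 1)"

text \<open>Chapman-Kolmogorov equation: \<open>quenched w m n g x\<close> is the mean of
  \<open>g\<close> at the position reached after \<open>n\<close> steps by a walk that is at
  \<open>x\<close> at time \<open>m\<close>. The environment may depend on time, which covers the
  cooling walk, and \<open>g\<close> may be vector-valued, so that one recursion serves moments as
  well as characteristic functions.\<close>

lemma quenched_add:
  "quenched w m (n + k) g x = quenched w m n (quenched w (m + n) k g) x"
  by (induction n arbitrary: m x) simp_all

lemma quenched_cong:
  assumes "\<And>i y. i < n \<Longrightarrow> w (m + i) y = w' (m' + i) y"
  shows "quenched w m n g x = quenched w' m' n g x"
  using assms
proof (induction n arbitrary: m m' x)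
  case (Suc n)
  have "quenched w (Suc m) n g y = quenched w' (Suc m') n g y" for y
    using Suc.prems[of "Suc i" for i] by (intro Suc.IH) simp
  then show ?case using Suc.prems[of 0] by simp
qed simp

lemma quenched_shift:
  "quenched w m n g (x + y) = quenched (\<lambda>i z. w i (y + z)) m n (\<lambda>z. g (z + y)) x"
proof (induction n arbitrary: m x)
  case (Suc n)
  have "x + y + 1 = (x + 1) + y" "x + y - 1 = (x - 1) + y" "y + x = x + y" by simp_all
  then show ?case by (simp only: quenched.simps Suc)
qed simp

text \<open>Expansion along the transition kernel of \<open>n\<close> steps. When the environment
  changes at a given time, this writes the mean as a finite sum of products, a kernel seeing only
  the old environments times a function seeing only the new one.\<close>

lemma quenched_linear_combination:
  fixes h :: "int \<Rightarrow> 'b::real_vector"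
  assumes "finite F" "\<And>y. \<bar>y - x\<bar> \<le> int n \<Longrightarrow> y \<in> F"
  shows "quenched w m n h x = (\<Sum>y\<in>F. quenched w m n (\<lambda>z. of_bool (z = y) :: real) x *\<^sub>R h y)"
  using assms(2)
proof (induction n arbitrary: m x)
  case 0
  then have "x \<in> F" by simp
  have "(\<Sum>y\<in>F. (of_bool (x = y) :: real) *\<^sub>R h y) = (\<Sum>y\<in>F. if x = y then h y else 0)"
    by (intro sum.cong) auto
  then show ?case using \<open>x \<in> F\<close> assms(1) by simp
next
  case (Suc n)
  have 1: "quenched w (Suc m) n h (x + 1) =
      (\<Sum>y\<in>F. quenched w (Suc m) n (\<lambda>z. of_bool (z = y) :: real) (x + 1) *\<^sub>R h y)"
    by (rule Suc.IH) (use Suc.prems in force)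
  have 2: "quenched w (Suc m) n h (x - 1) =
      (\<Sum>y\<in>F. quenched w (Suc m) n (\<lambda>z. of_bool (z = y) :: real) (x - 1) *\<^sub>R h y)"
    by (rule Suc.IH) (use Suc.prems in force)
  show ?case
    by (simp add: 1 2 scaleR_sum_right scaleR_add_left sum.distrib)
qed

lemma quenched_norm_le:
  fixes g :: "int \<Rightarrow> 'b::real_normed_vector"
  assumes "\<And>i y. 0 \<le> w i y \<and> w i y \<le> 1" and "\<And>y. \<bar>y - x\<bar> \<le> int n \<Longrightarrow> norm (g y) \<le> C"
  shows "norm (quenched w m n g x) \<le> C"
  using assms(2)
proof (induction n arbitrary: m x)
  case (Suc n)
  have 1: "norm (quenched w (Suc m) n g (x + 1)) \<le> C"
    by (rule Suc.IH) (use Suc.prems in force)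
  have 2: "norm (quenched w (Suc m) n g (x - 1)) \<le> C"
    by (rule Suc.IH) (use Suc.prems in force)
  have w: "0 \<le> w m x" "w m x \<le> 1" using assms(1) by auto
  have "norm (quenched w m (Suc n) g x) \<le>
      w m x * norm (quenched w (Suc m) n g (x + 1)) + (1 - w m x) * norm (quenched w (Suc m) n g
          (x - 1))"
    using w by (auto intro!: norm_triangle_le)
  also have "\<dots> \<le> w m x * C + (1 - w m x) * C"
    using w 1 2 by (intro add_mono mult_left_mono) auto
  finally show ?case by (simp add: algebra_simps)
qed auto

lemma measurable_quenched:
  fixes g :: "int \<Rightarrow> 'b::{real_normed_vector, second_countable_topology}"
  assumes "\<And>i y. i < n \<Longrightarrow> (\<lambda>s. w s (m + i) y) \<in> borel_measurable M"
  shows "(\<lambda>s. quenched (w s) m n g x) \<in> borel_measurable M"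
  using assms
proof (induction n arbitrary: m x)
  case (Suc n)
  have [measurable]: "(\<lambda>s. quenched (w s) (Suc m) n g y) \<in> borel_measurable M" for y
    by (rule Suc.IH) (use Suc.prems[of "Suc i" for i] in simp)
  have [measurable]: "(\<lambda>s. w s m y) \<in> borel_measurable M" for y
    using Suc.prems[of 0] by simp
  show ?case by simp
qed simp

section \<open>Path weights and the law of the walk at a fixed time\<close>

definition path_weight :: "(nat \<Rightarrow> int \<Rightarrow> real) \<Rightarrow> nat \<Rightarrow> (nat \<Rightarrow> int) \<Rightarrow> real" where
  "path_weight w n z = of_bool (z 0 = 0) * (\<Prod>m<n. jump_prob (w m (z m)) (z m) (z (Suc m)))"

lemma path_weight_cong:
  "(\<And>i. i \<le> n \<Longrightarrow> z i = z' i) \<Longrightarrow> path_weight w n z = path_weight w n z'"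
  unfolding path_weight_def by (intro arg_cong2[where f = "(*)"] prod.cong) auto

lemma path_weight_Suc:
  "path_weight w (Suc n) z = path_weight w n z * jump_prob (w n (z n)) (z n) (z (Suc n))"
  by (simp add: path_weight_def)

locale walk_in_random_env =
  fixes \<alpha> :: "real measure" and e :: "nat \<Rightarrow> int \<Rightarrow> 'i" and M :: "'s measure"
    and \<omega> :: "'i \<Rightarrow> 's \<Rightarrow> real" and X :: "nat \<Rightarrow> 's \<Rightarrow> int"
  assumes walk: "annealed_walk \<alpha> e M \<omega> X"
    and unit_interval: "distribution_on_unit_interval \<alpha>"
begin

sublocale prob_space M
  using walk by (simp add: annealed_walk_def)

lemma indep: "indep_vars (\<lambda>_. borel) \<omega> UNIV"
  using walk by (simp add: annealed_walk_def)

lemma distr_field: "distr M borel (\<omega> i) = \<alpha>"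
  using walk by (simp add: annealed_walk_def)

lemma measurable_field [measurable]: "\<omega> i \<in> borel_measurable M"
  using indep by (simp add: indep_vars_def)

lemma measurable_walk [measurable]: "X n \<in> measurable M (count_space UNIV)"
  using walk by (simp add: annealed_walk_def)

lemma AE_unit_interval: "AE s in M. 0 \<le> \<omega> i s \<and> \<omega> i s \<le> 1"
proof -
  have "AE w in distr M borel (\<omega> i). 0 \<le> w \<and> w \<le> 1"
    using unit_interval unfolding distr_field by (simp add: distribution_on_unit_interval_def)
  then show ?thesis by (subst (asm) AE_distr_iff) auto
qed

lemma AE_quenched_prob: "AE s in M. \<forall>m x. 0 \<le> \<omega> (e m x) s \<and> \<omega> (e m x) s \<le> 1"
  unfolding AE_all_countable using AE_unit_interval by blast

lemma measurable_path_weight [measurable]: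
  "(\<lambda>s. path_weight (\<lambda>i y. \<omega> (e i y) s) n z) \<in> borel_measurable M"
  unfolding path_weight_def jump_prob_def by measurable

lemma path_weight_bounds:
  assumes "\<And>i y. 0 \<le> w i y \<and> w i y \<le> 1"
  shows "0 \<le> path_weight w n z" "path_weight w n z \<le> 1"
proof -
  have *: "0 \<le> jump_prob (w m (z m)) (z m) (z (Suc m))"
      "jump_prob (w m (z m)) (z m) (z (Suc m)) \<le> 1" for m
    using assms by (auto simp: jump_prob_def)
  show "0 \<le> path_weight w n z" unfolding path_weight_def
    using * by (intro mult_nonneg_nonneg prod_nonneg) auto
  have "(\<Prod>m<n. jump_prob (w m (z m)) (z m) (z (Suc m))) \<le> 1"
    using * by (intro prod_le_1) auto
  then show "path_weight w n z \<le> 1" unfolding path_weight_def by (cases "z 0 = 0") auto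
qed

lemma prob_path:
  "prob {s \<in> space M. \<forall>m\<le>n. X m s = z m} = (\<integral>s. path_weight (\<lambda>i y. \<omega> (e i y) s) n z \<partial>M)"
proof -
  have "UNIV \<in> sets (PiM UNIV (\<lambda>_::'i. borel :: real measure))"
    using sets.top[of "PiM UNIV (\<lambda>_::'i. borel :: real measure)"]
    by (simp add: space_PiM)
  with walk have "prob {s \<in> space M. (\<lambda>i. \<omega> i s) \<in> UNIV \<and> (\<forall>m\<le>n. X m s = z m)} =
        (\<integral> s. indicator UNIV (\<lambda>i. \<omega> i s) * of_bool (z 0 = 0) *
               (\<Prod>m<n. jump_prob (\<omega> (e m (z m)) s) (z m) (z (Suc m))) \<partial>M)"
    unfolding annealed_walk_def by blast
  then show ?thesis by (simp add: path_weight_def)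
qed

text \<open>The law of the walk is given only through finite path segments. Segments violating the
  claim have weight zero, and coding them as finite lists makes them countably many, so their union
  is null.\<close>

lemma AE_nearest_neighbour: "AE s in M. X 0 s = 0 \<and> (\<forall>m. \<bar>X (Suc m) s - X m s\<bar> = 1)"
proof -
  define bad :: "(nat \<times> int list) set" where
    "bad = {(n, zs). length zs = n + 2 \<and> (zs ! 0 \<noteq> 0 \<or> (\<exists>m\<le>n. \<bar>zs ! Suc m - zs ! m\<bar> \<noteq> 1))}"
  have "AE s in M. \<not> (\<forall>m\<le>Suc n. X m s = zs ! m)" if "(n, zs) \<in> bad" for n zs
  proof -
    have "path_weight w (Suc n) ((!) zs) = 0" for w
    proof -
      from that consider "zs ! 0 \<noteq> 0" | m where "m \<le> n" "\<bar>zs ! Suc m - zs ! m\<bar> \<noteq> 1"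
        by (auto simp: bad_def)
      then show ?thesis
      proof cases
        case 2
        then have "jump_prob (w m (zs ! m)) (zs ! m) (zs ! Suc m) = 0"
          by (auto simp: jump_prob_def)
        with 2(1) have "(\<Prod>m<Suc n. jump_prob (w m (zs ! m)) (zs ! m) (zs ! Suc m)) = 0"
          by (intro prod_zero bexI[of _ m]) auto
        then show ?thesis unfolding path_weight_def by simp
      qed (simp add: path_weight_def)
    qed
    then have "prob {s \<in> space M. \<forall>m\<le>Suc n. X m s = zs ! m} = 0"
      unfolding prob_path by simp
    then have "{s \<in> space M. \<forall>m\<le>Suc n. X m s = zs ! m} \<in> null_sets M"
      by (intro null_setsI) (auto simp: emeasure_eq_measure)
    from AE_not_in[OF this] show ?thesis by (rule AE_mp) auto
  qed
  moreover have "countable bad" by simp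
  ultimately have "AE s in M. \<forall>p\<in>bad. \<not> (\<forall>m\<le>Suc (fst p). X m s = snd p ! m)"
    by (subst AE_ball_countable) auto
  then show ?thesis
  proof eventually_elim
    case (elim s)
    have *: "(n, map (\<lambda>m. X m s) [0..<n+2]) \<notin> bad" for n
    proof
      assume "(n, map (\<lambda>m. X m s) [0..<n+2]) \<in> bad"
      with elim obtain m where "m \<le> Suc n" "X m s \<noteq> map (\<lambda>m. X m s) [0..<n+2] ! m"
        by force
      then show False by (simp del: upt_Suc)
    qed
    have "X 0 s = 0" using *[of 0] by (auto simp: bad_def simp del: upt_Suc)
    moreover have "\<bar>X (Suc m) s - X m s\<bar> = 1" for m
      using *[of m] by (auto simp: bad_def simp del: upt_Suc)
    ultimately show ?case by blast
  qed
qed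

lemma AE_walk_bound: "AE s in M. \<forall>n. \<bar>X n s\<bar> \<le> int n"
  using AE_nearest_neighbour
proof eventually_elim
  case (elim s)
  have "\<bar>X n s\<bar> \<le> int n" for n
  proof (induction n)
    case (Suc n)
    then show ?case using elim[THEN conjunct2, rule_format, of n] by auto
  qed (use elim in simp)
  then show ?case by blast
qed

text \<open>At a fixed time the walk takes finitely many values almost surely, so every function of
  it is integrable, whatever its growth. This settles nearly all integrability questions
  below.\<close>

lemma integrable_walk:
  fixes g :: "int \<Rightarrow> 'b::{banach, second_countable_topology}"
  shows "integrable M (\<lambda>s. g (X n s))"
proof (rule integrable_const_bound)
  show "AE s in M. norm (g (X n s)) \<le> Max ((\<lambda>y. norm (g y)) ` {- int n..int n})"
    using AE_walk_bound
  proof eventually_elim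
    case (elim s)
    then have "\<bar>X n s\<bar> \<le> int n" by blast
    then show ?case by (intro Max_ge imageI) auto
  qed
qed measurable

lemma quenched_measurable [measurable]:
  fixes g :: "int \<Rightarrow> 'b::{real_normed_vector, second_countable_topology}"
  shows "(\<lambda>s. quenched (\<lambda>i y. \<omega> (e i y) s) m n g x) \<in> borel_measurable M"
  by (rule measurable_quenched) auto

lemma AE_quenched_norm_le:
  fixes g :: "int \<Rightarrow> 'b::real_normed_vector"
  shows "AE s in M. norm (quenched (\<lambda>i y. \<omega> (e i y) s) m n g x)
      \<le> Max ((\<lambda>y. norm (g y)) ` {x - int n..x + int n})"
  using AE_quenched_prob
proof eventually_elim
  case (elim s)
  show ?case
    by (rule quenched_norm_le) (use elim in \<open>auto intro!: Max_ge imageI\<close>)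
qed

lemma integrable_quenched:
  fixes g :: "int \<Rightarrow> 'b::{banach, second_countable_topology}"
  shows "integrable M (\<lambda>s. quenched (\<lambda>i y. \<omega> (e i y) s) m n g x)"
  by (rule integrable_const_bound[OF AE_quenched_norm_le]) measurable

text \<open>For \<open>n = 0\<close> this is the defining property of the walk. In the induction the
  event of a given past is split according to the next step: one unit of time moves from the future
  into the past, which is why \<open>m\<close> and \<open>z\<close> are generalized.\<close>

lemma integral_path_walk:
  fixes g :: "int \<Rightarrow> 'b::{banach, second_countable_topology}"
  shows "(\<integral>s. indicator {s. \<forall>i\<le>m. X i s = z i} s *\<^sub>R g (X (m + n) s) \<partial>M) =
    (\<integral>s. path_weight (\<lambda>i y. \<omega> (e i y) s) m z *\<^sub>R
          quenched (\<lambda>i y. \<omega> (e i y) s) m n g (z m) \<partial>M)"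
proof (induction n arbitrary: m z)
  case 0
  have "(\<integral>s. indicator {s. \<forall>i\<le>m. X i s = z i} s *\<^sub>R g (X (m + 0) s) \<partial>M) =
      (\<integral>s. indicator {s. \<forall>i\<le>m. X i s = z i} s *\<^sub>R g (z m) \<partial>M)"
    by (intro Bochner_Integration.integral_cong) (auto simp: indicator_def)
  also have "\<dots> = (\<integral>s. indicator {s \<in> space M. \<forall>i\<le>m. X i s = z i} s *\<^sub>R g (z m) \<partial>M)"
    by (intro Bochner_Integration.integral_cong) (auto simp: indicator_def)
  also have "\<dots> = prob {s \<in> space M. \<forall>i\<le>m. X i s = z i} *\<^sub>R g (z m)"
    by (subst integral_scaleR_left) (auto simp: emeasure_eq_measure)
  also have "\<dots> = (\<integral>s. path_weight (\<lambda>i y. \<omega> (e i y) s) m z *\<^sub>R g (z m) \<partial>M)"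
    unfolding prob_path
  proof (subst integral_scaleR_left)
    show "integrable M (\<lambda>s. path_weight (\<lambda>i y. \<omega> (e i y) s) m z)"
    proof (rule integrable_const_bound[where B = 1])
      show "AE s in M. norm (path_weight (\<lambda>i y. \<omega> (e i y) s) m z) \<le> 1"
        using AE_quenched_prob
        by eventually_elim (use path_weight_bounds in force)
    qed measurable
  qed simp
  finally show ?case by simp
next
  case (Suc n)
  let ?w = "\<lambda>s i y. \<omega> (e i y) s"
  let ?up = "z(Suc m := z m + 1)" and ?dn = "z(Suc m := z m - 1)"
  let ?A = "\<lambda>m z. {s. \<forall>i\<le>m. X i s = z i}"
  have int1: "integrable M (\<lambda>s. indicator (?A m' z') s *\<^sub>R g (X k s))" for m' z' k
    by (rule Bochner_Integration.integrable_bound[OF integrable_walk[of g k]])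
       (auto simp: indicator_def)
  have int2: "integrable M (\<lambda>s. path_weight (?w s) m' z' *\<^sub>R quenched (?w s) i k g x)" for m' z' i
      k x
  proof (rule Bochner_Integration.integrable_bound[OF integrable_quenched[of i k g x]])
    show "AE s in M. norm (path_weight (?w s) m' z' *\<^sub>R quenched (?w s) i k g x)
        \<le> norm (quenched (?w s) i k g x)"
      using AE_quenched_prob
    proof eventually_elim
      case (elim s)
      then show ?case using path_weight_bounds[of "?w s" m' z']
        by (simp add: mult_left_le_one_le)
    qed
  qed measurable
  have "(\<integral>s. indicator (?A m z) s *\<^sub>R g (X (m + Suc n) s) \<partial>M) =
    (\<integral>s. indicator (?A (Suc m) ?up) s *\<^sub>R g (X (Suc m + n) s)
        + indicator (?A (Suc m) ?dn) s *\<^sub>R g (X (Suc m + n) s) \<partial>M)"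
  proof (rule integral_cong_AE)
    show "AE s in M. indicator (?A m z) s *\<^sub>R g (X (m + Suc n) s) =
       indicator (?A (Suc m) ?up) s *\<^sub>R g (X (Suc m + n) s)
        + indicator (?A (Suc m) ?dn) s *\<^sub>R g (X (Suc m + n) s)"
      using AE_nearest_neighbour
    proof eventually_elim
      case (elim s)
      then have "\<bar>X (Suc m) s - X m s\<bar> = 1" by blast
      then consider "X (Suc m) s = X m s + 1" | "X (Suc m) s = X m s - 1" by linarith
      then show ?case
        by cases (auto simp: indicator_def le_Suc_eq)
    qed
  qed measurable
  also have "\<dots> = (\<integral>s. indicator (?A (Suc m) ?up) s *\<^sub>R g (X (Suc m + n) s) \<partial>M)
      + (\<integral>s. indicator (?A (Suc m) ?dn) s *\<^sub>R g (X (Suc m + n) s) \<partial>M)"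
    by (intro Bochner_Integration.integral_add int1)
  also have "\<dots> = (\<integral>s. path_weight (?w s) (Suc m) ?up *\<^sub>R quenched (?w s) (Suc m) n g (z m + 1) \<partial>M)
       + (\<integral>s. path_weight (?w s) (Suc m) ?dn *\<^sub>R quenched (?w s) (Suc m) n g (z m - 1) \<partial>M)"
    using Suc.IH[of "Suc m" ?up] Suc.IH[of "Suc m" ?dn] by (simp only: fun_upd_same)
  also have "\<dots> = (\<integral>s. path_weight (?w s) (Suc m) ?up *\<^sub>R quenched (?w s) (Suc m) n g (z m + 1)
       + path_weight (?w s) (Suc m) ?dn *\<^sub>R quenched (?w s) (Suc m) n g (z m - 1) \<partial>M)"
    by (intro Bochner_Integration.integral_add[symmetric] int2)
  also have "\<dots> = (\<integral>s. path_weight (?w s) m z *\<^sub>R quenched (?w s) m (Suc n) g (z m) \<partial>M)"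
  proof (intro Bochner_Integration.integral_cong refl)
    fix s
    have eq: "path_weight (?w s) m ?up = path_weight (?w s) m z"
      "path_weight (?w s) m ?dn = path_weight (?w s) m z"
      by (rule path_weight_cong; simp)+
    have "path_weight (?w s) (Suc m) ?up = path_weight (?w s) m z * \<omega> (e m (z m)) s"
      by (simp add: path_weight_Suc eq jump_prob_def)
    moreover have "path_weight (?w s) (Suc m) ?dn = path_weight (?w s) m z * (1 - \<omega> (e m (z m)) s)"
      by (simp add: path_weight_Suc eq jump_prob_def)
    ultimately show "path_weight (?w s) (Suc m) ?up *\<^sub>R quenched (?w s) (Suc m) n g (z m + 1)
       + path_weight (?w s) (Suc m) ?dn *\<^sub>R quenched (?w s) (Suc m) n g (z m - 1)
       = path_weight (?w s) m z *\<^sub>R quenched (?w s) m (Suc n) g (z m)"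
      by (simp add: scaleR_add_right)
  qed
  finally show ?case .
qed

text \<open>The annealed law at time \<open>n\<close> is the average of the quenched ones. From here
  on the walk is used only through its laws at single times and through
  \<open>AE_nearest_neighbour\<close> and its consequences.\<close>

theorem integral_walk:
  fixes g :: "int \<Rightarrow> 'b::{banach, second_countable_topology}"
  shows "(\<integral>s. g (X n s) \<partial>M) = (\<integral>s. quenched (\<lambda>i y. \<omega> (e i y) s) 0 n g 0 \<partial>M)"
proof -
  have "(\<integral>s. g (X n s) \<partial>M) = (\<integral>s. indicator {s. \<forall>i\<le>0. X i s = 0} s *\<^sub>R g (X (0 + n) s) \<partial>M)"
    using AE_nearest_neighbour
    by (intro integral_cong_AE) (auto elim!: eventually_mono)
  also have "\<dots> = (\<integral>s. quenched (\<lambda>i y. \<omega> (e i y) s) 0 n g 0 \<partial>M)"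
    unfolding integral_path_walk[where z = "\<lambda>_. 0"] by (simp add: path_weight_def)
  finally show ?thesis .
qed

text \<open>Used in two ways: to extract one environment from the field of the cooling walk, and to
  shift an environment in space.\<close>

lemma distr_field_reindex:
  assumes "inj f"
  shows "distr M (PiM UNIV (\<lambda>_. borel)) (\<lambda>s j. \<omega> (f j) s) = PiM UNIV (\<lambda>_. \<alpha>)"
proof -
  have [measurable_cong]: "sets (PiM UNIV (\<lambda>_. \<alpha>)) = sets (PiM UNIV (\<lambda>_. borel))"
    using unit_interval by (intro sets_PiM_cong) (auto simp: distribution_on_unit_interval_def)
  have sp: "space \<alpha> = UNIV"
    using unit_interval sets_eq_imp_space_eq[of \<alpha> borel]
    by (simp add: distribution_on_unit_interval_def)
  have "distr M (PiM UNIV (\<lambda>_. borel)) (\<lambda>s. \<lambda>i\<in>UNIV. \<omega> i s) = PiM UNIV (\<lambda>i. distr M borel (\<omega> i))"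
    using indep by (subst (asm) indep_vars_iff_distr_eq_PiM) auto
  then have all: "distr M (PiM UNIV (\<lambda>_. borel)) (\<lambda>s i. \<omega> i s) = PiM UNIV (\<lambda>_. \<alpha>)"
    by (simp add: distr_field restrict_def)
  have "distr (PiM UNIV (\<lambda>_. \<alpha>)) (PiM UNIV (\<lambda>_. \<alpha>)) (\<lambda>v. \<lambda>j\<in>UNIV. v (f j)) = PiM UNIV (\<lambda>_. \<alpha>)"
    using assms unit_interval
    by (intro distr_PiM_reindex) (auto simp: distribution_on_unit_interval_def)
  then have "PiM UNIV (\<lambda>_. \<alpha>) = distr (PiM UNIV (\<lambda>_. \<alpha>)) (PiM UNIV (\<lambda>_. borel)) (\<lambda>v j. v (f j))"
    using unit_interval
    by (subst (asm) distr_cong[OF refl, where L = "PiM UNIV (\<lambda>_. borel)" and g = "\<lambda>v j. v (f j)"])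
       (auto simp: distribution_on_unit_interval_def restrict_def intro!: sets_PiM_cong)
  also have "\<dots> = distr M (PiM UNIV (\<lambda>_. borel)) (\<lambda>s j. \<omega> (f j) s)"
    unfolding all[symmetric]
    by (subst distr_distr) (auto simp: comp_def intro!: measurable_PiM_single')
  finally show ?thesis by simp
qed

end

section \<open>Cooling times and the convolution of increments\<close>

lemma cooling_map_Suc: "cooling_map T (Suc k) = cooling_map T k + T k"
  by (simp add: cooling_map_def)

lemma cooling_map_mono: "k \<le> l \<Longrightarrow> cooling_map T k \<le> cooling_map T l"
  unfolding cooling_map_def by (intro sum_mono2) auto

lemma cooling_index_eqI:
  assumes "cooling_map T k \<le> n" "n < cooling_map T (Suc k)"
  shows "cooling_index T n = k"
proof -
  have *: "l \<le> k" if "cooling_map T l \<le> n" for l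
    using cooling_map_mono[of "Suc k" l T] assms that by (meson not_less_eq_eq le_trans leD)
  have "Sup {l. cooling_map T l \<le> n} = k"
    by (rule cSup_eq_maximum) (use assms * in auto)
  then show ?thesis by (simp add: cooling_index_def)
qed

lemma cooling_index_bounds:
  assumes "cooling_increments T"
  shows "cooling_map T (cooling_index T n) \<le> n" "n < cooling_map T (Suc (cooling_index T n))"
proof -
  \<comment> \<open>Positivity of the increments bounds the set whose supremum defines the index;
    without a bound, the supremum on natural numbers would carry no information.\<close>
  have ge: "k \<le> cooling_map T k" for k
  proof (induction k)
    case (Suc k)
    moreover have "0 < T k" using assms by (simp add: cooling_increments_def)
    ultimately show ?case by (simp add: cooling_map_Suc)
  qed simp
  have fin: "finite {l. cooling_map T l \<le> n}"
    by (rule finite_subset[of _ "{..n}"]) (use le_trans[OF ge] in auto)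
  have ne: "0 \<in> {l. cooling_map T l \<le> n}" by (simp add: cooling_map_def)
  have Max: "cooling_index T n = Max {l. cooling_map T l \<le> n}"
    unfolding cooling_index_def using fin ne by (intro cSup_eq_Max) auto
  show "cooling_map T (cooling_index T n) \<le> n"
    using Max_in[OF fin] ne unfolding Max by blast
  show "n < cooling_map T (Suc (cooling_index T n))"
  proof (rule ccontr)
    assume "\<not> ?thesis"
    then have "Suc (cooling_index T n) \<in> {l. cooling_map T l \<le> n}" by simp
    from Max_ge[OF fin this] show False unfolding Max by simp
  qed
qed

locale cooling_walk =
  W: walk_in_random_env \<alpha> "\<lambda>n x. (cooling_index T n, x)" M \<omega> X +
  E: walk_in_random_env \<alpha> "\<lambda>_ x. x" ME \<eta> Z
  for \<alpha> T M and \<omega> :: "nat \<times> int \<Rightarrow> 's \<Rightarrow> real" and X ME and \<eta> :: "int \<Rightarrow> 'e \<Rightarrow> real" and Z +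
  assumes cooling: "cooling_increments T"
begin

text \<open>Before time \<open>cooling_map T k\<close> the walk reads only environments of index
  below \<open>k\<close>, and during the next \<open>m\<close> steps only the one of index
  \<open>k\<close>, also when \<open>m = T k\<close>. After the kernel expansion each summand is a
  product of independent factors, and the second factor has the mean of the walk \<open>Z\<close>
  started at \<open>y\<close>, by spatial stationarity.\<close>

lemma integral_convolution:
  fixes g :: "int \<Rightarrow> 'b::{real_normed_field, banach, second_countable_topology}"
  assumes "m \<le> T k"
  shows "(\<integral>s. g (X (cooling_map T k + m) s) \<partial>M)
    = (\<integral>s. (\<integral>u. g (X (cooling_map T k) s + Z m u) \<partial>ME) \<partial>M)"
proof -
  define t where "t = cooling_map T k"
  define F where "F = {- int t..int t}"
  let ?w = "\<lambda>s i y. \<omega> (cooling_index T i, y) s"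
  have idx_lt: "cooling_index T i < k" if "i < t" for i
  proof -
    have "cooling_map T (cooling_index T i) < cooling_map T k"
      using that cooling_index_bounds(1)[OF cooling, of i] by (simp add: t_def)
    then show ?thesis using cooling_map_mono[of k "cooling_index T i" T] by (meson leD not_le)
  qed
  have idx_eq: "cooling_index T (t + i) = k" if "i < m" for i
    using that assms by (intro cooling_index_eqI) (auto simp: t_def cooling_map_Suc)
  \<comment> \<open>\<open>c y\<close> is the quenched probability to be at \<open>y\<close> when
    environment \<open>k\<close> comes into force, and \<open>h y\<close> is the quenched mean over
    the following \<open>m\<close> steps from there.\<close>
  define c where "c y s = quenched (?w s) 0 t (\<lambda>z. of_bool (z = y) :: real) 0" for y s
  define h where "h y s = quenched (?w s) t m g y" for y s
  have h_eq: "h y s = quenched (\<lambda>_ z. \<omega> (k, z) s) 0 m g y" for y s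
    unfolding h_def by (rule quenched_cong) (use idx_eq in simp)
  have int_c: "integrable M (c y)" for y
    unfolding c_def by (rule W.integrable_quenched)
  have int_h: "integrable M (h y)" for y
    unfolding h_def by (rule W.integrable_quenched)
  have indep: "W.indep_var borel (\<lambda>s. of_real (c y s) :: 'b) borel (h y)" for y
  proof -
    let ?A = "{..<k} \<times> (UNIV :: int set)" and ?B = "{k} \<times> (UNIV :: int set)"
    let ?C = "\<lambda>v. of_real (quenched (\<lambda>i z. v (cooling_index T i, z)) 0 t (\<lambda>z. of_bool (z = y) ::
        real) 0) :: 'b"
    let ?H = "\<lambda>v. quenched (\<lambda>_ z. v (k, z)) 0 m g y"
    have C: "?C \<in> measurable (PiM ?A (\<lambda>_. borel)) borel"
      by (intro measurable_compose[OF _ borel_measurable_of_real] measurable_quenched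
           measurable_component_singleton) (use idx_lt in auto)
    have H: "?H \<in> measurable (PiM ?B (\<lambda>_. borel)) borel"
      by (intro measurable_quenched measurable_component_singleton) auto
    have "W.indep_var (PiM ?A (\<lambda>_. borel)) (\<lambda>s. restrict (\<lambda>i. \<omega> i s) ?A)
        (PiM ?B (\<lambda>_. borel)) (\<lambda>s. restrict (\<lambda>i. \<omega> i s) ?B)"
      by (rule W.indep_var_restrict[OF W.indep]) auto
    from W.indep_var_compose[OF this C H]
    have "W.indep_var borel (?C \<circ> (\<lambda>s. restrict (\<lambda>i. \<omega> i s) ?A)) borel (?H \<circ> (\<lambda>s. restrict (\<lambda>i. \<omega>
        i s) ?B))" .
    moreover have "?C \<circ> (\<lambda>s. restrict (\<lambda>i. \<omega> i s) ?A) = (\<lambda>s. of_real (c y s))"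
      unfolding c_def comp_def
      by (intro ext arg_cong[where f = of_real] quenched_cong) (use idx_lt in auto)
    moreover have "?H \<circ> (\<lambda>s. restrict (\<lambda>i. \<omega> i s) ?B) = h y"
      unfolding comp_def h_eq[abs_def] by simp
    ultimately show ?thesis by simp
  qed
  have exp_c: "(\<integral>s. c y s \<partial>M) = (\<integral>s. of_bool (X t s = y) \<partial>M)" for y
    unfolding c_def by (rule W.integral_walk[symmetric])
  have exp_h: "(\<integral>s. h y s \<partial>M) = (\<integral>u. g (y + Z m u) \<partial>ME)" for y
  proof -
    let ?H = "\<lambda>v. quenched (\<lambda>_. v) 0 m (\<lambda>z. g (z + y)) 0"
    have H [measurable]: "?H \<in> borel_measurable (PiM UNIV (\<lambda>_. borel))"
      by (intro measurable_quenched measurable_component_singleton) auto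
    have "(\<integral>s. h y s \<partial>M) = (\<integral>s. ?H (\<lambda>j. \<omega> (k, y + j) s) \<partial>M)"
      using quenched_shift[of "\<lambda>_ z. \<omega> (k, z) s" 0 m g 0 y for s] by (simp add: h_eq)
    also have "\<dots> = (\<integral>v. ?H v \<partial>distr M (PiM UNIV (\<lambda>_. borel)) (\<lambda>s j. \<omega> (k, y + j) s))"
      by (subst integral_distr) (auto intro!: measurable_PiM_single')
    also have "distr M (PiM UNIV (\<lambda>_. borel)) (\<lambda>s j. \<omega> (k, y + j) s) =
        distr ME (PiM UNIV (\<lambda>_. borel)) (\<lambda>s j. \<eta> j s)"
      using W.distr_field_reindex[of "\<lambda>j. (k, y + j)"] E.distr_field_reindex[of "\<lambda>j. j"]
      by (simp add: inj_def)
    also have "(\<integral>v. ?H v \<partial>\<dots>) = (\<integral>u. ?H (\<lambda>j. \<eta> j u) \<partial>ME)"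
      by (subst integral_distr) (auto intro!: measurable_PiM_single')
    also have "\<dots> = (\<integral>u. g (Z m u + y) \<partial>ME)"
      by (rule E.integral_walk[symmetric])
    finally show ?thesis by (simp add: add.commute)
  qed
  have "(\<integral>s. g (X (t + m) s) \<partial>M) = (\<integral>s. quenched (?w s) 0 (t + m) g 0 \<partial>M)"
    by (rule W.integral_walk)
  also have "\<dots> = (\<integral>s. (\<Sum>y\<in>F. of_real (c y s) * h y s) \<partial>M)"
    unfolding quenched_add
    by (subst quenched_linear_combination[where F = F])
       (auto simp: F_def c_def h_def scaleR_conv_of_real)
  also have "\<dots> = (\<Sum>y\<in>F. (\<integral>s. of_real (c y s) * h y s \<partial>M))"
    by (rule Bochner_Integration.integral_sum)
       (intro W.indep_var_integrable indep integrable_of_real int_c int_h)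
  also have "\<dots> = (\<Sum>y\<in>F. (\<integral>s. of_real (c y s) \<partial>M) * (\<integral>s. h y s \<partial>M))"
    by (intro sum.cong refl W.indep_var_lebesgue_integral indep integrable_of_real int_c int_h)
  also have "\<dots> = (\<Sum>y\<in>F. (\<integral>s. of_bool (X t s = y) * (\<integral>u. g (y + Z m u) \<partial>ME) \<partial>M))"
  proof (intro sum.cong refl)
    fix y
    have "(\<integral>s. (of_real (c y s) :: 'b) \<partial>M) = of_real (\<integral>s. c y s \<partial>M)"
      by (rule integral_bounded_linear[OF bounded_linear_of_real int_c])
    also have "\<dots> = (\<integral>s. (of_bool (X t s = y) :: 'b) \<partial>M)"
      unfolding exp_c
      by (subst integral_bounded_linear[OF bounded_linear_of_real, symmetric],
          rule W.integrable_walk)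
         (intro Bochner_Integration.integral_cong refl, simp add: of_bool_def)
    finally show "(\<integral>s. of_real (c y s) \<partial>M) * (\<integral>s. h y s \<partial>M)
        = (\<integral>s. of_bool (X t s = y) * (\<integral>u. g (y + Z m u) \<partial>ME) \<partial>M)"
      by (simp add: exp_h)
  qed
  also have "\<dots> = (\<integral>s. (\<Sum>y\<in>F. of_bool (X t s = y) * (\<integral>u. g (y + Z m u) \<partial>ME)) \<partial>M)"
    by (rule Bochner_Integration.integral_sum[symmetric])
       (rule W.integrable_walk)
  also have "\<dots> = (\<integral>s. (\<integral>u. g (X t s + Z m u) \<partial>ME) \<partial>M)"
  proof (rule integral_cong_AE)
    show "AE s in M. (\<Sum>y\<in>F. of_bool (X t s = y) * (\<integral>u. g (y + Z m u) \<partial>ME)) =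
        (\<integral>u. g (X t s + Z m u) \<partial>ME)"
      using W.AE_walk_bound
    proof eventually_elim
      case (elim s)
      then have "\<bar>X t s\<bar> \<le> int t" by blast
      then have "X t s \<in> F" by (auto simp: F_def)
      have "(\<Sum>y\<in>F. of_bool (X t s = y) * (\<integral>u. g (y + Z m u) \<partial>ME)) =
          (\<Sum>y\<in>F. if X t s = y then (\<integral>u. g (y + Z m u) \<partial>ME) else 0)"
        by (intro sum.cong) auto
      then show ?case using \<open>X t s \<in> F\<close> by (simp add: F_def)
    qed
  qed measurable
  finally show ?thesis by (simp add: t_def)
qed

lemma integral_walk_decomposition:
  fixes g :: "int \<Rightarrow> 'b::{real_normed_field, banach, second_countable_topology}"
  shows "(\<integral>s. g (X n s) \<partial>M) = (\<integral>s. (\<integral>u. g (X (cooling_map T (cooling_index T n)) s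
      + Z (n - cooling_map T (cooling_index T n)) u) \<partial>ME) \<partial>M)"
proof -
  have "n - cooling_map T (cooling_index T n) \<le> T (cooling_index T n)"
    using cooling_index_bounds(2)[OF cooling, of n] by (simp add: cooling_map_Suc)
  from integral_convolution[OF this, of g] show ?thesis
    using cooling_index_bounds(1)[OF cooling, of n] by simp
qed

lemma integral_0: "(\<integral>s. g (X 0 s) \<partial>M) = g 0"
  for g :: "int \<Rightarrow> 'b::{real_normed_field, banach, second_countable_topology}"
proof -
  have "(\<integral>s. g (X 0 s) \<partial>M) = (\<integral>s. g 0 \<partial>M)"
    using W.AE_nearest_neighbour by (intro integral_cong_AE) (auto elim!: eventually_mono)
  then show ?thesis by (simp add: W.prob_space)
qed

lemma truncated_increment_simps:
  "k < cooling_index T n \<Longrightarrow> truncated_increment T n k = T k"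
  "truncated_increment T n (cooling_index T n) = n - cooling_map T (cooling_index T n)"
  "k > cooling_index T n \<Longrightarrow> truncated_increment T n k = 0"
  by (auto simp: truncated_increment_def)

text \<open>A homomorphism into a multiplicative structure factorizes the convolution identity. The
  instances are exponentials with real argument, for moment bounds, and with imaginary argument, for
  characteristic functions.\<close>

lemma integral_multiplicative:
  fixes g :: "int \<Rightarrow> 'b::{real_normed_field, banach, second_countable_topology}"
  assumes g: "\<And>x y. g (x + y) = g x * g y" "g 0 = 1"
  shows "(\<integral>s. g (X n s) \<partial>M) = (\<Prod>k\<le>cooling_index T n. \<integral>u. g (Z (truncated_increment T n k) u) \<partial>ME)"
proof -
  have "(\<integral>s. g (X (cooling_map T k) s) \<partial>M) = (\<Prod>i<k. \<integral>u. g (Z (T i) u) \<partial>ME)" for k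
  proof (induction k)
    case 0
    then show ?case using integral_0[of g] g by (simp add: cooling_map_def)
  next
    case (Suc k)
    then show ?case using integral_convolution[of "T k" k g] by (simp add: cooling_map_Suc g)
  qed
  then show ?thesis unfolding integral_walk_decomposition[of g n]
    by (simp add: g lessThan_Suc_atMost[symmetric] truncated_increment_simps)
qed

lemma expectation_additive:
  "(\<integral>s. real_of_int (X n s) \<partial>M) =
    (\<Sum>k\<le>cooling_index T n. \<integral>u. real_of_int (Z (truncated_increment T n k) u) \<partial>ME)"
proof -
  have *: "(\<integral>s. (\<integral>u. real_of_int (X m s + Z k u) \<partial>ME) \<partial>M) =
      (\<integral>s. real_of_int (X m s) \<partial>M) + (\<integral>u. real_of_int (Z k u) \<partial>ME)" for m k
    using E.integrable_walk[of real_of_int k] W.integrable_walk[of real_of_int m]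
    by (simp add: W.prob_space E.prob_space)
  have "(\<integral>s. real_of_int (X (cooling_map T k) s) \<partial>M) = (\<Sum>i<k. \<integral>u. real_of_int (Z (T i) u) \<partial>ME)"
      for k
  proof (induction k)
    case 0
    then show ?case using integral_0[of real_of_int] by (simp add: cooling_map_def)
  next
    case (Suc k)
    then show ?case using integral_convolution[of "T k" k real_of_int]
      by (simp add: cooling_map_Suc * del: of_int_add)
  qed
  then show ?thesis unfolding integral_walk_decomposition[of real_of_int n]
    by (simp add: * lessThan_Suc_atMost[symmetric] truncated_increment_simps del: of_int_add)
qed

text \<open>The convolution identity for the two functions x and x^2 yields the cancellation of
  cross terms that is familiar for independent summands, without reference to a joint law of the
  increments.\<close>

lemma variance_additive:
  "W.variance (\<lambda>s. real_of_int (X n s)) =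
    (\<Sum>k\<le>cooling_index T n. E.variance (\<lambda>u. real_of_int (Z (truncated_increment T n k) u)))"
proof -
  let ?EX = "\<lambda>n. \<integral>s. real_of_int (X n s) \<partial>M" and ?EZ = "\<lambda>n. \<integral>u. real_of_int (Z n u) \<partial>ME"
  let ?sq = "\<lambda>x. (real_of_int x)\<^sup>2"
  have VX: "W.variance (\<lambda>s. real_of_int (X n s)) = (\<integral>s. ?sq (X n s) \<partial>M) - (?EX n)\<^sup>2" for n
    by (rule W.variance_eq) (rule W.integrable_walk)+
  have VZ: "E.variance (\<lambda>s. real_of_int (Z n s)) = (\<integral>s. ?sq (Z n s) \<partial>ME) - (?EZ n)\<^sup>2" for n
    by (rule E.variance_eq) (rule E.integrable_walk)+
  have iZ: "integrable ME (\<lambda>u. a * real_of_int (Z k u))" "integrable ME (\<lambda>u. ?sq (Z k u))"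
     "integrable ME (\<lambda>u. a * real_of_int (Z k u) + ?sq (Z k u))" for a k
    by (rule E.integrable_walk E.integrable_walk[where g = ?sq]
         E.integrable_walk)+
  have iX: "integrable M (\<lambda>s. ?sq (X m s))" "integrable M (\<lambda>s. real_of_int (X m s))"
     "integrable M (\<lambda>s. 2 * real_of_int (X m s) * a)"
     "integrable M (\<lambda>s. 2 * real_of_int (X m s) * a + b)" for m a b
    by (rule W.integrable_walk[where g = real_of_int] W.integrable_walk[where g = ?sq]
          W.integrable_walk
          W.integrable_walk)+
  have inner: "(\<integral>u. ?sq (x + Z k u) \<partial>ME) =
      ?sq x + (2 * real_of_int x * ?EZ k + (\<integral>u. ?sq (Z k u) \<partial>ME))" for x k
  proof -
    have "(\<integral>u. ?sq (x + Z k u) \<partial>ME) =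
        (\<integral>u. ?sq x + ((2 * real_of_int x) * real_of_int (Z k u) + ?sq (Z k u)) \<partial>ME)"
      by (intro Bochner_Integration.integral_cong) (auto simp: power2_eq_square algebra_simps)
    also have "\<dots> = ?sq x + ((2 * real_of_int x) * ?EZ k + (\<integral>u. ?sq (Z k u) \<partial>ME))"
      using iZ(2,3) iZ(1)[of 1] by (simp add: E.prob_space)
    finally show ?thesis .
  qed
  have sq: "(\<integral>s. (\<integral>u. ?sq (X m s + Z k u) \<partial>ME) \<partial>M) =
      (\<integral>s. ?sq (X m s) \<partial>M) + (2 * ?EX m * ?EZ k + (\<integral>u. ?sq (Z k u) \<partial>ME))" for m k
    unfolding inner using iX by (simp add: W.prob_space)
  have lin: "(\<integral>s. (\<integral>u. real_of_int (X m s + Z k u) \<partial>ME) \<partial>M) = ?EX m + ?EZ k" for m k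
    using E.integrable_walk[of real_of_int k] W.integrable_walk[of real_of_int m]
    by (simp add: W.prob_space E.prob_space)
  have step: "W.variance (\<lambda>s. real_of_int (X n' s)) =
      W.variance (\<lambda>s. real_of_int (X m s)) + E.variance (\<lambda>u. real_of_int (Z k u))"
    if "\<And>g :: int \<Rightarrow> real. (\<integral>s. g (X n' s) \<partial>M) = (\<integral>s. (\<integral>u. g (X m s + Z k u) \<partial>ME) \<partial>M)" for n' m k
    unfolding VX VZ unfolding that[of ?sq] that[of real_of_int] sq lin
    by (simp add: power2_eq_square algebra_simps)
  have V0: "W.variance (\<lambda>s. real_of_int (X 0 s)) = 0"
    unfolding VX using integral_0[of real_of_int] integral_0[of ?sq] by simp
  have "W.variance (\<lambda>s. real_of_int (X (cooling_map T k) s)) =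
      (\<Sum>i<k. E.variance (\<lambda>u. real_of_int (Z (T i) u)))" for k
  proof (induction k)
    case 0
    show ?case using V0 by (simp add: cooling_map_def)
  next
    case (Suc k)
    have "W.variance (\<lambda>s. real_of_int (X (cooling_map T (Suc k)) s)) =
      W.variance (\<lambda>s. real_of_int (X (cooling_map T k) s)) + E.variance (\<lambda>u. real_of_int (Z (T k)
          u))"
      unfolding cooling_map_Suc by (rule step) (rule integral_convolution, simp)
    then show ?case using Suc by simp
  qed
  moreover have "W.variance (\<lambda>s. real_of_int (X n s)) =
      W.variance (\<lambda>s. real_of_int (X (cooling_map T (cooling_index T n)) s))
      + E.variance (\<lambda>u. real_of_int (Z (n - cooling_map T (cooling_index T n)) u))"
    by (rule step) (rule integral_walk_decomposition)
  ultimately show ?thesis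
    by (simp add: lessThan_Suc_atMost[symmetric] truncated_increment_simps)
qed

end

section \<open>Quenched estimates\<close>

lemma powr_half_square: "0 \<le> x \<Longrightarrow> (x powr (a / 2))\<^sup>2 = x powr a" for x a :: real
  by (cases "x = 0") (simp_all add: powr_power)

text \<open>The local \<open>\<rho>\<close> is the odds ratio raised to \<kappa>/2, so its second
  moment is exactly 1 and the mean of (\<open>\<rho>\<close> - 1)^2 equals 2 - 2
  E[\<open>\<rho>\<close>]. If E[\<open>\<rho>\<close>] were at least 1, then \<open>\<rho>\<close>
  = 1 almost surely and the logarithm of the odds would sit at 0, a point of the lattice of
  integers. Finiteness of the moment of order \<kappa> excludes an atom at w = 0.\<close>

lemma kappa_regular_odds:
  assumes reg: "kappa_regular \<kappa> \<alpha>"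
  defines "\<rho> \<equiv> \<lambda>w::real. ((1 - w) / w) powr (\<kappa> / 2)"
  shows "AE w in \<alpha>. 0 < w \<and> w \<le> 1" "integrable \<alpha> \<rho>" "(\<integral>w. \<rho> w \<partial>\<alpha>) < 1"
proof -
  interpret prob_space \<alpha>
    using reg by (simp add: kappa_regular_def distribution_on_unit_interval_def)
  have sets[measurable_cong]: "sets \<alpha> = sets borel"
    using reg by (simp add: kappa_regular_def distribution_on_unit_interval_def)
  have unit: "AE w in \<alpha>. 0 \<le> w \<and> w \<le> 1"
    using reg by (simp add: kappa_regular_def distribution_on_unit_interval_def)
  have one: "(\<integral>\<^sup>+ w. rho_powr \<kappa> w \<partial>\<alpha>) = 1"
    using reg by (simp add: kappa_regular_def)
  have [measurable]: "rho_powr \<kappa> \<in> borel_measurable borel"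
    unfolding rho_powr_def[abs_def] by measurable
  have "AE w in \<alpha>. rho_powr \<kappa> w \<noteq> \<infinity>"
    by (rule nn_integral_PInf_AE) (use one in auto)
  with unit show pos: "AE w in \<alpha>. 0 < w \<and> w \<le> 1"
    by eventually_elim (auto simp: rho_powr_def split: if_splits)
  have [measurable]: "\<rho> \<in> borel_measurable borel"
    unfolding \<rho>_def by measurable
  have "(\<integral>\<^sup>+ w. ennreal ((\<rho> w)\<^sup>2) \<partial>\<alpha>) = (\<integral>\<^sup>+ w. rho_powr \<kappa> w \<partial>\<alpha>)"
    using pos
    by (intro nn_integral_cong_AE, eventually_elim)
       (auto simp: rho_powr_def \<rho>_def powr_half_square)
  then have nn: "(\<integral>\<^sup>+ w. ennreal ((\<rho> w)\<^sup>2) \<partial>\<alpha>) = ennreal 1" using one by simp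
  then have int2: "integrable \<alpha> (\<lambda>w. (\<rho> w)\<^sup>2)"
    by (intro integrableI_nonneg) auto
  have I2: "(\<integral>w. (\<rho> w)\<^sup>2 \<partial>\<alpha>) = 1"
    using nn by (intro integral_eq_nn_integral[THEN trans]) auto
  show int: "integrable \<alpha> \<rho>"
    by (rule square_integrable_imp_integrable[OF _ int2]) measurable
  have intd: "integrable \<alpha> (\<lambda>w. (\<rho> w - 1)\<^sup>2)"
    unfolding power2_diff using int int2 by auto
  have Id: "(\<integral>w. (\<rho> w - 1)\<^sup>2 \<partial>\<alpha>) = 2 - 2 * (\<integral>w. \<rho> w \<partial>\<alpha>)"
    unfolding power2_diff using int int2 by (simp add: I2 prob_space)
  show "(\<integral>w. \<rho> w \<partial>\<alpha>) < 1"
  proof (rule ccontr)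
    assume "\<not> ?thesis"
    with Id have "(\<integral>w. (\<rho> w - 1)\<^sup>2 \<partial>\<alpha>) \<le> 0" by simp
    then have "(\<integral>w. (\<rho> w - 1)\<^sup>2 \<partial>\<alpha>) = 0"
      by (intro antisym) auto
    then have "AE w in \<alpha>. (\<rho> w - 1)\<^sup>2 = 0"
      using integral_nonneg_eq_0_iff_AE[OF intd] by simp
    with pos have "AE w in \<alpha>. log_rho w = ereal (1 * of_int 0)"
    proof eventually_elim
      case (elim w)
      then have "((1 - w) / w) powr (\<kappa> / 2) = 1" by (simp add: \<rho>_def)
      moreover have "\<kappa> > 0" using reg by (simp add: kappa_regular_def)
      moreover have "0 \<le> (1 - w) / w" using elim by simp
      ultimately have "(1 - w) / w = 1"
        by (metis half_gt_zero less_irrefl powr_eq_one_iff_gen powr_zero_eq_one powr_eq_0_iff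
            zero_neq_one order_less_le)
      then show ?case by (auto simp: log_rho_def)
    qed
    then have "AE w in \<alpha>. log_rho w = -\<infinity> \<or> (\<exists>m::int. log_rho w = ereal (1 * of_int m))"
      by eventually_elim blast
    then show False using reg unfolding kappa_regular_def non_lattice_log_rho_def
      using zero_less_one by blast
  qed
qed

abbreviation qexp :: "(int \<Rightarrow> real) \<Rightarrow> nat \<Rightarrow> (int \<Rightarrow> real) \<Rightarrow> int \<Rightarrow> real" where
  "qexp v n g x \<equiv> quenched (\<lambda>_. v) 0 n g x"

lemma qexp_Suc: "qexp v (Suc n) g x = v x * qexp v n g (x + 1) + (1 - v x) * qexp v n g (x - 1)"
proof -
  have "quenched (\<lambda>_. v) (Suc 0) n g y = qexp v n g y" for y
    by (rule quenched_cong) simp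
  then show ?thesis by simp
qed

lemma qexp_nonneg:
  assumes "\<forall>i. 0 \<le> v i \<and> v i \<le> 1" "\<And>z. 0 \<le> g z"
  shows "0 \<le> qexp v n g x"
proof (induction n arbitrary: x)
  case (Suc n)
  then show ?case using assms(1)[rule_format, of x] unfolding qexp_Suc
    by (intro add_nonneg_nonneg mult_nonneg_nonneg) auto
qed (use assms in simp)

lemma qexp_complement:
  "qexp v n (\<lambda>z. of_bool (h \<le> z)) x = 1 - qexp v n (\<lambda>z. of_bool (z < h)) x"
proof (induction n arbitrary: x)
  case (Suc n)
  show ?case unfolding qexp_Suc Suc.IH by (simp add: algebra_simps)
qed auto

section \<open>Scale functions and backtracking\<close>

definition odds :: "(int \<Rightarrow> real) \<Rightarrow> int \<Rightarrow> real" where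
  "odds v i = (1 - v i) / v i"

text \<open>Up to a constant and a sign, the scale function of the walk, truncated at \<open>N\<close>.\<close>

definition trunc_scale :: "int \<Rightarrow> int \<Rightarrow> (int \<Rightarrow> real) \<Rightarrow> int \<Rightarrow> real" where
  "trunc_scale a N v y = (\<Sum>j\<in>{y..<N}. \<Prod>i\<in>{a..j}. odds v i)"

lemma odds_nonneg: "0 < v i \<and> v i \<le> 1 \<Longrightarrow> 0 \<le> odds v i"
  by (simp add: odds_def)

lemma scale_nonneg:
  assumes "\<forall>i. 0 < v i \<and> v i \<le> 1"
  shows "0 \<le> trunc_scale a N v y"
  unfolding trunc_scale_def using assms by (intro sum_nonneg prod_nonneg odds_nonneg) auto

lemma scale_rec: "y < N \<Longrightarrow> trunc_scale a N v y = (\<Prod>i\<in>{a..y}. odds v i) + trunc_scale a N v (y + 1)"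
proof -
  assume "y < N"
  then have "{y..<N} = insert y {y+1..<N}" by auto
  then show ?thesis by (simp add: trunc_scale_def)
qed

text \<open>The product over an empty range is 1, so the truncated scale is at least 1 immediately
  to the left of \<open>a\<close>. This is the boundary value that lets it dominate the probability
  of being below \<open>a\<close>.\<close>

lemma scale_before: "a - 1 < N \<Longrightarrow> trunc_scale a N v (a - 1) = 1 + trunc_scale a N v a"
  by (subst scale_rec) auto

lemma scale_harmonic:
  assumes v: "0 < v y" and y: "a \<le> y" "y < N"
  shows "v y * trunc_scale a N v (y + 1) + (1 - v y) * trunc_scale a N v (y - 1) = trunc_scale a N
      v y"
proof -
  have "{a..y} = insert y {a..y - 1}" using y by auto
  then have "(\<Prod>i\<in>{a..y}. odds v i) = odds v y * (\<Prod>i\<in>{a..y - 1}. odds v i)" by simp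
  moreover have "v y * odds v y = 1 - v y" using v by (simp add: odds_def)
  ultimately have *: "v y * (\<Prod>i\<in>{a..y}. odds v i) = (1 - v y) * (\<Prod>i\<in>{a..y - 1}. odds v i)"
    by (simp add: mult.assoc[symmetric])
  have 1: "trunc_scale a N v (y + 1) = trunc_scale a N v y - (\<Prod>i\<in>{a..y}. odds v i)"
    using scale_rec[of y N a v] y by simp
  have 2: "trunc_scale a N v (y - 1) = trunc_scale a N v y + (\<Prod>i\<in>{a..y-1}. odds v i)"
    using scale_rec[of "y - 1" N a v] y by simp
  show ?thesis unfolding 1 2 using * by (simp add: algebra_simps)
qed

text \<open>The bound is a minimum of the constant 1 and a function harmonic between
  \<open>a\<close> and \<open>N\<close>, extended by 1 to the left of \<open>a\<close>, hence
  superharmonic wherever the induction visits it. The condition \<open>y + int k \<le> N\<close>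
  keeps the walk away from the truncation as long as steps remain.\<close>

lemma backtracking_bound:
  assumes v: "\<forall>i. 0 < v i \<and> v i \<le> 1" and "y + int k \<le> N"
  shows "qexp v k (\<lambda>z. of_bool (z < a)) y \<le> (if y < a then 1 else min 1 (trunc_scale a N v y))"
  using assms(2)
proof (induction k arbitrary: y)
  case 0
  then show ?case using scale_nonneg[OF v] by auto
next
  case (Suc k)
  define H where "H z = (if z < a then 1 else min 1 (trunc_scale a N v z))" for z
  have vy: "0 < v y" "v y \<le> 1" using v[rule_format, of y] by auto
  have "qexp v (Suc k) (\<lambda>z. of_bool (z < a)) y \<le> v y * H (y + 1) + (1 - v y) * H (y - 1)"
    unfolding qexp_Suc H_def using Suc.prems vy
    by (intro add_mono mult_left_mono Suc.IH) auto
  also have "\<dots> \<le> H y"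
  proof -
    have H1: "H z \<le> 1" for z by (simp add: H_def)
    have le1: "v y * H (y + 1) + (1 - v y) * H (y - 1) \<le> 1"
    proof -
      have "v y * H (y + 1) + (1 - v y) * H (y - 1) \<le> v y * 1 + (1 - v y) * 1"
        using vy H1 by (intro add_mono mult_left_mono) auto
      then show ?thesis by simp
    qed
    show ?thesis
    proof (cases "y < a")
      case False
      then have y: "a \<le> y" "y < N" using Suc.prems by auto
      have HS: "H z \<le> trunc_scale a N v z" if "a - 1 \<le> z" for z
      proof (cases "z = a - 1")
        case True
        then show ?thesis using scale_before[of a N v] scale_nonneg[OF v, of a N a] y
          by (simp add: H_def)
      qed (use that in \<open>auto simp: H_def\<close>)
      have "v y * H (y + 1) + (1 - v y) * H (y - 1)
          \<le> v y * trunc_scale a N v (y + 1) + (1 - v y) * trunc_scale a N v (y - 1)"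
        using vy y by (intro add_mono mult_left_mono HS) auto
      also have "\<dots> = trunc_scale a N v y" by (rule scale_harmonic) (use vy y in auto)
      finally show ?thesis using le1 False by (simp add: H_def)
    qed (use le1 in \<open>simp add: H_def\<close>)
  qed
  finally show ?case by (simp add: H_def)
qed

text \<open>\<open>f i\<close> plays the role of the generating function at \<open>c\<close> of the
  time to go from \<open>i\<close> to \<open>i + 1\<close>; \<open>super\<close> makes its product
  up to \<open>x\<close> a supersolution of the equation with discount \<open>c\<close> per step.
  Such a product dominates the Laplace transform of the hitting time of \<open>x\<close>, and
  dividing by \<open>c ^ n\<close> is Markov's inequality.\<close>

lemma crossing_bound:
  assumes v: "\<forall>i. 0 < v i \<and> v i \<le> 1" and c: "0 < c" "c \<le> 1"
    and f: "\<forall>i. 0 \<le> f i \<and> f i \<le> 1"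
    and super: "\<And>y. y < x \<Longrightarrow> c * (v y + (1 - v y) * f (y - 1) * f y) \<le> f y"
  shows "qexp v n (\<lambda>z. of_bool (x \<le> z)) y \<le> (\<Prod>i\<in>{y..<x}. f i) / c ^ n"
proof (induction n arbitrary: y)
  case 0
  then show ?case using f by (auto intro!: prod_nonneg)
next
  case (Suc n)
  define u where "u z = (\<Prod>i\<in>{z..<x}. f i)" for z
  have u: "0 \<le> u z" "u z \<le> 1" for z
    unfolding u_def using f by (auto intro!: prod_nonneg prod_le_1)
  have vy: "0 < v y" "v y \<le> 1" using v[rule_format, of y] by auto
  have "qexp v (Suc n) (\<lambda>z. of_bool (x \<le> z)) y \<le>
      v y * (u (y + 1) / c ^ n) + (1 - v y) * (u (y - 1) / c ^ n)"
    unfolding qexp_Suc u_def using vy by (intro add_mono mult_left_mono Suc.IH) auto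
  also have "\<dots> = (c * (v y * u (y + 1) + (1 - v y) * u (y - 1))) / c ^ Suc n"
    using c by (simp add: field_simps)
  also have "\<dots> \<le> u y / c ^ Suc n"
  proof (rule divide_right_mono)
    show "c * (v y * u (y + 1) + (1 - v y) * u (y - 1)) \<le> u y"
    proof (cases "y < x")
      case True
      have "{y..<x} = insert y {y+1..<x}" using True by auto
      then have uy: "u y = f y * u (y + 1)" by (simp add: u_def)
      have "{y-1..<x} = insert (y-1) {y..<x}" using True by auto
      then have uy': "u (y - 1) = f (y - 1) * f y * u (y + 1)" by (simp add: u_def uy[unfolded
          u_def])
      have "c * (v y * u (y + 1) + (1 - v y) * u (y - 1)) =
          (c * (v y + (1 - v y) * f (y - 1) * f y)) * u (y + 1)"
        by (simp add: uy' algebra_simps)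
      also have "\<dots> \<le> f y * u (y + 1)"
        by (intro mult_right_mono super True u)
      finally show ?thesis by (simp add: uy)
    next
      case False
      then have "u y = 1" by (simp add: u_def)
      have "v y * u (y + 1) + (1 - v y) * u (y - 1) \<le> v y * 1 + (1 - v y) * 1"
        using vy u by (intro add_mono mult_left_mono) auto
      then have "c * (v y * u (y + 1) + (1 - v y) * u (y - 1)) \<le> c * 1"
        using c by (intro mult_left_mono) auto
      then show ?thesis using \<open>u y = 1\<close> c by linarith
    qed
  qed (use c in simp)
  finally show ?case by (simp add: u_def)
qed

text \<open>\<open>cross c v a i\<close> is the generating function at \<open>c\<close> of the time to go from \<open>a + i\<close> to
  \<open>a + i + 1\<close> for the walk reflected at \<open>a\<close>.\<close>

primrec cross :: "real \<Rightarrow> (int \<Rightarrow> real) \<Rightarrow> int \<Rightarrow> nat \<Rightarrow> real" where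
  "cross c v a 0 = c * v a / (1 - c * (1 - v a))"
| "cross c v a (Suc i) =
     c * v (a + int (Suc i)) / (1 - c * (1 - v (a + int (Suc i))) * cross c v a i)"

lemma cross_aux:
  fixes c w t :: real
  assumes "0 < c" "c < 1" "0 < w" "w \<le> 1" "0 \<le> t" "t \<le> 1"
  shows "0 \<le> c * w / (1 - c * (1 - w) * t) \<and> c * w / (1 - c * (1 - w) * t) \<le> 1"
    and "c * w / (1 - c * (1 - w) * t) = c * (w + (1 - w) * t * (c * w / (1 - c * (1 - w) * t)))"
proof -
  have "(1 - w) * t \<le> (1 - w) * 1" using assms by (intro mult_left_mono) auto
  then have "c * ((1 - w) * t) \<le> c * (1 - w)" using assms by (intro mult_left_mono) auto
  then have *: "c * (1 - w) * t \<le> c - c * w" by (simp add: algebra_simps)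
  then have "c * w < 1 - c * (1 - w) * t" using assms by linarith
  moreover have "0 < c * w" using assms by simp
  ultimately have pos: "0 < 1 - c * (1 - w) * t" "c * w \<le> 1 - c * (1 - w) * t" by linarith+
  then show "0 \<le> c * w / (1 - c * (1 - w) * t) \<and> c * w / (1 - c * (1 - w) * t) \<le> 1"
    using \<open>0 < c * w\<close> by simp
  show "c * w / (1 - c * (1 - w) * t) = c * (w + (1 - w) * t * (c * w / (1 - c * (1 - w) * t)))"
    using pos(1) by (simp add: field_simps)
qed

lemma cross_bounds:
  assumes v: "\<forall>i. 0 < v i \<and> v i \<le> 1" and c: "0 < c" "c < 1"
  shows "0 \<le> cross c v a i \<and> cross c v a i \<le> 1"
proof (induction i)
  case 0
  then show ?case using cross_aux(1)[of c "v a" 1] v c by simp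
next
  case (Suc i)
  then show ?case using cross_aux(1)[of c "v (a + int (Suc i))" "cross c v a i"] v c by simp
qed

text \<open>First-step analysis: the walk either steps right, or steps left and must then cross two
  edges. Reflection at \<open>a\<close> means that a step to the left is replaced by a unit of time
  spent at \<open>a\<close>.\<close>

lemma cross_eq:
  assumes v: "\<forall>i. 0 < v i \<and> v i \<le> 1" and c: "0 < c" "c < 1"
  shows "cross c v a 0 = c * (v a + (1 - v a) * cross c v a 0)"
    and "cross c v a (Suc i) =
      c * (v (a + int (Suc i)) + (1 - v (a + int (Suc i))) * cross c v a i * cross c v a (Suc i))"
proof -
  show "cross c v a 0 = c * (v a + (1 - v a) * cross c v a 0)"
    unfolding cross.simps using cross_aux(2)[of c "v a" 1] v[rule_format, of a] c
    by (simp only: mult_1_right)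
  show "cross c v a (Suc i) =
      c * (v (a + int (Suc i)) + (1 - v (a + int (Suc i))) * cross c v a i * cross c v a (Suc i))"
    unfolding cross.simps(2)
    by (rule cross_aux(2)) (use v c cross_bounds[OF assms, of a i] in auto)
qed

text \<open>Generating function of the time to cross \<open>L\<close> edges starting from the
  reflecting site \<open>a\<close>. It reads the environment in the block only, so that disjoint
  blocks of an i.i.d. environment give independent factors.\<close>

definition block :: "real \<Rightarrow> nat \<Rightarrow> (int \<Rightarrow> real) \<Rightarrow> int \<Rightarrow> real" where
  "block c L v a = (\<Prod>j<L. cross c v a j)"

lemma block_bounds:
  assumes "\<forall>i. 0 < v i \<and> v i \<le> 1" "0 < c" "c < 1"
  shows "0 \<le> block c L v a" "block c L v a \<le> 1"
  unfolding block_def using cross_bounds[OF assms] by (auto intro!: prod_nonneg prod_le_1)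

lemma cross_cong:
  assumes "\<And>j. j \<le> i \<Longrightarrow> v (a + int j) = v' (a' + int j)"
  shows "cross c v a i = cross c v' a' i"
  using assms
proof (induction i)
  case 0 then show ?case using 0[of 0] by simp
next
  case (Suc i)
  then have "cross c v a i = cross c v' a' i" by simp
  then show ?case using Suc.prems[of "Suc i"] by (simp add: add.assoc)
qed

lemma block_cong:
  assumes "\<And>j. j < L \<Longrightarrow> v (a + int j) = v' (a' + int j)"
  shows "block c L v a = block c L v' a'"
  unfolding block_def using assms by (intro prod.cong cross_cong) auto

lemma measurable_cross:
  assumes "\<And>j. j \<le> i \<Longrightarrow> (\<lambda>s. v s (a + int j)) \<in> borel_measurable M"
  shows "(\<lambda>s. cross c (v s) a i) \<in> borel_measurable M"
  using assms
proof (induction i)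
  case 0
  have [measurable]: "(\<lambda>s. v s a) \<in> borel_measurable M" using 0[of 0] by simp
  show ?case by simp
next
  case (Suc i)
  have [measurable]: "(\<lambda>s. cross c (v s) a i) \<in> borel_measurable M"
    by (rule Suc.IH) (use Suc.prems in auto)
  have [measurable]: "(\<lambda>s. v s (a + int (Suc i))) \<in> borel_measurable M"
    using Suc.prems[of "Suc i"] by simp
  show ?case unfolding cross.simps by measurable
qed

lemma measurable_block:
  assumes "\<And>j. j < L \<Longrightarrow> (\<lambda>s. v s (a + int j)) \<in> borel_measurable M"
  shows "(\<lambda>s. block c L (v s) a) \<in> borel_measurable M"
  unfolding block_def using assms by (intro borel_measurable_prod measurable_cross) auto

text \<open>Reflection at the left end of each block can only accelerate the walk to the right, so
  the product over blocks is still a supersolution.\<close>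

lemma blocks_bound:
  assumes v: "\<forall>i. 0 < v i \<and> v i \<le> 1" and c: "0 < c" "c < 1" and L: "1 \<le> L"
  shows "qexp v n (\<lambda>z. of_bool (int (m * L) \<le> z)) 0 \<le> (\<Prod>b<m. block c L v (int (b * L))) / c ^ n"
proof -
  \<comment> \<open>Edges to the left of 0 get the trivial value 1. At the first site of a block the
    estimate \<open>f (y - 1) \<le> 1\<close> replaces the time spent to the left of the block by an
    immediate return.\<close>
  define f where "f y = (if y < 0 then 1 else cross c v (int L * (y div int L)) (nat (y mod int
      L)))" for y
  have f: "\<forall>i. 0 \<le> f i \<and> f i \<le> 1"
    using cross_bounds[OF v c] by (simp add: f_def)
  have "c * (v y + (1 - v y) * f (y - 1) * f y) \<le> f y" for y
  proof (cases "y < 0")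
    case True
    have "v y + (1 - v y) * f (y - 1) * f y \<le> 1" using True by (simp add: f_def)
    then have "c * (v y + (1 - v y) * f (y - 1) * f y) \<le> c * 1" using c by (intro mult_left_mono)
        auto
    then show ?thesis using True c by (simp add: f_def)
  next
    case False
    show ?thesis
    proof (cases "y mod int L = 0")
      case True
      then have "int L * (y div int L) = y" using mult_div_mod_eq[of "int L" y] by simp
      then have fy: "f y = c * (v y + (1 - v y) * f y)"
        using False True cross_eq(1)[OF v c, of y] by (simp add: f_def del: cross.simps)
      have "(1 - v y) * f (y - 1) * f y \<le> (1 - v y) * 1 * f y"
        using v[rule_format, of y] f[rule_format, of y] f[rule_format, of "y - 1"] by (intro
            mult_right_mono mult_left_mono) auto
      then have "c * (v y + (1 - v y) * f (y - 1) * f y) \<le> c * (v y + (1 - v y) * f y)"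
        using c by (intro mult_left_mono add_left_mono) auto
      with fy show ?thesis by simp
    next
      case ne: False
      define j where "j = nat (y mod int L - 1)"
      have "0 \<le> y mod int L" using L by simp
      then have j: "y mod int L = int (Suc j)" using ne by (simp add: j_def)
      have "y mod int L < int L" using L by simp
      have y: "y = int L * (y div int L) + int (Suc j)" using j mult_div_mod_eq[of "int L" y] by
          simp
      have "y - 1 = int j + int L * (y div int L)" using y by simp
      moreover have "int j < int L" using \<open>y mod int L < int L\<close> j by simp
      ultimately have "(y - 1) div int L = y div int L" "(y - 1) mod int L = int j" by simp_all
      moreover have "0 \<le> y - 1" using False ne by (cases "y = 0") auto
      ultimately have f1: "f (y - 1) = cross c v (int L * (y div int L)) j" by (simp add: f_def)
      have f2: "f y = cross c v (int L * (y div int L)) (Suc j)"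
        using False unfolding f_def j nat_int by (simp del: cross.simps)
      show ?thesis unfolding f1 f2
        using cross_eq(2)[OF v c, of "int L * (y div int L)" j] y by (simp del: cross.simps)
    qed
  qed
  from crossing_bound[where f = f and c = c, OF v c(1) less_imp_le[OF c(2)] f this]
  have "qexp v n (\<lambda>z. of_bool (int (m * L) \<le> z)) 0 \<le> (\<Prod>i\<in>{0..<int (m * L)}. f i) / c ^ n" .
  moreover have "(\<Prod>i\<in>{0..<int (m * L)}. f i) = (\<Prod>b<m. block c L v (int (b * L)))"
  proof (induction m)
    case (Suc m)
    have "0 \<le> int (m * L)" "int (m * L) \<le> int (Suc m * L)" by simp_all
    then have "{0..<int (Suc m * L)} = {0..<int (m * L)} \<union> {int (m * L)..<int (Suc m * L)}"
      by (intro ivl_disj_un_two(3)[symmetric])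
    then have "(\<Prod>i\<in>{0..<int (Suc m * L)}. f i) =
        (\<Prod>i\<in>{0..<int (m * L)}. f i) * (\<Prod>i\<in>{int (m * L)..<int (Suc m * L)}. f i)"
      by (simp only:) (subst prod.union_disjoint, auto)
    also have "(\<Prod>i\<in>{int (m * L)..<int (Suc m * L)}. f i) = (\<Prod>j<L. f (int (m * L) + int j))"
      by (rule prod.reindex_bij_witness[where i = "\<lambda>j. int (m * L) + int j" and j = "\<lambda>i. nat (i -
          int (m * L))"]) auto
    also have "\<dots> = block c L v (int (m * L))"
      unfolding block_def
    proof (intro prod.cong refl)
      fix j assume "j \<in> {..<L}"
      then have "(int (m * L) + int j) div int L = int m" "(int (m * L) + int j) mod int L = int j"
        by (simp_all add: algebra_simps)
      moreover have "\<not> int (m * L) + int j < 0" by (simp only: of_nat_add[symmetric] not_less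
          of_nat_0_le_iff)
      ultimately show "f (int (m * L) + int j) = cross c v (int (m * L)) j"
        by (simp only: f_def if_False nat_int) (simp add: mult.commute)
    qed
    finally show ?case by (simp only: Suc.IH prod.lessThan_Suc)
  qed simp
  ultimately show ?thesis by simp
qed

text \<open>Up to time \<open>k\<close> the reflected walk from \<open>0\<close> can only cross the block in one of these ways: by
  first reaching \<open>-1\<close> without reflection (the quotient of scale functions), by being beyond \<open>h\<close> at
  time \<open>k\<close>, or by backtracking from \<open>L\<close> to below \<open>h\<close>. The term \<open>c ^ k\<close> bounds the
  contribution of later crossings to the Laplace transform.\<close>

lemma block_upper_bound:
  assumes v: "\<forall>i. 0 < v i \<and> v i \<le> 1" and c: "0 < c" "c < 1" and L: "1 \<le> L"
  shows "block c L v 0 \<le> c ^ k + trunc_scale 0 (int L) v 0 / (1 + trunc_scale 0 (int L) v 0)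
     + qexp v k (\<lambda>z. of_bool (h \<le> z)) 0 + (if int L < h then 1 else min 1 (trunc_scale h (int L +
         int k) v (int L)))"
proof -
  define S where "S = trunc_scale 0 (int L) v"
  \<comment> \<open>Since \<open>S\<close> vanishes at \<open>int L\<close> and equals
    \<open>1 + S 0\<close> at \<open>-1\<close>, \<open>A\<close> is the probability of reaching
    \<open>-1\<close> before \<open>int L\<close>. The function \<open>u\<close> below is the
    generating function of the remaining crossing, raised to 1 at negative sites; this makes it a
    subsolution at 0, where reflection would otherwise enter.\<close>
  define A where "A y = (if y < 0 then 1 else S y / (1 + S 0))" for y
  define B where "B = (if int L < h then 1 else min 1 (trunc_scale h (int L + int k) v (int L)))"
  define g where "g i = cross c v 0 (nat i)" for i
  define u where "u y = (if y < 0 then 1 else \<Prod>i\<in>{y..<int L}. g i)" for y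
  define q where "q n y = qexp v n (\<lambda>z. of_bool (h \<le> z)) y" for n y
  have S: "0 \<le> S y" for y unfolding S_def by (rule scale_nonneg[OF v])
  have A: "0 \<le> A y" for y using S by (simp add: A_def)
  have B: "0 \<le> B" using scale_nonneg[OF v] by (simp add: B_def)
  have g: "0 \<le> g i" "g i \<le> 1" for i unfolding g_def using cross_bounds[OF v c] by auto
  have u: "0 \<le> u y" "u y \<le> 1" for y
    unfolding u_def using g by (auto intro!: prod_nonneg prod_le_1)
  have q: "0 \<le> q n y" for n y unfolding q_def using v by (intro qexp_nonneg) (auto simp:
      less_imp_le)
  have A_harm: "v y * A (y + 1) + (1 - v y) * A (y - 1) = A y" if "0 \<le> y" "y < int L" for y
  proof -
    have A_eq: "A z = S z / (1 + S 0)" if "-1 \<le> z" for z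
    proof (cases "z = -1")
      case True
      have "S (-1) = 1 + S 0" using scale_before[of 0 "int L" v] L by (simp add: S_def)
      then show ?thesis using True S[of 0] by (simp add: A_def)
    qed (use that in \<open>simp add: A_def\<close>)
    have "v y * S (y + 1) + (1 - v y) * S (y - 1) = S y"
      unfolding S_def by (rule scale_harmonic) (use v that in auto)
    then show ?thesis using that A_eq[of y] A_eq[of "y + 1"] A_eq[of "y - 1"]
      by (simp add: add_divide_distrib[symmetric])
  qed
  have u_sub: "u y \<le> c * (v y * u (y + 1) + (1 - v y) * u (y - 1))" if y: "0 \<le> y" "y < int L" for y
  proof -
    have "{y..<int L} = insert y {y+1..<int L}" using y by auto
    then have uy: "u y = g y * u (y + 1)" using y by (simp add: u_def)
    show ?thesis
    proof (cases "y = 0")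
      case True
      have "g 0 = c * (v 0 + (1 - v 0) * g 0)" using cross_eq(1)[OF v c, of 0] by (simp add: g_def
          del: cross.simps)
      then have "g 0 * u 1 = c * (v 0 + (1 - v 0) * g 0) * u 1" by simp
      also have "\<dots> = c * (v 0 * u 1 + (1 - v 0) * (g 0 * u 1))" by (simp add: algebra_simps)
      also have "\<dots> \<le> c * (v 0 * u 1 + (1 - v 0) * 1)"
        using c v[rule_format, of 0] u[of 0] uy True by (intro mult_left_mono add_left_mono) auto
      finally show ?thesis using uy True by (simp add: u_def)
    next
      case False
      define j where "j = nat (y - 1)"
      have yj: "y = int (Suc j)" using y False by (simp add: j_def)
      have "{y-1..<int L} = insert (y-1) {y..<int L}" using y by auto
      then have uy': "u (y - 1) = g (y - 1) * (g y * u (y + 1))"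
        using y False uy by (simp add: u_def)
      have "nat y = Suc j" "nat (y - 1) = j" by (simp_all add: yj)
      then have "g y = c * (v y + (1 - v y) * g (y - 1) * g y)"
        unfolding g_def using cross_eq(2)[OF v c, of 0 j] yj by (simp del: cross.simps)
      then have "g y * u (y + 1) = c * (v y + (1 - v y) * g (y - 1) * g y) * u (y + 1)" by simp
      also have "\<dots> = c * (v y * u (y + 1) + (1 - v y) * u (y - 1))"
        by (simp add: uy' algebra_simps)
      finally show ?thesis by (simp add: uy)
    qed
  qed
  \<comment> \<open>Induction over the remaining time \<open>n\<close>. At \<open>n = 0\<close> the
    term \<open>c ^ 0\<close> alone is enough; at negative sites it is \<open>A\<close>; at
    \<open>int L\<close> the position stays above \<open>h\<close> except with probability
    \<open>B\<close>, so \<open>q + B\<close> is at least 1. In the interior \<open>A\<close> and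
    \<open>q\<close> reproduce themselves under one step, and only \<open>c ^ n\<close> requires the
    discount factor.\<close>
  have "u y \<le> c ^ n + A y + q n y + B" if "n \<le> k" "y \<le> int L" for n y
    using that
  proof (induction n arbitrary: y)
    case 0
    then show ?case using u[of y] A[of y] q[of 0 y] B by simp
  next
    case (Suc n)
    have cn: "0 \<le> c ^ Suc n" using c by simp
    consider "y < 0" | "y = int L" | "0 \<le> y" "y < int L" using Suc.prems by linarith
    then show ?case
    proof cases
      case 1
      then show ?thesis using u[of y] q[of "Suc n" y] B cn by (simp add: A_def)
    next
      case 2
      have "qexp v (Suc n) (\<lambda>z. of_bool (z < h)) y \<le> B"
        unfolding B_def 2 using Suc.prems
        by (intro order_trans[OF backtracking_bound[OF v, where N = "int L + int k"]]) auto
      then have "1 - B \<le> q (Suc n) y" unfolding q_def qexp_complement by simp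
      then show ?thesis using u[of y] A[of y] cn by linarith
    next
      case 3
      have vy: "0 < v y" "v y \<le> 1" using v[rule_format, of y] by auto
      define w where "w z = c ^ n + A z + q n z + B" for z
      have "u y \<le> c * (v y * u (y + 1) + (1 - v y) * u (y - 1))" by (rule u_sub[OF 3])
      also have "\<dots> \<le> c * (v y * w (y + 1) + (1 - v y) * w (y - 1))"
        unfolding w_def using c vy Suc.prems 3 by (intro mult_left_mono add_mono Suc.IH) auto
      also have "v y * w (y + 1) + (1 - v y) * w (y - 1) =
          c ^ n + (v y * A (y + 1) + (1 - v y) * A (y - 1)) + q (Suc n) y + B"
        unfolding w_def q_def qexp_Suc by (simp add: algebra_simps)
      also have "\<dots> = c ^ n + (A y + q (Suc n) y + B)" unfolding A_harm[OF 3] by simp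
      also have "c * (c ^ n + (A y + q (Suc n) y + B)) \<le> c ^ Suc n + (A y + q (Suc n) y + B)"
        using c A[of y] q[of "Suc n" y] B
          mult_right_mono[of c 1 "A y + q (Suc n) y + B"] by (simp add: distrib_left)
      finally show ?thesis by simp
    qed
  qed
  from this[of k 0] have "u 0 \<le> c ^ k + A 0 + q k 0 + B" by simp
  moreover have "u 0 = block c L v 0"
    unfolding u_def block_def g_def
    by simp (rule prod.reindex_bij_witness[where i = int and j = nat], auto)
  ultimately show ?thesis by (simp add: A_def S_def q_def B_def)
qed

section \<open>Exponential moments of the walk\<close>

text \<open>Subadditivity of concave powers. It replaces a scale function, whose mean may be
  infinite, by a sum of products with powers of order \<kappa>/2, and these have geometrically small
  means.\<close>

lemma min_one_sum_le:
  fixes a :: "'i \<Rightarrow> real"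
  assumes "finite J" "\<And>j. j \<in> J \<Longrightarrow> 0 \<le> a j" "0 < p" "p \<le> 1"
  shows "min 1 (\<Sum>j\<in>J. a j) \<le> (\<Sum>j\<in>J. a j powr p)"
  using assms(1,2)
proof (induction J rule: finite_induct)
  case (insert x F)
  have "0 \<le> a x" using insert.prems by simp
  have "min 1 (a x) \<le> a x powr p"
  proof (cases "a x \<le> 1")
    case True
    have "a x powr 1 \<le> a x powr p"
      using True \<open>0 \<le> a x\<close> assms(3,4) by (intro powr_mono') auto
    then show ?thesis using True \<open>0 \<le> a x\<close> by (simp add: powr_one)
  next
    case False
    then show ?thesis using assms(3) by (simp add: ge_one_powr_ge_zero)
  qed
  moreover have "min 1 (\<Sum>j\<in>F. a j) \<le> (\<Sum>j\<in>F. a j powr p)" using insert by simp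
  moreover have "0 \<le> (\<Sum>j\<in>F. a j)" using insert.prems by (intro sum_nonneg) auto
  ultimately show ?case using insert.hyps \<open>0 \<le> a x\<close> by (simp add: min_def split: if_splits)
qed simp

lemma geometric_sum_le:
  fixes x :: real
  assumes "0 \<le> x" "x < 1"
  shows "(\<Sum>i<n. x ^ i) \<le> 1 / (1 - x)"
proof -
  have "(1 - x) * (\<Sum>i<n. x ^ i) = 1 - x ^ n" by (rule one_diff_power_eq[symmetric])
  also have "\<dots> \<le> 1" using assms by simp
  finally show ?thesis using assms by (simp add: field_simps)
qed

section \<open>Averages over the environment\<close>

locale regular_walk = walk_in_random_env \<alpha> "\<lambda>_ x. x" M \<eta> Z for \<alpha> M \<eta> Z +
  fixes \<kappa> :: real
  assumes kappa: "0 < \<kappa>" "\<kappa> < 1" and regular: "kappa_regular \<kappa> \<alpha>"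
begin

definition \<theta> :: real where "\<theta> = (\<integral>w. ((1 - w) / w) powr (\<kappa> / 2) \<partial>\<alpha>)"

abbreviation env :: "'a \<Rightarrow> int \<Rightarrow> real" where "env s i \<equiv> \<eta> i s"

lemma theta: "0 \<le> \<theta>" "\<theta> < 1"
  using kappa_regular_odds(3)[OF regular] by (auto simp: \<theta>_def intro!: integral_nonneg_AE)

lemma AE_env: "AE s in M. \<forall>i. 0 < env s i \<and> env s i \<le> 1"
proof -
  have "AE s in M. 0 < env s i \<and> env s i \<le> 1" for i
  proof -
    have "AE w in distr M borel (\<eta> i). 0 < w \<and> w \<le> 1"
      unfolding distr_field by (rule kappa_regular_odds(1)[OF regular])
    then show ?thesis by (subst (asm) AE_distr_iff) auto
  qed
  then show ?thesis by (simp add: AE_all_countable)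
qed

lemma odds_measurable [measurable]: "(\<lambda>s. odds (env s) i) \<in> borel_measurable M"
  unfolding odds_def by measurable

lemma scale_measurable [measurable]: "(\<lambda>s. trunc_scale a N (env s) y) \<in> borel_measurable M"
  unfolding trunc_scale_def by measurable

lemma AE_scale_nonneg: "AE s in M. 0 \<le> trunc_scale a N (env s) y"
  using AE_env by eventually_elim (rule scale_nonneg)

lemma integrable_min_scale:
  assumes "0 < B"
  shows "integrable M (\<lambda>s. min 1 (trunc_scale a N (env s) y / B))"
proof (rule integrable_const_bound[where B = 1])
  show "AE s in M. norm (min 1 (trunc_scale a N (env s) y / B)) \<le> 1"
    using AE_scale_nonneg[of a N y] by eventually_elim (use assms in \<open>auto simp: min_def\<close>)
qed measurable

lemma odds_powr_integral:
  "integrable M (\<lambda>s. odds (env s) i powr (\<kappa> / 2))"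
  "(\<integral>s. odds (env s) i powr (\<kappa> / 2) \<partial>M) = \<theta>"
proof -
  let ?f = "\<lambda>w::real. ((1 - w) / w) powr (\<kappa> / 2)"
  have [measurable]: "?f \<in> borel_measurable borel" by measurable
  have "integrable (distr M borel (\<eta> i)) ?f"
    unfolding distr_field by (rule kappa_regular_odds(2)[OF regular])
  then show "integrable M (\<lambda>s. odds (env s) i powr (\<kappa> / 2))"
    by (subst (asm) integrable_distr_eq) (auto simp: odds_def)
  have "(\<integral>w. ?f w \<partial>distr M borel (\<eta> i)) = (\<integral>s. odds (env s) i powr (\<kappa> / 2) \<partial>M)"
    by (subst integral_distr) (auto simp: odds_def)
  then show "(\<integral>s. odds (env s) i powr (\<kappa> / 2) \<partial>M) = \<theta>"
    unfolding distr_field \<theta>_def by simp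
qed

lemma odds_prod_integral:
  assumes "finite F"
  shows "integrable M (\<lambda>s. \<Prod>i\<in>F. odds (env s) i powr (\<kappa> / 2))"
    and "(\<integral>s. (\<Prod>i\<in>F. odds (env s) i powr (\<kappa> / 2)) \<partial>M) = \<theta> ^ card F"
proof -
  have ind: "indep_vars (\<lambda>_. borel) (\<lambda>i s. odds (env s) i powr (\<kappa> / 2)) F"
    unfolding odds_def
    by (rule indep_vars_compose2[OF indep_vars_subset[OF indep]]) auto
  show "integrable M (\<lambda>s. \<Prod>i\<in>F. odds (env s) i powr (\<kappa> / 2))"
    by (rule indep_vars_integrable[OF assms ind odds_powr_integral(1)])
  show "(\<integral>s. (\<Prod>i\<in>F. odds (env s) i powr (\<kappa> / 2)) \<partial>M) = \<theta> ^ card F"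
    by (subst indep_vars_lebesgue_integral[OF assms ind odds_powr_integral(1)])
       (simp add: odds_powr_integral(2))
qed

text \<open>Each product in the truncated scale contains all odds from \<open>a\<close> to
  \<open>y\<close>, which yields the power of \<open>\<theta>\<close> in front; the remaining odds
  sum to a geometric series, so the bound is uniform in \<open>N\<close>. A large \<open>B\<close>
  makes the event that the scale is of order \<open>B\<close> improbable.\<close>

lemma scale_expectation:
  assumes "a \<le> y" "0 < B"
  shows "(\<integral>s. min 1 (trunc_scale a N (env s) y / B) \<partial>M)
    \<le> B powr (- \<kappa> / 2) * (\<theta> ^ nat (y - a + 1) / (1 - \<theta>))"
proof -
  define G where "G s = (\<Sum>j\<in>{y..<N}. (\<Prod>i\<in>{a..j}. odds (env s) i powr (\<kappa> / 2)) * B powr (- \<kappa> / 2))"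
      for s
  have int: "integrable M (\<lambda>s. (\<Prod>i\<in>{a..j}. odds (env s) i powr (\<kappa> / 2)) * B powr (- \<kappa> / 2))" for j
    by (intro integrable_mult_left odds_prod_integral) auto
  then have "integrable M G" unfolding G_def by (intro Bochner_Integration.integrable_sum)
  have "(\<integral>s. min 1 (trunc_scale a N (env s) y / B) \<partial>M) \<le> (\<integral>s. G s \<partial>M)"
  proof (rule integral_mono_AE[OF integrable_min_scale[OF assms(2)] \<open>integrable M G\<close>])
    show "AE s in M. min 1 (trunc_scale a N (env s) y / B) \<le> G s"
      using AE_env
    proof eventually_elim
      case (elim s)
      have od: "0 \<le> odds (env s) i" for i by (rule odds_nonneg) (rule elim[rule_format])
      have "min 1 (trunc_scale a N (env s) y / B) \<le>
          (\<Sum>j\<in>{y..<N}. ((\<Prod>i\<in>{a..j}. odds (env s) i) / B) powr (\<kappa> / 2))"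
        unfolding trunc_scale_def sum_divide_distrib
        by (rule min_one_sum_le) (use kappa assms od in \<open>auto intro!: divide_nonneg_nonneg
            prod_nonneg\<close>)
      also have "\<dots> = G s" unfolding G_def
        using od assms
        by (intro sum.cong refl)
           (simp add: powr_divide prod_nonneg prod_powr_distrib powr_minus_divide)
      finally show ?case .
    qed
  qed
  also have "(\<integral>s. G s \<partial>M) = (\<Sum>j\<in>{y..<N}. \<theta> ^ card {a..j} * B powr (- \<kappa> / 2))"
    unfolding G_def using int
    by (subst Bochner_Integration.integral_sum) (auto simp: odds_prod_integral)
  also have "\<dots> = (\<Sum>i<nat (N - y). \<theta> ^ (nat (y - a + 1) + i) * B powr (- \<kappa> / 2))"
    by (rule sum.reindex_bij_witness[where i = "\<lambda>i. y + int i" and j = "\<lambda>j. nat (j - y)"])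
       (use assms in \<open>auto simp: nat_add_distrib[symmetric] intro!: arg_cong[where f = "\<lambda>n. \<theta> ^
           n"]\<close>)
  also have "\<dots> = B powr (- \<kappa> / 2) * (\<theta> ^ nat (y - a + 1) * (\<Sum>i<nat (N - y). \<theta> ^ i))"
    by (simp add: power_add sum_distrib_left sum_distrib_right mult_ac)
  also have "\<dots> \<le> B powr (- \<kappa> / 2) * (\<theta> ^ nat (y - a + 1) * (1 / (1 - \<theta>)))"
    using theta by (intro mult_left_mono geometric_sum_le) auto
  finally show ?thesis by simp
qed

lemma expectation_walk_event:
  "(\<integral>s. (of_bool (P (Z n s)) :: real) \<partial>M) = (\<integral>s. qexp (env s) n (\<lambda>z. of_bool (P z)) 0 \<partial>M)"
  using integral_walk[of "\<lambda>z. of_bool (P z) :: real" n] by simp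

lemma integrable_qexp: "integrable M (\<lambda>s. qexp (env s) n g x)"
  by (rule integrable_quenched[of 0 n g x])

text \<open>The threshold is shifted by one so that exactly \<open>d\<close> odds lie between it and
  the starting point. The bound does not depend on \<open>n\<close>: on the left the walk has
  exponential tails at scale 1, not at scale n^\<kappa>.\<close>

lemma lower_tail: "(\<integral>s. (of_bool (Z n s < 1 - int d) :: real) \<partial>M) \<le> \<theta> ^ d / (1 - \<theta>)"
proof (cases "d = 0")
  case True
  have "(\<integral>s. (of_bool (Z n s < 1 - int d) :: real) \<partial>M) \<le> (\<integral>s. 1 \<partial>M)"
    by (rule integral_mono[OF integrable_walk]) auto
  also have "\<dots> \<le> 1 / (1 - \<theta>)" using theta by (simp add: prob_space)
  finally show ?thesis using True by simp
next
  case False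
  have "(\<integral>s. (of_bool (Z n s < 1 - int d) :: real) \<partial>M) \<le> (\<integral>s. min 1 (trunc_scale (1 - int d) (int
      n) (env s) 0 / 1) \<partial>M)"
    unfolding expectation_walk_event[of "\<lambda>z. z < 1 - int d"]
  proof (rule integral_mono_AE[OF integrable_qexp integrable_min_scale[OF zero_less_one]])
    show "AE s in M. qexp (env s) n (\<lambda>z. of_bool (z < 1 - int d)) 0
        \<le> min 1 (trunc_scale (1 - int d) (int n) (env s) 0 / 1)"
      using AE_env
    proof eventually_elim
      case (elim s)
      from backtracking_bound[OF elim, of 0 n "int n" "1 - int d"] False show ?case by simp
    qed
  qed
  also have "\<dots> \<le> \<theta> ^ d / (1 - \<theta>)"
    using scale_expectation[of "1 - int d" 0 1 "int n"] False by simp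
  finally show ?thesis .
qed

lemma block_measurable [measurable]: "(\<lambda>s. block c L (env s) a) \<in> borel_measurable M"
  by (rule measurable_block) auto

lemma integrable_block:
  assumes "0 < c" "c < 1"
  shows "integrable M (\<lambda>s. block c L (env s) a)"
proof (rule integrable_const_bound[where B = 1])
  show "AE s in M. norm (block c L (env s) a) \<le> 1"
    using AE_env
  proof eventually_elim
    case (elim s)
    show ?case using block_bounds[OF elim assms, of L a] by simp
  qed
qed measurable

lemma block_stationary: "(\<integral>s. block c L (env s) a \<partial>M) = (\<integral>s. block c L (env s) 0 \<partial>M)"
proof -
  have H [measurable]: "(\<lambda>v. block c L v 0) \<in> borel_measurable (PiM UNIV (\<lambda>_. borel))"
    by (intro measurable_block measurable_component_singleton) auto
  have "(\<integral>s. block c L (env s) a \<partial>M) = (\<integral>s. block c L (\<lambda>j. env s (a + j)) 0 \<partial>M)"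
    by (intro Bochner_Integration.integral_cong refl block_cong) simp
  also have "\<dots> = (\<integral>v. block c L v 0 \<partial>distr M (PiM UNIV (\<lambda>_. borel)) (\<lambda>s j. \<eta> (a + j) s))"
    by (subst integral_distr) (auto intro!: measurable_PiM_single')
  also have "distr M (PiM UNIV (\<lambda>_. borel)) (\<lambda>s j. \<eta> (a + j) s) =
      distr M (PiM UNIV (\<lambda>_. borel)) (\<lambda>s j. \<eta> j s)"
    using distr_field_reindex[of "\<lambda>j. a + j"] distr_field_reindex[of "\<lambda>j. j"] by (simp add: inj_def)
  also have "(\<integral>v. block c L v 0 \<partial>\<dots>) = (\<integral>s. block c L (env s) 0 \<partial>M)"
    by (subst integral_distr) (auto intro!: measurable_PiM_single')
  finally show ?thesis .
qed

text \<open>The block with number \<open>b\<close> reads only the sites in \<open>K b\<close>; these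
  sets are disjoint, so the mean of the product of blocks is a power of a single mean.\<close>

lemma upper_tail:
  assumes c: "0 < c" "c < 1" and L: "1 \<le> L"
  shows "(\<integral>s. (of_bool (int (m * L) \<le> Z n s) :: real) \<partial>M) \<le> (\<integral>s. block c L (env s) 0 \<partial>M) ^ m / c ^
      n"
proof -
  define K where "K b = {int (b * L)..<int (b * L) + int L}" for b
  have disj: "disjoint_family K"
    unfolding disjoint_family_on_def
  proof (intro ballI impI)
    fix b b' :: nat assume "b \<noteq> b'"
    have *: "K b \<inter> K b' = {}" if "b < b'" for b b'
    proof -
      have "Suc b * L \<le> b' * L" using that by (intro mult_right_mono) auto
      then have "int (b * L) + int L \<le> int (b' * L)" by (metis add.commute mult_Suc of_nat_add
          of_nat_le_iff)
      then show ?thesis by (auto simp: K_def)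
    qed
    show "K b \<inter> K b' = {}" using *[of b b'] *[of b' b] \<open>b \<noteq> b'\<close> by (cases "b < b'") auto
  qed
  have ind: "indep_vars (\<lambda>_. borel) (\<lambda>b s. block c L (env s) (int (b * L))) {..<m}"
  proof -
    have "indep_vars (\<lambda>b. PiM (K b) (\<lambda>_. borel)) (\<lambda>b s. restrict (\<lambda>i. \<eta> i s) (K b)) {..<m}"
      by (rule indep_vars_restrict[OF indep]) (use disj in \<open>auto simp: disjoint_family_on_def\<close>)
    then have "indep_vars (\<lambda>_. borel) (\<lambda>b s. block c L (restrict (\<lambda>i. \<eta> i s) (K b)) (int (b * L)))
        {..<m}"
      by (rule indep_vars_compose2)
         (intro measurable_block measurable_component_singleton, simp add: K_def)
    moreover have "block c L (restrict (\<lambda>i. \<eta> i s) (K b)) (int (b * L)) = block c L (env s) (int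
        (b * L))" for b s
      by (rule block_cong) (simp add: K_def)
    ultimately show ?thesis by simp
  qed
  have int: "integrable M (\<lambda>s. \<Prod>b<m. block c L (env s) (int (b * L)))"
    by (rule indep_vars_integrable[OF _ ind]) (use integrable_block c in auto)
  have "(\<integral>s. (of_bool (int (m * L) \<le> Z n s) :: real) \<partial>M) \<le>
      (\<integral>s. (\<Prod>b<m. block c L (env s) (int (b * L))) / c ^ n \<partial>M)"
    unfolding expectation_walk_event[of "\<lambda>z. int (m * L) \<le> z"]
  proof (rule integral_mono_AE[OF integrable_qexp])
    show "AE s in M. qexp (env s) n (\<lambda>z. of_bool (int (m * L) \<le> z)) 0
        \<le> (\<Prod>b<m. block c L (env s) (int (b * L))) / c ^ n"
      using AE_env by eventually_elim (rule blocks_bound[OF _ c L])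
  qed (use int in auto)
  also have "\<dots> = (\<Prod>b<m. \<integral>s. block c L (env s) (int (b * L)) \<partial>M) / c ^ n"
    using indep_vars_lebesgue_integral[OF finite_lessThan ind integrable_block[OF c]] by simp
  also have "(\<Prod>b<m. \<integral>s. block c L (env s) (int (b * L)) \<partial>M) = (\<Prod>b<m. \<integral>s. block c L (env s) 0 \<partial>M)"
    by (rule prod.cong[OF refl block_stationary])
  also have "\<dots> = (\<integral>s. block c L (env s) 0 \<partial>M) ^ m" by simp
  finally show ?thesis .
qed

text \<open>The number \<open>q\<close> bounds from below the averaged probability of crossing the
  block before falling to -1. It is independent of \<open>c\<close>, \<open>L\<close>,
  \<open>k\<close> and \<open>h\<close>, which leaves these free to make the other three terms small
  compared with \<open>q\<close>.\<close>

lemma block_expectation: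
  "\<exists>q. 0 < q \<and> q < 1 \<and> (\<forall>c L k h. 0 < c \<and> c < 1 \<and> 1 \<le> L \<and> h \<le> int L \<longrightarrow>
    (\<integral>s. block c L (env s) 0 \<partial>M) \<le> c ^ k + (1 - q) + (\<integral>s. (of_bool (h \<le> Z k s) :: real) \<partial>M)
      + \<theta> ^ nat (int L - h + 1) / (1 - \<theta>))"
proof -
  \<comment> \<open>Chosen so that \<open>B powr (- \<kappa> / 2)\<close> is (1 -
    \<open>\<theta>\<close>)/2, whence the mean of min(1, S/B) is at most 1/2. The elementary bound
    of S/(1 + S) by B/(1 + B) plus min(1, S/B)/(1 + B) then averages to at most
    \<open>1 - q\<close>.\<close>
  define B where "B = (2 / (1 - \<theta>)) powr (2 / \<kappa>)"
  define q where "q = 1 / (2 * (1 + B))"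
  have B: "0 < B" using theta by (simp add: B_def)
  have B_powr: "B powr (- \<kappa> / 2) = (1 - \<theta>) / 2"
    unfolding B_def powr_powr using kappa theta by (simp add: powr_minus)
  have q: "0 < q" "q < 1" using B by (auto simp: q_def field_simps)
  show ?thesis
  proof (intro exI[of _ q] conjI allI impI q)
    fix c :: real and L k :: nat and h :: int
    assume "0 < c \<and> c < 1 \<and> 1 \<le> L \<and> h \<le> int L"
    then have c: "0 < c" "c < 1" and L: "1 \<le> L" and h: "h \<le> int L" by auto
    define R where "R s = c ^ k + (B / (1 + B) + 1 / (1 + B) * min 1 (trunc_scale 0 (int L) (env
        s) 0 / B))
       + qexp (env s) k (\<lambda>z. of_bool (h \<le> z)) 0 + min 1 (trunc_scale h (int L + int k) (env s)
           (int L) / 1)" for s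
    have "(\<integral>s. block c L (env s) 0 \<partial>M) \<le> (\<integral>s. R s \<partial>M)"
    proof (rule integral_mono_AE[OF integrable_block[OF c]])
      show "integrable M R" unfolding R_def
        using integrable_min_scale[OF B] integrable_min_scale[of 1] integrable_qexp by auto
      show "AE s in M. block c L (env s) 0 \<le> R s"
        using AE_env AE_scale_nonneg[of 0 "int L" 0]
      proof eventually_elim
        case (elim s)
        define S where "S = trunc_scale 0 (int L) (env s) 0"
        have "S / (1 + S) \<le> B / (1 + B) + 1 / (1 + B) * min 1 (S / B)"
        proof (cases "S \<le> B")
          case True
          then have "S / (1 + S) \<le> B / (1 + B)" using elim(2) B by (simp add: S_def field_simps)
          moreover have "0 \<le> 1 / (1 + B) * min 1 (S / B)" using elim(2) B by (simp add: S_def)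
          ultimately show ?thesis by linarith
        next
          case False
          then have "min 1 (S / B) = 1" using B by (simp add: min_def field_simps)
          moreover have "S / (1 + S) \<le> 1" using elim(2) by (simp add: S_def)
          moreover have "B / (1 + B) + 1 / (1 + B) = 1"
            using B by (simp add: add_divide_distrib[symmetric] add.commute)
          ultimately show ?thesis by simp
        qed
        then show ?case
          using block_upper_bound[OF elim(1) c L, of k h] h unfolding S_def R_def by simp
      qed
    qed
    also have "\<dots> = c ^ k + (B / (1 + B) + 1 / (1 + B) * (\<integral>s. min 1 (trunc_scale 0 (int L) (env s)
        0 / B) \<partial>M))
       + (\<integral>s. (of_bool (h \<le> Z k s) :: real) \<partial>M) + (\<integral>s. min 1 (trunc_scale h (int L + int k) (env
           s) (int L) / 1) \<partial>M)"
      unfolding R_def expectation_walk_event[of "\<lambda>z. h \<le> z"]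
      using integrable_min_scale[OF B] integrable_min_scale[of 1] integrable_qexp by (simp add:
          prob_space)
    also have "\<dots> \<le> c ^ k + (B / (1 + B) + 1 / (1 + B) * (1 / 2))
       + (\<integral>s. (of_bool (h \<le> Z k s) :: real) \<partial>M) + \<theta> ^ nat (int L - h + 1) / (1 - \<theta>)"
    proof (intro add_mono mult_left_mono order_refl)
      have "(\<integral>s. min 1 (trunc_scale 0 (int L) (env s) 0 / B) \<partial>M) \<le> (1 - \<theta>) / 2 * (\<theta> / (1 - \<theta>))"
        using scale_expectation[of 0 0 B "int L"] B unfolding B_powr by simp
      also have "\<dots> = \<theta> / 2" using theta by (simp add: field_simps)
      also have "\<dots> \<le> 1 / 2" using theta by simp
      finally show "(\<integral>s. min 1 (trunc_scale 0 (int L) (env s) 0 / B) \<partial>M) \<le> 1 / 2" .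
      show "(\<integral>s. min 1 (trunc_scale h (int L + int k) (env s) (int L) / 1) \<partial>M)
          \<le> \<theta> ^ nat (int L - h + 1) / (1 - \<theta>)"
        using scale_expectation[OF h, of 1 "int L + int k"] by simp
    qed (use B in auto)
    also have "B / (1 + B) + 1 / (1 + B) * (1 / 2) = 1 - q"
    proof -
      have "B / (1 + B) + 1 / (1 + B) = 1"
        using B by (simp add: add_divide_distrib[symmetric] add.commute)
      moreover have "q = 1 / (1 + B) * (1 / 2)" by (simp add: q_def)
      ultimately show ?thesis by linarith
    qed
    finally show "(\<integral>s. block c L (env s) 0 \<partial>M) \<le> c ^ k + (1 - q) + (\<integral>s. (of_bool (h \<le> Z k s) ::
        real) \<partial>M)
      + \<theta> ^ nat (int L - h + 1) / (1 - \<theta>)" .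
  qed
qed

text \<open>Renormalization: tightness says that the walk needs a time of order n to travel a
  distance of order n^\<kappa>, with a probability that is merely close to 1; independence of blocks
  turns this into a geometric tail in the number of blocks. Tightness is required on the right only,
  the left tail being controlled by \<open>lower_tail\<close>.\<close>

lemma tail_bound:
  assumes tight: "\<And>\<epsilon>. 0 < \<epsilon> \<Longrightarrow> \<exists>K>0. \<forall>\<^sub>F n in sequentially.
      (\<integral>s. (of_bool (K * real n powr \<kappa> \<le> real_of_int (Z n s)) :: real) \<partial>M) \<le> \<epsilon>"
  shows "\<exists>K>0. \<exists>r C. 0 < r \<and> r < 1 \<and> (\<forall>\<^sub>F n in sequentially. \<exists>L\<ge>1. real L \<le> K * real n powr \<kappa> \<and>
      (\<forall>m. (\<integral>s. (of_bool (int (m * L) \<le> \<bar>Z n s\<bar>) :: real) \<partial>M) \<le> C * r ^ m))"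
proof -
  obtain q where q: "0 < q" "q < 1" and blockE: "\<And>c L k h. 0 < c \<Longrightarrow> c < 1 \<Longrightarrow> 1 \<le> L \<Longrightarrow> h \<le> int L \<Longrightarrow>
    (\<integral>s. block c L (env s) 0 \<partial>M) \<le> c ^ k + (1 - q) + (\<integral>s. (of_bool (h \<le> Z k s) :: real) \<partial>M)
      + \<theta> ^ nat (int L - h + 1) / (1 - \<theta>)"
    using block_expectation by blast
  have "(\<lambda>D. exp (- real D)) \<longlonglongrightarrow> 0" by real_asymp
  then have "\<forall>\<^sub>F D in sequentially. exp (- real D) < q / 4"
    by (rule order_tendstoD(2)) (use q in simp)
  then obtain D0 where D0: "\<And>D. D \<ge> D0 \<Longrightarrow> exp (- real D) < q / 4" unfolding eventually_sequentially
      by blast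
  define D where "D = max 1 D0"
  have D: "1 \<le> D" "exp (- real D) < q / 4" using D0[of D] by (auto simp: D_def)
  obtain K1 n1 where K1: "0 < K1"
    and n1: "\<And>n. n \<ge> n1 \<Longrightarrow> (\<integral>s. (of_bool (K1 * real n powr \<kappa> \<le> real_of_int (Z n s)) :: real) \<partial>M) \<le>
        q / 4"
    using tight[of "q / 4"] q unfolding eventually_sequentially by auto
  have "(\<lambda>h. \<theta> ^ h / (1 - \<theta>)) \<longlonglongrightarrow> 0 / (1 - \<theta>)"
    using theta by (intro tendsto_intros LIMSEQ_realpow_zero) auto
  then have "\<forall>\<^sub>F h in sequentially. \<theta> ^ h / (1 - \<theta>) < q / 4"
    by (rule order_tendstoD(2)) (use q in simp)
  then obtain h0 where h0: "\<And>h. h \<ge> h0 \<Longrightarrow> \<theta> ^ h / (1 - \<theta>) < q / 4"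
    unfolding eventually_sequentially by blast
  have "filterlim (\<lambda>n. K1 * real n powr \<kappa>) at_top sequentially"
    using K1 kappa by real_asymp
  then have ev_h: "\<forall>\<^sub>F n in sequentially. real h0 \<le> K1 * real n powr \<kappa>"
    by (simp add: filterlim_at_top)
  define K where "K = 2 * K1 * real D powr \<kappa> + 2"
  define r where "r = max (1 - q / 4) \<theta>"
  define C where "C = exp 1 + 1 / (1 - \<theta>)"
  have "\<forall>\<^sub>F n in sequentially. \<exists>L\<ge>1. real L \<le> K * real n powr \<kappa> \<and>
      (\<forall>m. (\<integral>s. (of_bool (int (m * L) \<le> \<bar>Z n s\<bar>) :: real) \<partial>M) \<le> C * r ^ m)"
    using ev_h eventually_ge_at_top[of n1] eventually_ge_at_top[of 1]
  proof eventually_elim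
    case (elim n)
    \<comment> \<open>The discount \<open>c\<close> is chosen so that \<open>c ^ n\<close> is 1/e,
      and \<open>D\<close> so that \<open>c ^ k\<close> is below \<open>q / 4\<close>. The level
      \<open>h\<close> is of order k^\<kappa>, beyond the typical position at time \<open>k\<close>,
      and \<open>L\<close> is twice \<open>h\<close>, so that returning from \<open>L\<close> below
      \<open>h\<close> is exponentially unlikely. Three errors of size \<open>q / 4\<close> against
      the gain \<open>q\<close> leave \<open>1 - q / 4\<close>.\<close>
    define k where "k = D * n"
    define h where "h = nat \<lceil>K1 * real k powr \<kappa>\<rceil>"
    define L where "L = 2 * h"
    define c where "c = exp (- 1 / real n)"
    have c: "0 < c" "c < 1" using elim by (auto simp: c_def)
    have k: "n \<le> k" "1 \<le> k" using D elim by (auto simp: k_def)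
    then have h_pos: "0 < K1 * real k powr \<kappa>" using K1 by simp
    have h_ge: "K1 * real k powr \<kappa> \<le> real h" unfolding h_def by (rule of_nat_ceiling)
    then have h1: "1 \<le> h" using h_pos by linarith
    have h_le: "real h \<le> K1 * real k powr \<kappa> + 1" unfolding h_def using h_pos by linarith
    have npow: "1 \<le> real n powr \<kappa>" using elim kappa by (intro ge_one_powr_ge_zero) auto
    have "real k powr \<kappa> = real D powr \<kappa> * real n powr \<kappa>" by (simp add: k_def powr_mult)
    then have "real L \<le> 2 * K1 * real D powr \<kappa> * real n powr \<kappa> + 2"
      using h_le by (simp add: L_def mult.assoc)
    also have "\<dots> \<le> K * real n powr \<kappa>" using npow by (simp add: K_def algebra_simps)
    finally have LK: "real L \<le> K * real n powr \<kappa>" .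
    have L1: "1 \<le> L" using h1 by (simp add: L_def)
    have "real n powr \<kappa> \<le> real k powr \<kappa>" using k kappa by (intro powr_mono2) auto
    then have "K1 * real n powr \<kappa> \<le> K1 * real k powr \<kappa>" using K1 by simp
    then have "real h0 \<le> real h" using elim(1) h_ge by linarith
    then have hh0: "h0 \<le> h + 1" by simp
    have "(\<integral>s. block c L (env s) 0 \<partial>M) \<le> c ^ k + (1 - q) + (\<integral>s. (of_bool (int h \<le> Z k s) :: real)
        \<partial>M)
      + \<theta> ^ nat (int L - int h + 1) / (1 - \<theta>)"
      by (rule blockE) (use c L1 in \<open>auto simp: L_def\<close>)
    also have "\<dots> \<le> q / 4 + (1 - q) + q / 4 + q / 4"
    proof (intro add_mono order_refl)
      have "c ^ k = exp (- real D)" unfolding c_def exp_of_nat_mult[symmetric] k_def using elim by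
          simp
      then show "c ^ k \<le> q / 4" using D by simp
      have "(\<integral>s. (of_bool (int h \<le> Z k s) :: real) \<partial>M) \<le>
          (\<integral>s. (of_bool (K1 * real k powr \<kappa> \<le> real_of_int (Z k s)) :: real) \<partial>M)"
      proof (intro integral_mono)
        fix s
        show "of_bool (int h \<le> Z k s) \<le> (of_bool (K1 * real k powr \<kappa> \<le> real_of_int (Z k s)) ::
            real)"
        proof (cases "int h \<le> Z k s")
          case True
          then have "real h \<le> real_of_int (Z k s)" by (metis of_int_le_iff of_int_of_nat_eq)
          then show ?thesis using h_ge by simp
        qed simp
      qed (rule integrable_walk
           integrable_walk)+
      also have "\<dots> \<le> q / 4" using n1[of k] elim k by simp
      finally show "(\<integral>s. (of_bool (int h \<le> Z k s) :: real) \<partial>M) \<le> q / 4" .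
      have "nat (int L - int h + 1) = h + 1" by (simp add: L_def)
      then show "\<theta> ^ nat (int L - int h + 1) / (1 - \<theta>) \<le> q / 4" using h0[OF hh0] by simp
    qed
    finally have block: "(\<integral>s. block c L (env s) 0 \<partial>M) \<le> 1 - q / 4" by simp
    have block0: "0 \<le> (\<integral>s. block c L (env s) 0 \<partial>M)"
    proof (rule integral_nonneg_AE)
      show "AE s in M. 0 \<le> block c L (env s) 0"
        using AE_env by eventually_elim (rule block_bounds(1)[OF _ c])
    qed
    have cn: "1 / c ^ n = exp 1"
      unfolding c_def exp_of_nat_mult[symmetric] using elim by (simp add: exp_minus field_simps)
    show ?case
    proof (intro exI[of _ L] conjI L1 LK allI)
      fix m
      have i1: "integrable M (\<lambda>s. of_bool (P (Z n s)) :: real)" for P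
        by (rule integrable_walk)
      have "(\<integral>s. (of_bool (int (m * L) \<le> \<bar>Z n s\<bar>) :: real) \<partial>M) \<le>
         (\<integral>s. (of_bool (int (m * L) \<le> Z n s) + of_bool (Z n s < 1 - int m) :: real) \<partial>M)"
      proof (rule integral_mono[OF i1[of "\<lambda>z. int (m * L) \<le> \<bar>z\<bar>"]
          Bochner_Integration.integrable_add[OF i1[of "\<lambda>z. int (m * L) \<le> z"]
            i1[of "\<lambda>z. z < 1 - int m"]]])
        fix s
        \<comment> \<open>As \<open>L \<ge> 1\<close>, distance \<open>m * L\<close> to the left is
          at least distance \<open>m\<close>, so the left tail decays at least like
          \<open>\<theta> ^ m\<close>.\<close>
        have "m * 1 \<le> m * L" using L1 by (intro mult_left_mono) auto
        then have "int m \<le> int (m * L)" by (simp only: of_nat_le_iff mult_1_right)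
        then have "int (m * L) \<le> \<bar>Z n s\<bar> \<Longrightarrow> int (m * L) \<le> Z n s \<or> Z n s < 1 - int m" by linarith
        then show "of_bool (int (m * L) \<le> \<bar>Z n s\<bar>) \<le>
            of_bool (int (m * L) \<le> Z n s) + (of_bool (Z n s < 1 - int m) :: real)" by auto
      qed
      also have "\<dots> = (\<integral>s. (of_bool (int (m * L) \<le> Z n s) :: real) \<partial>M) + (\<integral>s. (of_bool (Z n s < 1 -
          int m) :: real) \<partial>M)"
        by (rule Bochner_Integration.integral_add[OF i1[of "\<lambda>z. int (m * L) \<le> z"]
              i1[of "\<lambda>z. z < 1 - int m"]])
      also have "\<dots> \<le> (1 - q / 4) ^ m * exp 1 + \<theta> ^ m / (1 - \<theta>)"
      proof (intro add_mono lower_tail)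
        have "(\<integral>s. (of_bool (int (m * L) \<le> Z n s) :: real) \<partial>M) \<le> (\<integral>s. block c L (env s) 0 \<partial>M) ^ m
            * (1 / c ^ n)"
          using upper_tail[OF c L1, of m n] by simp
        also have "\<dots> \<le> (1 - q / 4) ^ m * (1 / c ^ n)"
          using c by (intro mult_right_mono power_mono block block0) auto
        finally show "(\<integral>s. (of_bool (int (m * L) \<le> Z n s) :: real) \<partial>M) \<le> (1 - q / 4) ^ m * exp 1"
          unfolding cn .
      qed
      also have "\<dots> \<le> r ^ m * exp 1 + r ^ m / (1 - \<theta>)"
        using q theta by (intro add_mono mult_right_mono divide_right_mono power_mono) (auto simp:
            r_def)
      also have "\<dots> = C * r ^ m" by (simp add: C_def algebra_simps)
      finally show "(\<integral>s. (of_bool (int (m * L) \<le> \<bar>Z n s\<bar>) :: real) \<partial>M) \<le> C * r ^ m" .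
    qed
  qed
  moreover have "0 < K" using K1 by (simp add: K_def add_nonneg_pos)
  moreover have "0 < r" "r < 1" using q theta by (auto simp: r_def)
  ultimately show ?thesis by blast
qed

text \<open>Geometric tails at scale n^\<kappa> are summed over layers of width \<open>L\<close>.
  The finitely many times before the tail bound applies are covered by the fact that the walk moves
  at most one site per step.\<close>

theorem exponential_moment:
  assumes tight: "\<And>\<epsilon>. 0 < \<epsilon> \<Longrightarrow> \<exists>K>0. \<forall>\<^sub>F n in sequentially.
      (\<integral>s. (of_bool (K * real n powr \<kappa> \<le> real_of_int (Z n s)) :: real) \<partial>M) \<le> \<epsilon>"
  shows "\<exists>a>0. \<exists>C. \<forall>n\<ge>1. (\<integral>s. exp (a * \<bar>real_of_int (Z n s)\<bar> / real n powr \<kappa>) \<partial>M) \<le> C"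
proof -
  obtain K r C n0 where K: "0 < K" and r: "0 < r" "r < 1"
    and tail: "\<And>n. n \<ge> n0 \<Longrightarrow> \<exists>L\<ge>1. real L \<le> K * real n powr \<kappa> \<and>
      (\<forall>m. (\<integral>s. (of_bool (int (m * L) \<le> \<bar>Z n s\<bar>) :: real) \<partial>M) \<le> C * r ^ m)"
    using tail_bound[OF tight] unfolding eventually_sequentially by blast
  \<comment> \<open>This makes \<open>exp (a * K)\<close> equal to \<open>1 / sqrt r\<close>: the
    exponential grows over one layer by at most this factor while the tail shrinks by
    \<open>r\<close>, leaving a geometric series of ratio \<open>sqrt r\<close>.\<close>
  define a where "a = - ln r / (2 * K)"
  have a: "0 < a" using K r unfolding a_def by (intro divide_pos_pos) auto
  have aK: "exp (a * K) * r = sqrt r" "exp (a * K) = 1 / sqrt r"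
  proof -
    have "a * K = - (ln r / 2)" using K by (simp add: a_def)
    moreover have "exp (ln r / 2) = sqrt r" using r by (simp add: ln_sqrt[symmetric])
    ultimately show "exp (a * K) = 1 / sqrt r" by (simp add: exp_minus inverse_eq_divide)
    then show "exp (a * K) * r = sqrt r" using r by (simp add: real_div_sqrt)
  qed
  have sr: "0 \<le> sqrt r" "sqrt r < 1" using r by auto
  have int: "integrable M (\<lambda>s. exp (a * \<bar>real_of_int (Z n s)\<bar> / real n powr \<kappa>))" for n
    by (rule integrable_walk)
  have "0 \<le> C"
  proof -
    obtain L where "(\<integral>s. (of_bool (int (0 * L) \<le> \<bar>Z n0 s\<bar>) :: real) \<partial>M) \<le> C * r ^ 0" using tail[of
        n0] by blast
    then show ?thesis by (simp add: prob_space)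
  qed
  have bound: "(\<integral>s. exp (a * \<bar>real_of_int (Z n s)\<bar> / real n powr \<kappa>) \<partial>M) \<le>
      max (exp (a * real n0)) (exp (a * K) * C * (1 / (1 - sqrt r)))" if n: "1 \<le> n" for n
  proof (cases "n \<ge> n0")
    case False
    have npow: "1 \<le> real n powr \<kappa>" using n kappa by (intro ge_one_powr_ge_zero) auto
    have "(\<integral>s. exp (a * \<bar>real_of_int (Z n s)\<bar> / real n powr \<kappa>) \<partial>M) \<le> (\<integral>s. exp (a * real n0) \<partial>M)"
    proof (rule integral_mono_AE[OF int])
      show "AE s in M. exp (a * \<bar>real_of_int (Z n s)\<bar> / real n powr \<kappa>) \<le> exp (a * real n0)"
        using AE_walk_bound
      proof eventually_elim
        case (elim s)
        then have "\<bar>Z n s\<bar> \<le> int n" by blast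
        then have *: "\<bar>real_of_int (Z n s)\<bar> \<le> real n0" using False by linarith
        have "a * \<bar>real_of_int (Z n s)\<bar> / real n powr \<kappa> \<le> a * \<bar>real_of_int (Z n s)\<bar> / 1"
          using npow a n by (intro divide_left_mono) auto
        also have "\<dots> \<le> a * real n0" using * a by simp
        finally show ?case by simp
      qed
    qed simp
    then show ?thesis by (simp add: prob_space)
  next
    case True
    then obtain L where L: "1 \<le> L" "real L \<le> K * real n powr \<kappa>"
      and tailL: "\<And>m. (\<integral>s. (of_bool (int (m * L) \<le> \<bar>Z n s\<bar>) :: real) \<partial>M) \<le> C * r ^ m"
      using tail by blast
    have i1: "integrable M (\<lambda>s. exp (a * K) ^ Suc m * of_bool (int (m * L) \<le> \<bar>Z n s\<bar>))" for m
      by (rule integrable_walk)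
    have "(\<integral>s. exp (a * \<bar>real_of_int (Z n s)\<bar> / real n powr \<kappa>) \<partial>M) \<le>
        (\<integral>s. (\<Sum>m<Suc n. exp (a * K) ^ Suc m * of_bool (int (m * L) \<le> \<bar>Z n s\<bar>)) \<partial>M)"
    proof (rule integral_mono_AE[OF int])
      show "AE s in M. exp (a * \<bar>real_of_int (Z n s)\<bar> / real n powr \<kappa>) \<le>
          (\<Sum>m<Suc n. exp (a * K) ^ Suc m * of_bool (int (m * L) \<le> \<bar>Z n s\<bar>))"
        using AE_walk_bound
      proof eventually_elim
        case (elim s)
        define y where "y = nat \<bar>Z n s\<bar>"
        have y: "\<bar>Z n s\<bar> = int y" by (simp add: y_def)
        have "y \<le> n" using elim[rule_format, of n] y by simp
        define m where "m = y div L"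
        have m: "m * L \<le> y" "y < Suc m * L" unfolding m_def using L
          by (auto simp: dividend_less_div_times div_times_less_eq_dividend)
        have "m \<le> n" using \<open>y \<le> n\<close> unfolding m_def by (meson div_le_dividend le_trans)
        have "real y \<le> real (Suc m) * real L" using m(2)
          by (simp only: of_nat_mult[symmetric] of_nat_le_iff less_imp_le)
        also have "\<dots> \<le> real (Suc m) * (K * real n powr \<kappa>)" using L by (intro mult_left_mono) auto
        finally have "real y / real n powr \<kappa> \<le> real (Suc m) * K" using n by (simp add: field_simps)
        then have "a * (real y / real n powr \<kappa>) \<le> a * (real (Suc m) * K)" using a by (intro
            mult_left_mono) auto
        moreover have "\<bar>real_of_int (Z n s)\<bar> = real y" using y by linarith
        ultimately have "exp (a * \<bar>real_of_int (Z n s)\<bar> / real n powr \<kappa>) \<le> exp (real (Suc m) * (a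
            * K))"
          by (simp add: mult_ac del: of_nat_Suc)
        also have "\<dots> = exp (a * K) ^ Suc m * of_bool (int (m * L) \<le> \<bar>Z n s\<bar>)"
          using m(1) unfolding y exp_of_nat_mult by (simp del: of_nat_mult of_nat_Suc power_Suc)
        also have "\<dots> \<le> (\<Sum>m<Suc n. exp (a * K) ^ Suc m * of_bool (int (m * L) \<le> \<bar>Z n s\<bar>))"
          using \<open>m \<le> n\<close> by (intro member_le_sum) auto
        finally show ?case .
      qed
    qed (intro Bochner_Integration.integrable_sum i1)
    also have "\<dots> = (\<Sum>m<Suc n. \<integral>s. exp (a * K) ^ Suc m * of_bool (int (m * L) \<le> \<bar>Z n s\<bar>) \<partial>M)"
      by (intro Bochner_Integration.integral_sum i1)
    also have "\<dots> \<le> (\<Sum>m<Suc n. exp (a * K) ^ Suc m * (C * r ^ m))"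
    proof (intro sum_mono)
      fix m
      have "(\<integral>s. exp (a * K) ^ Suc m * of_bool (int (m * L) \<le> \<bar>Z n s\<bar>) \<partial>M) =
          exp (a * K) ^ Suc m * (\<integral>s. (of_bool (int (m * L) \<le> \<bar>Z n s\<bar>) :: real) \<partial>M)" by simp
      also have "\<dots> \<le> exp (a * K) ^ Suc m * (C * r ^ m)" by (intro mult_left_mono tailL) auto
      finally show "(\<integral>s. exp (a * K) ^ Suc m * of_bool (int (m * L) \<le> \<bar>Z n s\<bar>) \<partial>M)
          \<le> exp (a * K) ^ Suc m * (C * r ^ m)" .
    qed
    also have "\<dots> = exp (a * K) * C * (\<Sum>m<Suc n. (exp (a * K) * r) ^ m)"
      unfolding sum_distrib_left by (intro sum.cong refl) (simp add: power_mult_distrib)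
    also have "\<dots> \<le> exp (a * K) * C * (1 / (1 - sqrt r))"
      unfolding aK(1) using \<open>0 \<le> C\<close> sr by (intro mult_left_mono geometric_sum_le) auto
    finally show ?thesis by simp
  qed
  then show ?thesis using a by blast
qed

end

section \<open>Sums of independent variables and moments of weak limits\<close>

context prob_space
begin

lemma markov_inequality_set:
  assumes [measurable]: "f \<in> borel_measurable M" "A \<in> sets M"
    and "\<And>x. x \<in> A \<Longrightarrow> a \<le> f x" "\<And>x. x \<in> space M \<Longrightarrow> 0 \<le> f x" "integrable M f"
  shows "a * prob A \<le> (\<integral>x. f x \<partial>M)"
proof -
  have "a * prob A = (\<integral>x. a * indicator A x \<partial>M)" by simp
  also have "\<dots> \<le> (\<integral>x. f x \<partial>M)"
    using assms
    by (intro integral_mono integrable_mult_right integrable_real_indicator)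
       (auto simp: indicator_def emeasure_eq_measure)
  finally show ?thesis .
qed

text \<open>Instead of a stopping time, the proof follows the square of the partial sums, replaced by
  \<open>\<epsilon>\<^sup>2\<close> from the first exceedance on; its mean grows by at most the variance of each summand.\<close>

lemma kolmogorov_maximal_inequality:
  fixes V :: "nat \<Rightarrow> 'a \<Rightarrow> real"
  assumes ind: "indep_vars (\<lambda>_. borel) V UNIV"
    and sq: "\<And>k. integrable M (\<lambda>x. (V k x)\<^sup>2)"
    and mean: "\<And>k. expectation (V k) = 0" and \<epsilon>: "0 < \<epsilon>"
  shows "\<epsilon>\<^sup>2 * prob {x \<in> space M. \<exists>k\<le>n. \<epsilon> \<le> \<bar>\<Sum>i<k. V (m + i) x\<bar>}
    \<le> (\<Sum>i<n. expectation (\<lambda>x. (V (m + i) x)\<^sup>2))"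
proof -
  have [measurable]: "V k \<in> borel_measurable M" for k
    using ind by (simp add: indep_vars_def)
  have int: "integrable M (V k)" for k
    by (rule square_integrable_imp_integrable[OF _ sq]) simp
  define S where "S k x = (\<Sum>i<k. V (m + i) x)" for k x
  define A where "A k x \<longleftrightarrow> (\<exists>j\<le>k. \<epsilon> \<le> \<bar>S j x\<bar>)" for k x
  have [measurable]: "S k \<in> borel_measurable M" for k unfolding S_def by measurable
  have [measurable]: "Measurable.pred M (A k)" for k unfolding A_def by measurable
  have S_Suc: "S (Suc k) x = S k x + V (m + k) x" for k x by (simp add: S_def)
  have small: "\<bar>S k x\<bar> \<le> \<epsilon>" if "\<not> A k x" for k x
    using that unfolding A_def by (meson le_refl linear)
  define D where "D k x = (if A k x then \<epsilon>\<^sup>2 else (S k x)\<^sup>2)" for k x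
  \<comment> \<open>The partial sum killed at the first exceedance. It depends only on summands
    before index \<open>m + k\<close>, hence is independent of the next one, and the cross term has
    mean zero.\<close>
  define B where "B k x = (if A k x then 0 else S k x)" for k x
  have [measurable]: "D k \<in> borel_measurable M" "B k \<in> borel_measurable M" for k
    unfolding D_def B_def by measurable
  have Dle: "D k x \<le> \<epsilon>\<^sup>2" for k x
    using small[of k x] \<epsilon> by (auto simp: D_def abs_le_square_iff[symmetric])
  have D0: "0 \<le> D k x" for k x by (simp add: D_def)
  have intD: "integrable M (D k)" for k
    by (rule integrable_const_bound[where B = "\<epsilon>\<^sup>2"]) (use Dle D0 in auto)
  have intB: "integrable M (B k)" for k
    by (rule integrable_const_bound[where B = \<epsilon>]) (use small \<epsilon> in \<open>auto simp: B_def\<close>)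
  have indepB: "indep_var borel (B k) borel (V (m + k))" for k
  proof -
    define b where "b v = (if \<exists>j\<le>k. \<epsilon> \<le> \<bar>\<Sum>i<j. v (m + i)\<bar> then 0 else \<Sum>i<k. v (m + i))" for v ::
        "nat \<Rightarrow> real"
    have comp: "(\<lambda>v. v i :: real) \<in> borel_measurable (PiM {..<m + k} (\<lambda>_. borel))" if "i < m + k"
        for i
      using that by (intro measurable_component_singleton) auto
    have sums: "(\<lambda>v. \<Sum>i<j. v (m + i) :: real) \<in> borel_measurable (PiM {..<m + k} (\<lambda>_. borel))" if
        "j \<le> k" for j
      using that by (intro borel_measurable_sum comp) auto
    have b: "b \<in> borel_measurable (PiM {..<m + k} (\<lambda>_. borel))"
      unfolding b_def
    proof (intro measurable_If sums order_refl measurable_const)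
      have "{v \<in> space (PiM {..<m + k} (\<lambda>_. borel)). \<exists>j\<le>k. \<epsilon> \<le> \<bar>\<Sum>i<j. v (m + i)\<bar>} =
        (\<Union>j\<in>{..k}. {v \<in> space (PiM {..<m + k} (\<lambda>_. borel)). \<epsilon> \<le> \<bar>\<Sum>i<j. v (m + i)\<bar>})"
        by auto
      also have "\<dots> \<in> sets (PiM {..<m + k} (\<lambda>_. borel))"
        using sums by (intro sets.finite_UN borel_measurable_le borel_measurable_abs) auto
      finally show "{v \<in> space (PiM {..<m + k} (\<lambda>_. borel)). \<exists>j\<le>k. \<epsilon> \<le> \<bar>\<Sum>i<j. v (m + i)\<bar>}
         \<in> sets (PiM {..<m + k} (\<lambda>_. borel))" .
    qed simp
    have "indep_var (PiM {..<m + k} (\<lambda>_. borel)) (\<lambda>x. restrict (\<lambda>i. V i x) {..<m + k})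
       (PiM {m + k} (\<lambda>_. borel)) (\<lambda>x. restrict (\<lambda>i. V i x) {m + k})"
      by (rule indep_var_restrict[OF ind]) auto
    from indep_var_compose[OF this b, of "\<lambda>v. v (m + k)" borel]
    have "indep_var borel (b \<circ> (\<lambda>x. restrict (\<lambda>i. V i x) {..<m + k})) borel
        ((\<lambda>v. v (m + k)) \<circ> (\<lambda>x. restrict (\<lambda>i. V i x) {m + k}))"
      by simp
    moreover have "b \<circ> (\<lambda>x. restrict (\<lambda>i. V i x) {..<m + k}) = B k"
      by (auto simp: b_def B_def A_def S_def fun_eq_iff)
    moreover have "(\<lambda>v. v (m + k)) \<circ> (\<lambda>x. restrict (\<lambda>i. V i x) {m + k}) = V (m + k)"
      by (auto simp: fun_eq_iff)
    ultimately show ?thesis by simp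
  qed
  have "expectation (D n) \<le> (\<Sum>i<n. expectation (\<lambda>x. (V (m + i) x)\<^sup>2))" for n
  proof (induction n)
    case 0
    have "D 0 x = 0" for x using \<epsilon> by (simp add: D_def A_def S_def)
    then show ?case by simp
  next
    case (Suc n)
    have intBV: "integrable M (\<lambda>x. B n x * V (m + n) x)"
      by (rule indep_var_integrable[OF indepB intB int])
    have "expectation (D (Suc n)) \<le> expectation (\<lambda>x. D n x + 2 * (B n x * V (m + n) x) + (V (m +
        n) x)\<^sup>2)"
    proof (rule integral_mono[OF intD])
      show "integrable M (\<lambda>x. D n x + 2 * (B n x * V (m + n) x) + (V (m + n) x)\<^sup>2)"
        using intD intBV sq by auto
      fix x
      show "D (Suc n) x \<le> D n x + 2 * (B n x * V (m + n) x) + (V (m + n) x)\<^sup>2"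
      proof (cases "A n x")
        case True
        then have "A (Suc n) x" unfolding A_def using le_SucI by blast
        then show ?thesis using True by (simp add: D_def B_def)
      next
        case False
        have "D (Suc n) x \<le> (S (Suc n) x)\<^sup>2"
        proof (cases "A (Suc n) x")
          case True
          then have "\<epsilon> \<le> \<bar>S (Suc n) x\<bar>" using False unfolding A_def by (metis le_SucE)
          then show ?thesis using True \<epsilon> by (simp add: D_def abs_le_square_iff[symmetric])
        qed (simp add: D_def)
        also have "\<dots> = D n x + 2 * (B n x * V (m + n) x) + (V (m + n) x)\<^sup>2"
          using False by (simp add: S_Suc D_def B_def power2_sum)
        finally show ?thesis .
      qed
    qed
    also have "\<dots> = expectation (D n) + 2 * expectation (\<lambda>x. B n x * V (m + n) x)
        + expectation (\<lambda>x. (V (m + n) x)\<^sup>2)"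
      using intD intBV sq by simp
    also have "expectation (\<lambda>x. B n x * V (m + n) x) = 0"
      by (subst indep_var_lebesgue_integral[OF indepB intB int]) (simp add: mean)
    finally show ?case using Suc by simp
  qed
  moreover have "\<epsilon>\<^sup>2 * prob {x \<in> space M. A n x} \<le> expectation (D n)"
  proof (rule markov_inequality_set[OF _ _ _ D0 intD])
    fix x assume "x \<in> {x \<in> space M. A n x}"
    then show "\<epsilon>\<^sup>2 \<le> D n x" by (simp add: D_def)
  qed measurable
  ultimately show ?thesis unfolding A_def S_def by (meson order_trans)
qed

text \<open>Convergence in mean square would not be enough: the limit variable is a pointwise
  infinite sum, so its law can be identified only where the series converges. The maximal inequality
  makes the tails of the partial sums uniformly small almost surely, and the Cauchy criterion
  applies.\<close>

theorem AE_summable_independent: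
  fixes V :: "nat \<Rightarrow> 'a \<Rightarrow> real"
  assumes ind: "indep_vars (\<lambda>_. borel) V UNIV"
    and sq: "\<And>k. integrable M (\<lambda>x. (V k x)\<^sup>2)"
    and mean: "\<And>k. expectation (V k) = 0"
    and summ: "summable (\<lambda>k. expectation (\<lambda>x. (V k x)\<^sup>2))"
  shows "AE x in M. summable (\<lambda>k. V k x)"
proof -
  have [measurable]: "V k \<in> borel_measurable M" for k
    using ind by (simp add: indep_vars_def)
  define v where "v k = expectation (\<lambda>x. (V k x)\<^sup>2)" for k
  have v0: "0 \<le> v k" for k by (simp add: v_def)
  have AE: "AE x in M. \<exists>m. \<forall>k. \<bar>\<Sum>i<k. V (m + i) x\<bar> < \<epsilon>" if \<epsilon>: "0 < \<epsilon>" for \<epsilon>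
  proof -
    define F where "F m n = {x \<in> space M. \<exists>k\<le>n. \<epsilon> \<le> \<bar>\<Sum>i<k. V (m + i) x\<bar>}" for m n
    have F: "F m n \<in> sets M" for m n unfolding F_def by measurable
    define G where "G = (\<Inter>m. \<Union>n. F m n)"
    have G: "G \<in> sets M" unfolding G_def using F by auto
    have summ': "summable (\<lambda>i. v (m + i))" for m
      using summable_ignore_initial_segment[OF summ, of m] by (simp add: v_def add.commute)
    have "prob G \<le> (\<Sum>i. v (m + i)) / \<epsilon>\<^sup>2" for m
    proof -
      have "incseq (F m)" unfolding incseq_def F_def using le_trans by blast
      then have "(\<lambda>n. prob (F m n)) \<longlonglongrightarrow> prob (\<Union>n. F m n)"
        using F by (intro finite_Lim_measure_incseq) auto
      moreover have "prob (F m n) \<le> (\<Sum>i. v (m + i)) / \<epsilon>\<^sup>2" for n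
      proof -
        have "\<epsilon>\<^sup>2 * prob (F m n) \<le> (\<Sum>i<n. v (m + i))"
          unfolding F_def v_def by (rule kolmogorov_maximal_inequality[OF ind sq mean \<epsilon>])
        also have "\<dots> \<le> (\<Sum>i. v (m + i))" using summ' v0 by (intro sum_le_suminf) auto
        finally show ?thesis using \<epsilon> by (simp add: field_simps)
      qed
      ultimately have "prob (\<Union>n. F m n) \<le> (\<Sum>i. v (m + i)) / \<epsilon>\<^sup>2" by (intro LIMSEQ_le_const2) auto
      moreover have "prob G \<le> prob (\<Union>n. F m n)"
        unfolding G_def using F by (intro finite_measure_mono) auto
      ultimately show ?thesis by linarith
    qed
    moreover have "(\<lambda>m. (\<Sum>i. v (m + i)) / \<epsilon>\<^sup>2) \<longlonglongrightarrow> 0 / \<epsilon>\<^sup>2"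
    proof (intro tendsto_divide tendsto_const)
      show "(\<lambda>m. \<Sum>i. v (m + i)) \<longlonglongrightarrow> 0"
        using suminf_exist_split2[OF summ] by (simp add: v_def add.commute)
    qed (use \<epsilon> in simp)
    ultimately have "prob G \<le> 0" by (intro LIMSEQ_le_const[of "\<lambda>m. (\<Sum>i. v (m + i)) / \<epsilon>\<^sup>2"]) auto
    then have "prob G = 0" by (simp add: measure_le_0_iff)
    then have "G \<in> null_sets M" using G by (intro null_setsI) (auto simp: emeasure_eq_measure)
    from AE_not_in[OF this] show ?thesis
    proof (rule AE_mp, intro AE_I2 impI)
      fix x assume "x \<in> space M" "x \<notin> G"
      then obtain m where "\<And>n. x \<notin> F m n" unfolding G_def by auto
      then have "\<bar>\<Sum>i<k. V (m + i) x\<bar> < \<epsilon>" for k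
        using \<open>x \<in> space M\<close> by (force simp: F_def not_le)
      then show "\<exists>m. \<forall>k. \<bar>\<Sum>i<k. V (m + i) x\<bar> < \<epsilon>" by blast
    qed
  qed
  have "AE x in M. \<forall>j. \<exists>m. \<forall>k. \<bar>\<Sum>i<k. V (m + i) x\<bar> < 1 / real (Suc j)"
    unfolding AE_all_countable using AE by simp
  then show ?thesis
  proof eventually_elim
    case (elim x)
    have "\<exists>N. \<forall>m\<ge>N. \<forall>n. norm (\<Sum>i\<in>{m..<n}. V i x) < e" if "0 < e" for e
    proof -
      obtain j where j: "1 / real (Suc j) < e / 2"
        using nat_approx_posE[of "e / 2"] \<open>0 < e\<close> by auto
      obtain m where m: "\<And>k. \<bar>\<Sum>i<k. V (m + i) x\<bar> < 1 / real (Suc j)" using elim by blast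
      show ?thesis
      proof (intro exI[of _ m] allI impI)
        fix a b assume "m \<le> a"
        show "norm (\<Sum>i\<in>{a..<b}. V i x) < e"
        proof (cases "a \<le> b")
          case True
          have shift: "(\<Sum>i<c - m. V (m + i) x) = (\<Sum>i\<in>{m..<c}. V i x)" if "m \<le> c" for c
            by (rule sum.reindex_bij_witness[where i = "\<lambda>i. i - m" and j = "\<lambda>i. m + i"]) (use that
                in auto)
          have "(\<Sum>i\<in>{m..<a}. V i x) + (\<Sum>i\<in>{a..<b}. V i x) = (\<Sum>i\<in>{m..<b}. V i x)"
            using \<open>m \<le> a\<close> True by (intro sum.atLeastLessThan_concat)
          then show ?thesis
            using m[of "a - m"] m[of "b - m"] shift[of a] shift[of b] \<open>m \<le> a\<close> True j by simp
        qed (use \<open>0 < e\<close> in simp)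
      qed
    qed
    then show ?case by (simp add: summable_Cauchy)
  qed
qed

end

section \<open>Moments and their passage to weak limits\<close>

lemma power_le_exp:
  fixes a y :: real
  assumes "0 < a" "0 \<le> y"
  shows "y ^ k \<le> fact k / a ^ k * exp (a * y)"
proof -
  have "(\<Sum>i\<in>{k}. inverse (fact i) * (a * y) ^ i) \<le> (\<Sum>i. inverse (fact i) * (a * y) ^ i)"
    using assms by (intro sum_le_suminf summable_exp) auto
  then have "(a * y) ^ k / fact k \<le> exp (a * y)" by (simp add: exp_def divide_inverse mult.commute)
  then show ?thesis using assms by (simp add: power_mult_distrib field_simps)
qed

lemma abs_moment_le:
  fixes f :: "'a \<Rightarrow> real"
  assumes [measurable]: "f \<in> borel_measurable M" and a: "0 < a"
    and int: "integrable M (\<lambda>x. exp (a * \<bar>f x\<bar>))" and C: "(\<integral>x. exp (a * \<bar>f x\<bar>) \<partial>M) \<le> C"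
  shows "(\<integral>x. \<bar>f x\<bar> ^ k \<partial>M) \<le> fact k / a ^ k * C"
proof -
  have int': "integrable M (\<lambda>x. fact k / a ^ k * exp (a * \<bar>f x\<bar>))" using int by simp
  have le: "\<bar>y\<bar> ^ k \<le> fact k / a ^ k * exp (a * \<bar>y\<bar>)" for y :: real
    using a by (intro power_le_exp) auto
  have "integrable M (\<lambda>x. \<bar>f x\<bar> ^ k)"
    by (rule Bochner_Integration.integrable_bound[OF int']) (use le a in \<open>auto simp: abs_mult\<close>)
  then have "(\<integral>x. \<bar>f x\<bar> ^ k \<partial>M) \<le> (\<integral>x. fact k / a ^ k * exp (a * \<bar>f x\<bar>) \<partial>M)"
    by (rule integral_mono[OF _ int' le])
  also have "\<dots> \<le> fact k / a ^ k * C" using a C by (simp add: divide_right_mono mult_left_mono)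
  finally show ?thesis .
qed

text \<open>Clipping \<open>f\<close> at height \<open>K\<close> gives a bounded continuous
  function, to which weak convergence applies, and costs at most \<open>C / K\<close> in the mean,
  uniformly along the sequence. The limit inherits the second moment bound through the truncations
  of \<open>f\<close> squared.\<close>

lemma weak_conv_moment:
  fixes \<mu> :: "nat \<Rightarrow> real measure"
  assumes "\<And>n. real_distribution (\<mu> n)" "real_distribution N" "weak_conv_m \<mu> N"
    and cont: "\<And>x. isCont f x" and int: "\<And>n. integrable (\<mu> n) (\<lambda>x. (f x)\<^sup>2)"
    and bound: "\<And>n. (\<integral>x. (f x)\<^sup>2 \<partial>\<mu> n) \<le> C"
  shows "integrable N (\<lambda>x. (f x)\<^sup>2)" "(\<lambda>n. \<integral>x. f x \<partial>\<mu> n) \<longlonglongrightarrow> (\<integral>x. f x \<partial>N :: real)"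
proof -
  interpret N: real_distribution N by fact
  interpret \<mu>: real_distribution "\<mu> n" for n by fact
  have [measurable]: "f \<in> borel_measurable borel"
    using cont by (intro borel_measurable_continuous_onI continuous_at_imp_continuous_on) auto
  have C0: "0 \<le> C" by (rule order_trans[OF _ bound[of 0]]) simp
  have trunc: "(\<integral>x. min ((f x)\<^sup>2) (real K) \<partial>N) \<le> C" for K
  proof (rule LIMSEQ_le_const2)
    show "(\<lambda>n. \<integral>x. min ((f x)\<^sup>2) (real K) \<partial>\<mu> n) \<longlonglongrightarrow> (\<integral>x. min ((f x)\<^sup>2) (real K) \<partial>N)"
      by (rule weak_conv_imp_integral_bdd_continuous_conv[OF assms(1-3), where B = "real K"])
         (use cont in \<open>auto intro!: continuous_intros\<close>)
    have "(\<integral>x. min ((f x)\<^sup>2) (real K) \<partial>\<mu> n) \<le> C" for n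
    proof (rule order_trans[OF _ bound[of n]], rule integral_mono)
      show "integrable (\<mu> n) (\<lambda>x. min ((f x)\<^sup>2) (real K))"
        by (rule \<mu>.integrable_const_bound[where B = "real K"]) auto
    qed (use int in auto)
    then show "\<exists>n0. \<forall>n\<ge>n0. (\<integral>x. min ((f x)\<^sup>2) (real K) \<partial>\<mu> n) \<le> C" by blast
  qed
  have intK: "integrable N (\<lambda>x. min ((f x)\<^sup>2) (real K))" for K
    by (rule N.integrable_const_bound[where B = "real K"]) auto
  have nn: "(\<integral>\<^sup>+x. ennreal ((f x)\<^sup>2) \<partial>N) \<le> ennreal C"
  proof -
    have "(\<integral>\<^sup>+x. ennreal ((f x)\<^sup>2) \<partial>N) = (\<integral>\<^sup>+x. (SUP K. ennreal (min ((f x)\<^sup>2) (real K))) \<partial>N)"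
    proof (intro nn_integral_cong SUP_eqI[symmetric])
      fix x y assume y: "\<And>K. K \<in> UNIV \<Longrightarrow> ennreal (min ((f x)\<^sup>2) (real K)) \<le> y"
      obtain K where "(f x)\<^sup>2 \<le> real K" using real_arch_simple by blast
      then show "ennreal ((f x)\<^sup>2) \<le> y" using y[of K] by (simp add: min_def)
    qed (auto intro!: ennreal_leI)
    also have "\<dots> = (SUP K. (\<integral>\<^sup>+x. ennreal (min ((f x)\<^sup>2) (real K)) \<partial>N))"
      by (rule nn_integral_monotone_convergence_SUP) (auto simp: incseq_def le_fun_def intro!:
          ennreal_leI)
    also have "\<dots> \<le> ennreal C"
    proof (rule SUP_least)
      fix K :: nat
      show "(\<integral>\<^sup>+x. ennreal (min ((f x)\<^sup>2) (real K)) \<partial>N) \<le> ennreal C"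
        by (subst nn_integral_eq_integral[OF intK]) (use trunc in \<open>auto intro!: ennreal_leI\<close>)
    qed
    finally show ?thesis .
  qed
  show intN: "integrable N (\<lambda>x. (f x)\<^sup>2)"
    by (rule integrableI_nonneg) (use nn in \<open>auto intro: le_less_trans\<close>)
  have boundN: "(\<integral>x. (f x)\<^sup>2 \<partial>N) \<le> C"
  proof -
    have "ennreal (\<integral>x. (f x)\<^sup>2 \<partial>N) \<le> ennreal C"
      using nn by (subst (asm) nn_integral_eq_integral[OF intN]) auto
    then show ?thesis using C0 by simp
  qed
  define clip where "clip K x = max (- K) (min K (f x))" for K x :: real
  have clip: "\<bar>f x - clip K x\<bar> \<le> (f x)\<^sup>2 / K" if "0 < K" for K x
  proof (cases "\<bar>f x\<bar> \<le> K")
    case True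
    then have "clip K x = f x" by (auto simp: clip_def max_def min_def)
    then show ?thesis using that by simp
  next
    case False
    then have "\<bar>f x - clip K x\<bar> \<le> \<bar>f x\<bar>" using that by (auto simp: clip_def max_def min_def)
    moreover have "K * \<bar>f x\<bar> \<le> \<bar>f x\<bar> * \<bar>f x\<bar>" using False by (intro mult_right_mono) auto
    moreover have "K * \<bar>f x - clip K x\<bar> \<le> K * \<bar>f x\<bar>"
      using that by (intro mult_left_mono calculation(1)) simp
    ultimately have "K * \<bar>f x - clip K x\<bar> \<le> (f x)\<^sup>2" by (simp add: power2_eq_square)
    then show ?thesis using that by (simp add: field_simps)
  qed
  have diff: "\<bar>(\<integral>x. f x \<partial>P) - (\<integral>x. clip K x \<partial>P)\<bar> \<le> C / K"
    if P: "real_distribution P" and i: "integrable P (\<lambda>x. (f x)\<^sup>2)" and b: "(\<integral>x. (f x)\<^sup>2 \<partial>P) \<le> C"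
        and K: "0 < K" for P K
  proof -
    interpret P: real_distribution P by (rule P)
    have i1: "integrable P f" by (rule P.square_integrable_imp_integrable[OF _ i]) simp
    have i2: "integrable P (clip K)"
      unfolding clip_def[abs_def] by (rule P.integrable_const_bound[where B = K]) (use K in auto)
    have "\<bar>(\<integral>x. f x \<partial>P) - (\<integral>x. clip K x \<partial>P)\<bar> = \<bar>\<integral>x. f x - clip K x \<partial>P\<bar>"
      using i1 i2 by simp
    also have "\<dots> \<le> (\<integral>x. \<bar>f x - clip K x\<bar> \<partial>P)" by (rule integral_abs_bound)
    also have "\<dots> \<le> (\<integral>x. (f x)\<^sup>2 / K \<partial>P)"
      using i1 i2 i clip K by (intro integral_mono) auto
    also have "\<dots> \<le> C / K" using b K by (simp add: divide_right_mono)
    finally show ?thesis .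
  qed
  show "(\<lambda>n. \<integral>x. f x \<partial>\<mu> n) \<longlonglongrightarrow> (\<integral>x. f x \<partial>N)"
  proof (rule LIMSEQ_I)
    fix e :: real assume e: "0 < e"
    define K where "K = 3 * C / e + 1"
    have "0 \<le> 3 * C / e" using e C0 by simp
    then have K: "0 < K" by (simp add: K_def)
    have "e * K = 3 * C + e" using e by (simp add: K_def field_simps)
    then have K: "0 < K" "C / K < e / 3" using K e by (auto simp: field_simps)
    have "(\<lambda>n. \<integral>x. clip K x \<partial>\<mu> n) \<longlonglongrightarrow> (\<integral>x. clip K x \<partial>N)"
      by (rule weak_conv_imp_integral_bdd_continuous_conv[OF assms(1-3), where B = K])
         (use cont K in \<open>auto simp: clip_def[abs_def] intro!: continuous_intros\<close>)
    from LIMSEQ_D[OF this, of "e / 3"] e obtain n0 where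
      n0: "\<And>n. n \<ge> n0 \<Longrightarrow> norm ((\<integral>x. clip K x \<partial>\<mu> n) - (\<integral>x. clip K x \<partial>N)) < e / 3" by auto
    show "\<exists>n0. \<forall>n\<ge>n0. norm ((\<integral>x. f x \<partial>\<mu> n) - (\<integral>x. f x \<partial>N)) < e"
    proof (intro exI[of _ n0] allI impI)
      fix n assume "n0 \<le> n"
      from n0[OF this] diff[OF assms(1)[of n] int bound K(1)] diff[OF assms(2) intN boundN K(1)]
          K(2)
      show "norm ((\<integral>x. f x \<partial>\<mu> n) - (\<integral>x. f x \<partial>N)) < e" unfolding real_norm_def by linarith
    qed
  qed
qed

text \<open>Equivalent to positivity of 2/\<Gamma>(1 + 2\<kappa>) - 1/\<Gamma>(1 + \<kappa>)^2, the
  factor in the variance of the Mittag-Leffler law. The logarithm \<open>g\<close> of the quotient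
  vanishes at 1 and is strictly decreasing, since the digamma function is increasing.\<close>

lemma Gamma_two_lt_square:
  fixes \<kappa> :: real
  assumes "0 < \<kappa>" "\<kappa> < 1"
  shows "Gamma (1 + 2 * \<kappa>) < 2 * (Gamma (1 + \<kappa>))\<^sup>2"
proof -
  define g where "g x = ln 2 + 2 * ln_Gamma (1 + x) - ln_Gamma (1 + 2 * x)" for x :: real
  have "g 1 < g \<kappa>"
  proof (rule DERIV_neg_imp_decreasing[OF assms(2)])
    fix x assume "\<kappa> \<le> x" "x \<le> 1"
    then have x: "0 < x" using assms by simp
    have "(g has_real_derivative 2 * Digamma (1 + x) - 2 * Digamma (1 + 2 * x)) (at x)"
      unfolding g_def using x by (auto intro!: derivative_eq_intros)
    moreover have "Digamma (1 + x) < Digamma (1 + 2 * x)" using x by (intro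
        Digamma_real_strict_mono) auto
    ultimately show "\<exists>y. (g has_real_derivative y) (at x) \<and> y < 0" by (intro exI conjI) auto
  qed
  moreover have "g 1 = 0"
  proof -
    have "Gamma (3::real) = 2" by (simp add: Gamma_numeral fact_numeral)
    moreover have "Gamma (2::real) = 1" by (simp add: Gamma_numeral)
    ultimately show ?thesis by (simp add: g_def ln_Gamma_real_pos)
  qed
  moreover have "g \<kappa> = ln (2 * (Gamma (1 + \<kappa>))\<^sup>2) - ln (Gamma (1 + 2 * \<kappa>))"
    using assms by (simp add: g_def ln_Gamma_real_pos ln_mult ln_realpow Gamma_real_pos
        less_imp_neq[symmetric])
  moreover have "0 < Gamma (1 + 2 * \<kappa>)" "0 < Gamma (1 + \<kappa>)" using assms by auto
  ultimately show ?thesis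
    using ln_less_cancel_iff[of "Gamma (1 + 2 * \<kappa>)" "2 * (Gamma (1 + \<kappa>))\<^sup>2"] by simp
qed

text \<open>The recursion shows that \<Gamma>(x) \<ge> \<Gamma>(x - 1) for x above 2, so the minimum
  over the compact interval [1, 2] works everywhere. Its use is to dominate the Laplace series by a
  geometric one near 0.\<close>

lemma Gamma_real_lower_bound: "\<exists>m>0. \<forall>x\<ge>1. m \<le> Gamma (x::real)"
proof -
  have "{1..2} \<inter> \<int>\<^sub>\<le>\<^sub>0 = ({} :: real set)" by (auto elim!: nonpos_Ints_cases)
  then have "continuous_on {1..2} (Gamma :: real \<Rightarrow> real)" by (rule continuous_on_Gamma)
  then obtain c where c: "c \<in> {1..2}" "\<And>x. x \<in> {1..2} \<Longrightarrow> Gamma c \<le> Gamma (x::real)"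
    using continuous_attains_inf[of "{1..2::real}" Gamma] by auto
  have "\<forall>x. 1 \<le> x \<and> x \<le> real n + 1 \<longrightarrow> Gamma c \<le> Gamma x" for n
  proof (induction n)
    case 0
    then show ?case using c(2)[of 1] by auto
  next
    case (Suc n)
    show ?case
    proof (intro allI impI, elim conjE)
      fix x :: real assume x: "1 \<le> x" "x \<le> real (Suc n) + 1"
      show "Gamma c \<le> Gamma x"
      proof (cases "x \<le> 2")
        case False
        then have "Gamma c \<le> Gamma (x - 1)" using Suc x by simp
        also have "\<dots> = 1 * Gamma (x - 1)" by simp
        also have "\<dots> \<le> (x - 1) * Gamma (x - 1)" using False by (intro mult_right_mono) auto
        also have "x - 1 \<notin> \<int>\<^sub>\<le>\<^sub>0" using False by (auto elim!: nonpos_Ints_cases)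
        then have "(x - 1) * Gamma (x - 1) = Gamma x" using Gamma_plus1[of "x - 1"] by simp
        finally show ?thesis .
      qed (use c(2)[of x] x in auto)
    qed
  qed
  moreover have "\<exists>n. x \<le> real n + 1" for x :: real
    using real_arch_simple[of x] by (meson le_add_same_cancel1 order_trans zero_le_one)
  moreover have "0 < Gamma c" using c by (intro Gamma_real_pos) auto
  ultimately show ?thesis by (intro exI[of _ "Gamma c"]) blast
qed

text \<open>A degenerate law would have an exponential Laplace transform; this is refuted by the
  coefficients of order \<open>1\<close> and \<open>2\<close> of the power series.\<close>

lemma mittag_leffler_variance_pos:
  assumes \<kappa>: "0 < \<kappa>" "\<kappa> < 1" and b: "0 < b" and N: "mittag_leffler_law \<kappa> b N"
    and int: "integrable N (\<lambda>x. x\<^sup>2)"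
  shows "0 < prob_space.variance N (\<lambda>x. x)"
proof (rule ccontr)
  interpret prob_space N using N by (simp add: mittag_leffler_law_def)
  have [measurable_cong]: "sets N = sets borel" using N by (simp add: mittag_leffler_law_def)
  define c where "c = expectation (\<lambda>x. x)"
  have int1: "integrable N (\<lambda>x. x)"
    by (rule square_integrable_imp_integrable[OF _ int]) simp
  assume "\<not> ?thesis"
  then have "expectation (\<lambda>x. (x - c)\<^sup>2) = 0"
    using variance_positive[of "\<lambda>x. x"] by (simp add: c_def)
  moreover have "integrable N (\<lambda>x. (x - c)\<^sup>2)"
    unfolding power2_diff using int int1 by auto
  ultimately have AE: "AE x in N. x = c"
    using integral_nonneg_eq_0_iff_AE[of N "\<lambda>x. (x - c)\<^sup>2"] by simp
  have laplace: "(\<Sum>n. (- b * l) ^ n / Gamma (1 + \<kappa> * real n)) = exp (- l * c)" if "0 < l" for l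
  proof -
    have "(\<integral>x. exp (- l * x) \<partial>N) = (\<integral>x. exp (- l * c) \<partial>N)"
      using AE by (intro integral_cong_AE) auto
    then show ?thesis using N that by (simp add: mittag_leffler_law_def prob_space)
  qed
  obtain m where m: "0 < m" "\<And>x::real. 1 \<le> x \<Longrightarrow> m \<le> Gamma x" using Gamma_real_lower_bound by blast
  define p where "p n = (- b) ^ n / Gamma (1 + \<kappa> * real n)" for n
  \<comment> \<open>Under the assumption that the law is concentrated at \<open>c\<close>,
    \<open>f\<close> vanishes at every positive argument. Its power series has a nonzero coefficient
    of positive order, so its zero at the origin would have to be isolated.\<close>
  define f where "f l = (\<Sum>n. p n * l ^ n) - exp (- c * l)" for l
  define a where "a n = p n - (- c) ^ n / fact n" for n
  have summ: "summable (\<lambda>n. p n * l ^ n)" if "\<bar>l\<bar> < 1 / b" for l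
  proof (rule summable_comparison_test)
    show "\<exists>k. \<forall>n\<ge>k. norm (p n * l ^ n) \<le> (b * \<bar>l\<bar>) ^ n / m"
    proof (intro exI[of _ 0] allI impI)
      fix n :: nat
      have G: "m \<le> Gamma (1 + \<kappa> * real n)" using \<kappa> by (intro m) simp
      have "norm (p n * l ^ n) = (b * \<bar>l\<bar>) ^ n / Gamma (1 + \<kappa> * real n)"
        using G m b by (simp add: p_def abs_mult power_abs power_mult_distrib)
      also have "\<dots> \<le> (b * \<bar>l\<bar>) ^ n / m"
        using G m b by (intro divide_left_mono) auto
      finally show "norm (p n * l ^ n) \<le> (b * \<bar>l\<bar>) ^ n / m" .
    qed
    show "summable (\<lambda>n. (b * \<bar>l\<bar>) ^ n / m)"
      using that b by (intro summable_divide summable_geometric) (simp add: field_simps)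
  qed
  have a1: "a 1 = c - b / Gamma (1 + \<kappa>)" by (simp add: a_def p_def)
  have a2: "a 2 = b\<^sup>2 / Gamma (1 + 2 * \<kappa>) - c\<^sup>2 / 2" by (simp add: a_def p_def mult.commute)
  have "\<exists>i>0. a i \<noteq> 0"
  proof (rule ccontr)
    assume "\<not> ?thesis"
    then have "a i = 0" if "0 < i" for i using that by blast
    from this[of 1] this[of 2] have "a 1 = 0" "a 2 = 0" by simp_all
    with a1 a2 have *: "b\<^sup>2 / Gamma (1 + 2 * \<kappa>) = (b / Gamma (1 + \<kappa>))\<^sup>2 / 2"
      by simp
    have "0 < Gamma (1 + \<kappa>)" "0 < Gamma (1 + 2 * \<kappa>)" using \<kappa> by auto
    with * b have "Gamma (1 + 2 * \<kappa>) = 2 * (Gamma (1 + \<kappa>))\<^sup>2"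
      by (simp add: power_divide nonzero_divide_eq_eq nonzero_eq_divide_eq)
    with Gamma_two_lt_square[OF \<kappa>] show False by simp
  qed
  then obtain i where i: "0 < i" "a i \<noteq> 0" by blast
  have "(\<lambda>n. a n * (x - 0) ^ n) sums f x" if "norm (x - 0) < 1 / b" for x
  proof -
    have "(\<lambda>n. p n * x ^ n) sums (\<Sum>n. p n * x ^ n)" using summ that by (simp add: summable_sums)
    moreover have "(\<lambda>n. (- c * x) ^ n / fact n) sums exp (- c * x)"
      using exp_converges[of "- c * x"] by (simp add: divide_inverse mult.commute)
    ultimately have "(\<lambda>n. p n * x ^ n - (- c * x) ^ n / fact n) sums f x"
      unfolding f_def by (rule sums_diff)
    moreover have "(- c * x) ^ n = (- c) ^ n * x ^ n" for n by (rule power_mult_distrib)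
    ultimately show ?thesis by (simp add: a_def algebra_simps)
  qed
  moreover have "f 0 = 0"
  proof -
    have "(\<Sum>n. p n * 0 ^ n) = p 0" by (rule powser_zero)
    then show ?thesis by (simp add: f_def p_def)
  qed
  ultimately obtain s where s: "0 < s" "\<And>z. z \<in> cball 0 s - {0} \<Longrightarrow> f z \<noteq> 0"
    using powser_0_nonzero[of "1 / b" 0 a f i] b i by auto
  have "f s = 0"
  proof -
    have "(\<Sum>n. p n * s ^ n) = (\<Sum>n. (- b * s) ^ n / Gamma (1 + \<kappa> * real n))"
      by (simp only: p_def power_mult_distrib) simp
    then show ?thesis using laplace[OF s(1)] by (simp add: f_def mult.commute)
  qed
  with s(2)[of s] s(1) show False by simp
qed

section \<open>Characteristic functions of weighted arrays\<close>

text \<open>Independence gives the characteristic functions of the partial sums as finite products;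
  almost sure convergence of the series and dominated convergence identify their limit. Only
  convergence of these partial products is needed to match the limit of the walk.\<close>

lemma tensor_sum_char:
  assumes Q: "prob_space Q" and ind: "prob_space.indep_vars Q (\<lambda>_. borel) Y UNIV"
    and law: "\<And>k. distr Q borel (Y k) = N" and int: "integrable N (\<lambda>x::real. x\<^sup>2)"
    and summ: "summable (\<lambda>k. (lam k)\<^sup>2)"
  defines "\<phi> \<equiv> char (distr N borel (standardized N (\<lambda>x. x)))"
  shows "tensor_sum Q Y lam \<in> borel_measurable Q"
    and "(\<lambda>K. \<Prod>k<K. \<phi> (t * lam k)) \<longlonglongrightarrow> char (distr Q borel (tensor_sum Q Y lam)) t"
proof -
  interpret Q: prob_space Q by fact
  have [measurable]: "Y k \<in> borel_measurable Q" for k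
    using ind by (simp add: Q.indep_vars_def)
  have sets_N: "sets N = sets borel" using law[of 0] by (metis sets_distr)
  note sets_N [measurable_cong]
  interpret N: prob_space N unfolding law[of 0, symmetric] by (rule Q.prob_space_distr) simp
  have int1: "integrable N (\<lambda>x. x)"
    by (rule N.square_integrable_imp_integrable[OF _ int]) simp
  define g where "g = standardized N (\<lambda>x. x)"
  define c where "c = N.expectation (\<lambda>x. x)"
  define d where "d = sqrt (N.variance (\<lambda>x. x))"
  have g_eq: "g x = (x - c) / d" for x by (simp add: g_def c_def d_def standardized_def)
  have [measurable]: "g \<in> borel_measurable borel" unfolding g_eq[abs_def] by measurable
  have transfer: "(\<integral>q. h (Y k q) \<partial>Q) = (\<integral>x. h x \<partial>N)" if "h \<in> borel_measurable borel" for h ::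
      "real \<Rightarrow> real" and k
    unfolding law[of k, symmetric] using that by (subst integral_distr) auto
  have int_transfer: "integrable Q (\<lambda>q. h (Y k q))" if "h \<in> borel_measurable borel" "integrable N
      h" for h :: "real \<Rightarrow> real" and k
    using that(2) unfolding law[of k, symmetric] by (subst (asm) integrable_distr_eq) (use that in
        auto)
  have std: "standardized Q (Y k) = (\<lambda>q. g (Y k q))" for k
    using transfer[of "\<lambda>x. x" k] transfer[of "\<lambda>x. (x - N.expectation (\<lambda>x. x))\<^sup>2" k]
    by (simp add: fun_eq_iff standardized_def g_def)
  define V where "V k q = lam k * g (Y k q)" for k q
  have [measurable]: "V k \<in> borel_measurable Q" for k unfolding V_def by measurable
  have tensor: "tensor_sum Q Y lam = (\<lambda>q. \<Sum>k. V k q)"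
    by (simp add: fun_eq_iff tensor_sum_def V_def std)
  show meas [measurable]: "tensor_sum Q Y lam \<in> borel_measurable Q"
    unfolding tensor by measurable
  have indV: "Q.indep_vars (\<lambda>_. borel) V UNIV"
    unfolding V_def by (rule Q.indep_vars_compose2[OF ind]) auto
  have int_g: "integrable N g" unfolding g_eq[abs_def] using int1 by auto
  have mean_g: "(\<integral>x. g x \<partial>N) = 0"
    unfolding g_eq[abs_def] using int1 by (simp add: c_def N.prob_space)
  have int_g2: "integrable N (\<lambda>x. (g x)\<^sup>2)"
    unfolding g_eq power_divide power2_diff using int int1 by auto
  have mean: "Q.expectation (V k) = 0" for k
    unfolding V_def using transfer[of g k] by (simp add: mean_g)
  have int_V2: "integrable Q (\<lambda>q. (V k q)\<^sup>2)" for k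
    unfolding V_def power_mult_distrib
    by (intro integrable_mult_right int_transfer[of "\<lambda>x. (g x)\<^sup>2"] int_g2) auto
  have V2: "Q.expectation (\<lambda>q. (V k q)\<^sup>2) = (lam k)\<^sup>2 * (\<integral>x. (g x)\<^sup>2 \<partial>N)" for k
    unfolding V_def power_mult_distrib using transfer[of "\<lambda>x. (g x)\<^sup>2" k] by simp
  have "AE q in Q. summable (\<lambda>k. V k q)"
    by (rule Q.AE_summable_independent[OF indV int_V2 mean])
       (unfold V2, intro summable_mult2 summ)
  then have lim: "AE q in Q. (\<lambda>K. iexp (t * (\<Sum>k<K. V k q))) \<longlonglongrightarrow> iexp (t * tensor_sum Q Y lam q)"
  proof eventually_elim
    case (elim q)
    then have "(\<lambda>K. \<Sum>k<K. V k q) \<longlonglongrightarrow> tensor_sum Q Y lam q"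
      unfolding tensor by (rule summable_LIMSEQ)
    then show ?case by (intro tendsto_intros)
  qed
  have "(\<lambda>K. \<integral>q. iexp (t * (\<Sum>k<K. V k q)) \<partial>Q) \<longlonglongrightarrow> (\<integral>q. iexp (t * tensor_sum Q Y lam q) \<partial>Q)"
    by (rule integral_dominated_convergence[where w = "\<lambda>_. 1", OF _ _ _ lim]) auto
  moreover have "(\<integral>q. iexp (t * tensor_sum Q Y lam q) \<partial>Q) = char (distr Q borel (tensor_sum Q Y
      lam)) t"
    by (simp add: char_def integral_distr)
  moreover have "(\<integral>q. iexp (t * (\<Sum>k<K. V k q)) \<partial>Q) = (\<Prod>k<K. \<phi> (t * lam k))" for K
  proof -
    have "(\<integral>q. iexp (t * (\<Sum>k<K. V k q)) \<partial>Q) = char (distr Q borel (\<lambda>q. \<Sum>k<K. V k q)) t"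
      by (simp add: char_def integral_distr)
    also have "\<dots> = (\<Prod>k<K. char (distr Q borel (V k)) t)"
      by (rule Q.char_distr_sum[OF Q.indep_vars_subset[OF indV]]) simp
    also have "\<dots> = (\<Prod>k<K. \<phi> (t * lam k))"
    proof (intro prod.cong refl)
      fix k
      have "char (distr Q borel (V k)) t = (\<integral>q. iexp (t * lam k * g (Y k q)) \<partial>Q)"
        by (simp add: char_def integral_distr V_def mult.assoc)
      also have "\<dots> = (\<integral>x. iexp (t * lam k * g x) \<partial>distr Q borel (Y k))"
        by (subst integral_distr) auto
      also have "\<dots> = \<phi> (t * lam k)"
        unfolding \<phi>_def law char_def g_def[symmetric] by (subst integral_distr) auto
      finally show "char (distr Q borel (V k)) t = \<phi> (t * lam k)" .
    qed
    finally show ?thesis .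
  qed
  ultimately show "(\<lambda>K. \<Prod>k<K. \<phi> (t * lam k)) \<longlonglongrightarrow> char (distr Q borel (tensor_sum Q Y lam)) t"
    by simp
qed

lemma exp_minus_linear_bound:
  fixes x :: real assumes "0 \<le> x"
  shows "\<bar>exp (- x) - (1 - x)\<bar> \<le> x\<^sup>2"
proof (cases "x \<le> 1")
  case True
  have "1 - x \<le> exp (- x)" using exp_ge_add_one_self[of "- x"] by simp
  moreover have "exp (- x) \<le> 1 - x + x\<^sup>2"
  proof -
    have "exp (- x) \<le> 1 / (1 + x)"
      using exp_ge_add_one_self[of x] assms by (simp add: exp_minus field_simps)
    also have "\<dots> \<le> 1 - x + x\<^sup>2"
    proof -
      have "(1 - x + x\<^sup>2) * (1 + x) = 1 + x ^ 3" by (simp add: algebra_simps power2_eq_square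
          power3_eq_cube)
      then show ?thesis using assms by (simp add: divide_le_eq)
    qed
    finally show ?thesis .
  qed
  ultimately show ?thesis by simp
next
  case False
  have "exp (- x) \<le> 1" "0 \<le> exp (- x)" using assms by auto
  moreover have "x \<le> x\<^sup>2" using False by (simp add: power2_eq_square)
  moreover have "1 - x \<le> exp (- x)" using exp_ge_add_one_self[of "- x"] by simp
  ultimately show ?thesis using False by linarith
qed

text \<open>In an array with rows ordered by decreasing weight, the factors of fixed rank converge to
  those of the limit law, while the remaining factors, all of small weight, behave like a Gaussian
  one.\<close>

lemma array_char_limit:
  fixes \<phi> :: "nat \<Rightarrow> real \<Rightarrow> complex" and v :: "nat \<Rightarrow> real" and \<phi>' :: "real \<Rightarrow> complex"
    and N :: "nat \<Rightarrow> nat" and T :: "nat \<Rightarrow> nat \<Rightarrow> nat" and y :: "nat \<Rightarrow> nat \<Rightarrow> real" and V t :: "nat \<Rightarrow>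
        real"
  assumes le1: "\<And>T u. norm (\<phi> T u) \<le> 1"
    and approx: "\<And>T u. norm (\<phi> T u - (1 - u\<^sup>2 * v T / 2)) \<le> C * \<bar>u\<bar> ^ 3"
    and v: "\<And>T. 0 \<le> v T \<and> v T \<le> C" and v_lim: "v \<longlonglongrightarrow> \<sigma>2"
    and \<phi>_lim: "\<And>S u u'. filterlim S at_top sequentially \<Longrightarrow> u \<longlonglongrightarrow> u' \<Longrightarrow> (\<lambda>j. \<phi> (S j) (u j)) \<longlonglongrightarrow> \<phi>' u'"
    and \<phi>'_0: "\<phi>' 0 = 1" and \<kappa>: "0 < \<kappa>"
    and supp: "\<And>j i. N j \<le> i \<Longrightarrow> y j i = 0" and anti: "\<And>j. antimono (y j)"
    and y0: "\<And>j i. 0 \<le> y j i"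
    and y_eq: "\<forall>\<^sub>F j in sequentially. \<forall>i<N j. real (T j i) powr \<kappa> = y j i * V j"
    and V: "filterlim V at_top sequentially"
    and sq: "\<forall>\<^sub>F j in sequentially. (\<Sum>i<N j. (y j i)\<^sup>2) = 1"
    and y_lim: "\<And>i. (\<lambda>j. y j i) \<longlonglongrightarrow> lam i"
    and var: "(\<lambda>j. \<Sum>i<N j. v (T j i) * (y j i)\<^sup>2) \<longlonglongrightarrow> \<sigma>2"
    and t: "t \<longlonglongrightarrow> t'"
    and summ: "summable (\<lambda>i. (lam i)\<^sup>2)"
    and prod_lim: "(\<lambda>K. \<Prod>i<K. \<phi>' (t' * lam i)) \<longlonglongrightarrow> G"
  shows "(\<lambda>j. \<Prod>i<N j. \<phi> (T j i) (t j * y j i))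
    \<longlonglongrightarrow> G * exp (- (t'\<^sup>2 * \<sigma>2 * (1 - (\<Sum>i. (lam i)\<^sup>2)) / 2))"
proof -
  define P where "P j = (\<Prod>i<N j. \<phi> (T j i) (t j * y j i))" for j
  \<comment> \<open>A hybrid between row \<open>j\<close> and its limit: the \<open>K\<close>
    factors of largest weight are kept, and all others are replaced by one Gaussian factor with the
    same total variance. \<open>H'\<close> is its limit for fixed \<open>K\<close>.\<close>
  define H where "H K j = (\<Prod>i<K. \<phi> (T j i) (t j * y j i)) *
     complex_of_real (exp (- ((t j)\<^sup>2 / 2 * ((\<Sum>i<N j. v (T j i) * (y j i)\<^sup>2) - (\<Sum>i<K. v (T j i) * (y
         j i)\<^sup>2)))))" for K j
  define H' where "H' K = (\<Prod>i<K. \<phi>' (t' * lam i)) *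
     complex_of_real (exp (- (t'\<^sup>2 / 2 * (\<sigma>2 - (\<Sum>i<K. \<sigma>2 * (lam i)\<^sup>2)))))" for K
  define c where "c j = C * \<bar>t j\<bar> ^ 3 + C\<^sup>2 * (t j) ^ 4 / 4" for j
  define c' where "c' = C * \<bar>t'\<bar> ^ 3 + C\<^sup>2 * t' ^ 4 / 4"
  have C: "0 \<le> C" using v[of 0] by linarith
  have \<phi>_0: "\<phi> T 0 = 1" for T using approx[of T 0] by simp
  \<comment> \<open>By \<open>y_eq\<close> the length to the power \<kappa> is weight times
    \<open>V j\<close>, so a positive limiting weight forces the length to infinity.\<close>
  have T_lim: "filterlim (\<lambda>j. T j i) at_top sequentially" if "0 < lam i" for i
  proof -
    have "filterlim (\<lambda>j. y j i * V j) at_top sequentially"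
      by (rule filterlim_tendsto_pos_mult_at_top[OF y_lim that V])
    moreover have "\<forall>\<^sub>F j in sequentially. y j i * V j = real (T j i) powr \<kappa>"
      using y_eq order_tendstoD(1)[OF y_lim that]
    proof eventually_elim
      case (elim j)
      then have "i < N j" using supp[of j i] by (cases "i < N j") auto
      then show ?case using elim by simp
    qed
    ultimately have lim: "filterlim (\<lambda>j. real (T j i) powr \<kappa>) at_top sequentially"
      by (subst (asm) filterlim_cong) auto
    show ?thesis
      unfolding filterlim_at_top
    proof
      fix B :: nat
      have "\<forall>\<^sub>F j in sequentially. real B powr \<kappa> < real (T j i) powr \<kappa>"
        using lim by (simp add: filterlim_at_top_dense)
      then show "\<forall>\<^sub>F j in sequentially. B \<le> T j i"
      proof eventually_elim
        case (elim j)
        then have "\<not> real (T j i) \<le> real B"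
          using \<kappa> powr_mono2[of \<kappa> "real (T j i)" "real B"] by auto
        then show ?case by simp
      qed
    qed
  qed
  have lam0: "0 \<le> lam i" for i using y0 by (intro LIMSEQ_le_const[OF y_lim]) auto
  have factor_lim: "(\<lambda>j. \<phi> (T j i) (t j * y j i)) \<longlonglongrightarrow> \<phi>' (t' * lam i)" for i
  proof (cases "lam i = 0")
    case False
    with lam0[of i] have "0 < lam i" by simp
    then show ?thesis by (intro \<phi>_lim T_lim tendsto_mult t y_lim)
  next
    case True
    \<comment> \<open>If the limiting weight is zero, the length \<open>T j i\<close> may stay
      bounded and the limit law says nothing; the Taylor estimate, uniform in the length, shows that
      the factor tends to 1.\<close>
    define u where "u j = t j * y j i" for j
    have u: "u \<longlonglongrightarrow> 0" unfolding u_def using tendsto_mult[OF t y_lim[of i]] True by simp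
    have "(\<lambda>j. \<phi> (T j i) (u j) - 1) \<longlonglongrightarrow> 0"
    proof (rule Lim_null_comparison)
      show "\<forall>\<^sub>F j in sequentially. norm (\<phi> (T j i) (u j) - 1) \<le> C * \<bar>u j\<bar> ^ 3 + (u j)\<^sup>2 * C"
      proof (intro always_eventually allI)
        fix j
        have "\<phi> (T j i) (u j) - 1 = (\<phi> (T j i) (u j) - (1 - (u j)\<^sup>2 * v (T j i) / 2)) -
            complex_of_real ((u j)\<^sup>2 * v (T j i) / 2)"
          by simp
        also have "norm \<dots> \<le> C * \<bar>u j\<bar> ^ 3 + norm (complex_of_real ((u j)\<^sup>2 * v (T j i) / 2))"
          by (rule order_trans[OF norm_triangle_ineq4 add_mono[OF approx order_refl]])
        also have "norm (complex_of_real ((u j)\<^sup>2 * v (T j i) / 2)) = (u j)\<^sup>2 * (v (T j i) / 2)"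
          using v[of "T j i"] by (subst norm_of_real) (simp add: abs_mult)
        also have "\<dots> \<le> (u j)\<^sup>2 * C"
          using v[of "T j i"] by (intro mult_left_mono) auto
        finally show "norm (\<phi> (T j i) (u j) - 1) \<le> C * \<bar>u j\<bar> ^ 3 + (u j)\<^sup>2 * C" by simp
      qed
      have "(\<lambda>j. C * \<bar>u j\<bar> ^ 3 + (u j)\<^sup>2 * C) \<longlonglongrightarrow> C * \<bar>0\<bar> ^ 3 + 0\<^sup>2 * C"
        by (intro tendsto_intros u)
      then show "(\<lambda>j. C * \<bar>u j\<bar> ^ 3 + (u j)\<^sup>2 * C) \<longlonglongrightarrow> 0" by simp
    qed
    then show ?thesis using True \<phi>'_0 by (simp add: u_def LIM_zero_iff)
  qed
  have v_factor_lim: "(\<lambda>j. v (T j i) * (y j i)\<^sup>2) \<longlonglongrightarrow> \<sigma>2 * (lam i)\<^sup>2" for i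
  proof (cases "lam i = 0")
    case False
    with lam0[of i] have "0 < lam i" by simp
    then show ?thesis
      by (intro tendsto_mult tendsto_power y_lim filterlim_compose[OF v_lim T_lim])
  next
    case True
    have "(\<lambda>j. v (T j i) * (y j i)\<^sup>2) \<longlonglongrightarrow> 0"
    proof (rule Lim_null_comparison)
      show "\<forall>\<^sub>F j in sequentially. norm (v (T j i) * (y j i)\<^sup>2) \<le> C * (y j i)\<^sup>2"
        using v by (intro always_eventually allI) (simp add: abs_mult mult_right_mono)
      have "(\<lambda>j. C * (y j i)\<^sup>2) \<longlonglongrightarrow> C * (lam i)\<^sup>2" by (intro tendsto_intros y_lim)
      then show "(\<lambda>j. C * (y j i)\<^sup>2) \<longlonglongrightarrow> 0" using True by simp
    qed
    then show ?thesis using True by simp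
  qed
  have H_lim: "H K \<longlonglongrightarrow> H' K" for K
    unfolding H_def[abs_def] H'_def
    by (intro tendsto_mult tendsto_prod factor_lim tendsto_of_real tendsto_exp tendsto_minus
         tendsto_diff tendsto_divide tendsto_power tendsto_const tendsto_sum var v_factor_lim t)
             simp
  have H'_lim: "H' \<longlonglongrightarrow> G * exp (- (t'\<^sup>2 * \<sigma>2 * (1 - (\<Sum>i. (lam i)\<^sup>2)) / 2))"
  proof -
    have "(\<lambda>K. \<Sum>i<K. \<sigma>2 * (lam i)\<^sup>2) \<longlonglongrightarrow> \<sigma>2 * (\<Sum>i. (lam i)\<^sup>2)"
      unfolding sum_distrib_left[symmetric] by (intro tendsto_mult tendsto_const summable_LIMSEQ
          summ)
    then have "H' \<longlonglongrightarrow> G * complex_of_real (exp (- (t'\<^sup>2 / 2 * (\<sigma>2 - \<sigma>2 * (\<Sum>i. (lam i)\<^sup>2)))))"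
      unfolding H'_def[abs_def] by (intro tendsto_mult prod_lim tendsto_of_real tendsto_exp
         tendsto_minus tendsto_diff tendsto_const)
    moreover have "- (t'\<^sup>2 / 2 * (\<sigma>2 - \<sigma>2 * (\<Sum>i. (lam i)\<^sup>2))) = - (t'\<^sup>2 * \<sigma>2 * (1 - (\<Sum>i. (lam i)\<^sup>2)) /
        2)"
      by (simp add: field_simps)
    ultimately show ?thesis by (simp only: exp_of_real)
  qed
  have tail: "\<forall>\<^sub>F j in sequentially. norm (P j - H K j) \<le> c j * y j K" for K
    using sq
  proof eventually_elim
    case (elim j)
    \<comment> \<open>Padding the row with zero weights, whose factors are 1, avoids distinguishing
      whether \<open>K\<close> exceeds the length of the row.\<close>
    define M where "M = max K (N j)"
    define u where "u i = t j * y j i" for i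
    have split: "(\<Prod>i<M. f i) = (\<Prod>i<K. f i) * (\<Prod>i\<in>{K..<M}. f i)" for f :: "nat \<Rightarrow> complex"
      using prod.atLeastLessThan_concat[of 0 K M f] by (simp add: M_def lessThan_atLeast0)
    have split': "(\<Sum>i<M. f i) = (\<Sum>i<K. f i) + (\<Sum>i\<in>{K..<M}. f i)" for f :: "nat \<Rightarrow> real"
      using sum.atLeastLessThan_concat[of 0 K M f] by (simp add: M_def lessThan_atLeast0)
    have P: "P j = (\<Prod>i<M. \<phi> (T j i) (u i))"
      unfolding P_def u_def
      by (rule prod.mono_neutral_left) (auto simp: M_def supp \<phi>_0)
    have Nj: "(\<Sum>i<N j. v (T j i) * (y j i)\<^sup>2) = (\<Sum>i<M. v (T j i) * (y j i)\<^sup>2)"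
      by (rule sum.mono_neutral_left) (auto simp: M_def supp)
    have sqM: "(\<Sum>i<M. (y j i)\<^sup>2) = 1"
      unfolding elim[symmetric] by (rule sum.mono_neutral_right) (auto simp: M_def supp)
    define x where "x i = (u i)\<^sup>2 * v (T j i) / 2" for i
    have x: "0 \<le> x i" for i using v by (simp add: x_def)
    have "complex_of_real (exp (- ((t j)\<^sup>2 / 2 * ((\<Sum>i<N j. v (T j i) * (y j i)\<^sup>2) - (\<Sum>i<K. v (T j i)
        * (y j i)\<^sup>2)))))
       = (\<Prod>i\<in>{K..<M}. complex_of_real (exp (- x i)))"
      unfolding Nj split' of_real_prod[symmetric] exp_sum[OF finite_atLeastLessThan, symmetric]
      by (simp add: x_def u_def sum_distrib_left sum_negf power_mult_distrib mult_ac)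
    then have "P j - H K j = (\<Prod>i<K. \<phi> (T j i) (u i)) *
        ((\<Prod>i\<in>{K..<M}. \<phi> (T j i) (u i)) - (\<Prod>i\<in>{K..<M}. complex_of_real (exp (- x i))))"
      unfolding P split H_def u_def[symmetric] by (simp add: algebra_simps)
    also have "norm \<dots> \<le> 1 * norm ((\<Prod>i\<in>{K..<M}. \<phi> (T j i) (u i)) - (\<Prod>i\<in>{K..<M}. complex_of_real
        (exp (- x i))))"
      unfolding norm_mult
    proof (rule mult_right_mono)
      show "norm (\<Prod>i<K. \<phi> (T j i) (u i)) \<le> 1"
        unfolding prod_norm[symmetric] by (intro prod_le_1) (auto simp: le1)
    qed simp
    also have "\<dots> \<le> (\<Sum>i\<in>{K..<M}. norm (\<phi> (T j i) (u i) - complex_of_real (exp (- x i))))"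
      unfolding mult_1 using x by (intro norm_prod_diff le1) auto
    \<comment> \<open>Every error is of order three or higher in the weight. One power is bounded by
      the weight of rank \<open>K\<close>, and the remaining squares sum to at most 1.\<close>
    also have "\<dots> \<le> (\<Sum>i\<in>{K..<M}. c j * y j K * (y j i)\<^sup>2)"
    proof (rule sum_mono)
      fix i assume i: "i \<in> {K..<M}"
      have yK: "y j i \<le> y j K" using i antimonoD[OF anti] by simp
      have "(y j K)\<^sup>2 \<le> 1"
      proof (cases "K < M")
        case True
        have "(y j K)\<^sup>2 \<le> (\<Sum>i<M. (y j i)\<^sup>2)" using True by (intro member_le_sum) auto
        then show ?thesis using sqM by simp
      qed (use i in auto)
      then have yK1: "y j K \<le> 1" using y0[of j K] by (simp add: abs_square_le_1)
      have "norm (\<phi> (T j i) (u i) - complex_of_real (exp (- x i))) \<le>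
         norm (\<phi> (T j i) (u i) - (1 - (u i)\<^sup>2 * v (T j i) / 2)) + norm (complex_of_real (exp (- x
             i) - (1 - x i)))"
      proof -
        have eq: "\<phi> (T j i) (u i) - complex_of_real (exp (- x i)) =
          (\<phi> (T j i) (u i) - (1 - (u i)\<^sup>2 * v (T j i) / 2)) - complex_of_real (exp (- x i) - (1 - x
              i))"
          by (simp add: x_def)
        show ?thesis unfolding eq by (rule norm_triangle_ineq4)
      qed
      also have "\<dots> \<le> C * \<bar>u i\<bar> ^ 3 + (x i)\<^sup>2"
        using exp_minus_linear_bound[OF x[of i]] by (intro add_mono approx) (simp only:
            norm_of_real)
      also have "C * \<bar>u i\<bar> ^ 3 \<le> C * \<bar>t j\<bar> ^ 3 * (y j K * (y j i)\<^sup>2)"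
      proof -
        have "(y j i) ^ 3 = y j i * (y j i)\<^sup>2" by (simp add: power2_eq_square power3_eq_cube)
        also have "\<dots> \<le> y j K * (y j i)\<^sup>2" by (intro mult_right_mono yK) simp
        finally have "C * \<bar>t j\<bar> ^ 3 * (y j i) ^ 3 \<le> C * \<bar>t j\<bar> ^ 3 * (y j K * (y j i)\<^sup>2)"
          using C by (intro mult_left_mono) auto
        then show ?thesis using y0[of j i] by (simp add: u_def abs_mult power_mult_distrib)
      qed
      also have "(x i)\<^sup>2 \<le> C\<^sup>2 * (t j) ^ 4 / 4 * (y j K * (y j i)\<^sup>2)"
      proof -
        have "(x i)\<^sup>2 = (t j) ^ 4 / 4 * ((v (T j i))\<^sup>2 * (y j i) ^ 4)"
          by (simp add: x_def u_def power_mult_distrib power_divide power_mult[symmetric])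
        also have "\<dots> \<le> (t j) ^ 4 / 4 * (C\<^sup>2 * (y j K * (y j i)\<^sup>2))"
        proof (intro mult_left_mono mult_mono power_mono)
          have "(y j i)\<^sup>2 \<le> y j K"
          proof -
            have "y j i * y j i \<le> y j K * 1" using yK yK1 y0 by (intro mult_mono) (auto intro:
                order_trans)
            then show ?thesis by (simp add: power2_eq_square)
          qed
          then have "(y j i)\<^sup>2 * (y j i)\<^sup>2 \<le> y j K * (y j i)\<^sup>2" by (intro mult_right_mono) auto
          then show "(y j i) ^ 4 \<le> y j K * (y j i)\<^sup>2" by (simp add: power_add[symmetric])
        qed (use v in \<open>auto simp: zero_le_even_power\<close>)
        finally show ?thesis by (simp add: mult_ac)
      qed
      finally show "norm (\<phi> (T j i) (u i) - complex_of_real (exp (- x i))) \<le> c j * y j K * (y j i)\<^sup>2"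
        by (simp add: c_def algebra_simps)
    qed
    also have "\<dots> = c j * y j K * (\<Sum>i\<in>{K..<M}. (y j i)\<^sup>2)" by (simp add: sum_distrib_left)
    also have "\<dots> \<le> c j * y j K * 1"
    proof (rule mult_left_mono)
      have "0 \<le> (\<Sum>i<K. (y j i)\<^sup>2)" by (intro sum_nonneg) simp
      then show "(\<Sum>i\<in>{K..<M}. (y j i)\<^sup>2) \<le> 1" using split'[of "\<lambda>i. (y j i)\<^sup>2"] sqM by linarith
      show "0 \<le> c j * y j K" using C y0 by (simp add: c_def zero_le_even_power)
    qed
    finally show ?case by simp
  qed
  have "c \<longlonglongrightarrow> c'" unfolding c_def c'_def by (intro tendsto_intros t) auto
  then have cy_lim: "(\<lambda>j. c j * y j K) \<longlonglongrightarrow> c' * lam K" for K by (intro tendsto_mult y_lim)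
  have "lam \<longlonglongrightarrow> 0"
  proof -
    have "(\<lambda>i. sqrt ((lam i)\<^sup>2)) \<longlonglongrightarrow> sqrt 0"
      using summable_LIMSEQ_zero[OF summ] by (intro tendsto_real_sqrt)
    then show ?thesis using lam0 by simp
  qed
  then have clam: "(\<lambda>K. c' * lam K) \<longlonglongrightarrow> 0" using tendsto_mult[OF tendsto_const] by fastforce
  let ?L = "G * exp (- (t'\<^sup>2 * \<sigma>2 * (1 - (\<Sum>i. (lam i)\<^sup>2)) / 2))"
  have "P \<longlonglongrightarrow> ?L"
  proof (rule LIMSEQ_I)
    fix e :: real assume e: "0 < e"
    then have e3: "0 < e / 3" by simp
    have "\<forall>\<^sub>F K in sequentially. c' * lam K < e / 3 \<and> norm (H' K - ?L) < e / 3"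
      using order_tendstoD(2)[OF clam, of "e / 3"] tendstoD[OF H'_lim, of "e / 3"] e
      by (simp add: dist_norm eventually_conj_iff)
    then obtain K where K: "c' * lam K < e / 3" "norm (H' K - ?L) < e / 3"
      by (auto simp: eventually_sequentially)
    have "\<forall>\<^sub>F j in sequentially. norm (P j - ?L) < e"
      using tail[of K] order_tendstoD(2)[OF cy_lim K(1)] tendstoD[OF H_lim[of K] e3]
    proof eventually_elim
      case (elim j)
      have "P j - ?L = (P j - H K j) + ((H K j - H' K) + (H' K - ?L))" by simp
      also have "norm \<dots> \<le> norm (P j - H K j) + (norm (H K j - H' K) + norm (H' K - ?L))"
        by (intro order_trans[OF norm_triangle_ineq] add_left_mono norm_triangle_ineq)
      also have "\<dots> < e" using elim K by (simp add: dist_norm)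
      finally show ?case .
    qed
    then show "\<exists>n0. \<forall>n\<ge>n0. norm (P n - ?L) < e" by (simp add: eventually_sequentially)
  qed
  then show ?thesis unfolding P_def .
qed

section \<open>The walk at scale \<open>n\<^sup>\<kappa>\<close>\<close>

text \<open>Half of the exponent \<open>a\<close> absorbs the Taylor remainder, the other half the
  factor y^2; the constant 8/a^2 comes from z^2/2 \<le> exp z at z = a|y|/2. The point is a
  quadratic error in \<open>x\<close> whose coefficient has a bounded mean.\<close>

lemma exp_le_quadratic:
  fixes x y a :: real
  assumes a: "0 < a" and x: "\<bar>x\<bar> \<le> a / 2"
  shows "exp (x * y) \<le> 1 + x * y + x\<^sup>2 * (8 / a\<^sup>2 * exp (a * \<bar>y\<bar>))"
proof -
  obtain t where t: "\<bar>t\<bar> \<le> \<bar>x * y\<bar>" "exp (x * y) = (\<Sum>m<2. (x * y) ^ m / fact m) + exp t / fact 2 *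
      (x * y) ^ 2"
    using Maclaurin_exp_le[of "x * y" 2] by blast
  have xy: "\<bar>x * y\<bar> \<le> a / 2 * \<bar>y\<bar>" unfolding abs_mult using x by (intro mult_right_mono) auto
  have "(a / 2 * \<bar>y\<bar>)\<^sup>2 / 2 \<le> exp (a / 2 * \<bar>y\<bar>)"
  proof -
    have z: "0 \<le> a / 2 * \<bar>y\<bar>" using a by simp
    show ?thesis using exp_lower_Taylor_quadratic[OF z] z by linarith
  qed
  then have y2: "y\<^sup>2 \<le> 8 / a\<^sup>2 * exp (a / 2 * \<bar>y\<bar>)"
    using a by (simp add: power_mult_distrib power_divide field_simps)
  have "exp t / 2 * y\<^sup>2 \<le> exp (a / 2 * \<bar>y\<bar>) * (8 / a\<^sup>2 * exp (a / 2 * \<bar>y\<bar>))"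
  proof (intro mult_mono y2)
    have "exp t \<le> exp (a / 2 * \<bar>y\<bar>)" using t(1) xy by simp
    then show "exp t / 2 \<le> exp (a / 2 * \<bar>y\<bar>)" using exp_ge_zero[of "a / 2 * \<bar>y\<bar>"] by linarith
  qed auto
  also have "\<dots> = 8 / a\<^sup>2 * exp (a * \<bar>y\<bar>)" by (simp add: exp_add[symmetric])
  finally have "x\<^sup>2 * (exp t / 2 * y\<^sup>2) \<le> x\<^sup>2 * (8 / a\<^sup>2 * exp (a * \<bar>y\<bar>))" by (intro mult_left_mono)
      auto
  then show ?thesis unfolding t(2) by (simp add: numeral_2_eq_2 power_mult_distrib mult_ac)
qed

locale regular_walk_limit = regular_walk \<alpha> M \<eta> Z \<kappa> for \<alpha> M \<eta> Z \<kappa> +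
  fixes b :: real and N :: "real measure"
  assumes b_pos: "0 < b" and N: "mittag_leffler_law \<kappa> b N"
    and conv: "weak_conv_m (\<lambda>n. distr M borel (\<lambda>s. real_of_int (Z n s) / real n powr \<kappa>)) N"
begin

definition scaled :: "nat \<Rightarrow> 'a \<Rightarrow> real" where
  "scaled n s = real_of_int (Z n s) / real n powr \<kappa>"

text \<open>At \<open>n = 0\<close> division by zero makes \<open>scaled\<close> and
  \<open>centered\<close> vanish, so the uniform bounds below hold for empty increments too.\<close>

definition centered :: "nat \<Rightarrow> 'a \<Rightarrow> real" where
  "centered n s = (real_of_int (Z n s) - expectation (\<lambda>s. real_of_int (Z n s))) / real n powr \<kappa>"

lemma measurable_scaled [measurable]: "scaled n \<in> borel_measurable M"
  unfolding scaled_def by measurable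

lemma measurable_centered [measurable]: "centered n \<in> borel_measurable M"
  unfolding centered_def by measurable

lemma integrable_scaled: "integrable M (\<lambda>s. g (scaled n s))"
  for g :: "real \<Rightarrow> 'c::{banach, second_countable_topology}"
  unfolding scaled_def by (rule integrable_walk)

lemma integrable_centered: "integrable M (\<lambda>s. g (centered n s))"
  for g :: "real \<Rightarrow> 'c::{banach, second_countable_topology}"
  unfolding centered_def
  by (rule integrable_walk)

lemma centered_eq: "centered n s = scaled n s - expectation (scaled n)"
  by (simp add: centered_def scaled_def[abs_def] diff_divide_distrib)

lemma expectation_centered: "expectation (centered n) = 0"
  unfolding centered_eq[abs_def] using integrable_scaled[of "\<lambda>x. x" n] by (simp add: prob_space)

lemma real_distribution_scaled: "real_distribution (distr M borel (scaled n))"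
  by (simp add: real_distribution_distr)

lemma real_distribution_N: "real_distribution N"
  using N by (simp add: mittag_leffler_law_def real_distribution_def real_distribution_axioms_def)

lemma conv_scaled: "weak_conv_m (\<lambda>n. distr M borel (scaled n)) N"
  using conv by (simp add: scaled_def[abs_def])

text \<open>The ramp from 0 at height \<open>K\<close> to 1 at height \<open>K + 1\<close> is a
  continuous substitute for the indicator of a half-line: weak convergence applies to it, and its
  mean under the limit law is small for large \<open>K\<close>.\<close>

lemma tight:
  fixes \<epsilon> :: real
  assumes "0 < \<epsilon>"
  shows "\<exists>K>0. \<forall>\<^sub>F n in sequentially.
      (\<integral>s. of_bool (K * real n powr \<kappa> \<le> real_of_int (Z n s)) \<partial>M) \<le> \<epsilon>"
proof -
  interpret N: real_distribution N by (rule real_distribution_N)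
  define f where "f K x = max 0 (min 1 (x - real K))" for K :: nat and x :: real
  have [measurable]: "f K \<in> borel_measurable borel" for K unfolding f_def by measurable
  have "(\<lambda>K. \<integral>x. f K x \<partial>N) \<longlonglongrightarrow> (\<integral>x. 0 \<partial>N)"
  proof (rule integral_dominated_convergence[where w = "\<lambda>_. 1"])
    show "AE x in N. (\<lambda>K. f K x) \<longlonglongrightarrow> 0"
    proof (intro always_eventually allI)
      fix x
      obtain K0 where "x \<le> real K0" using real_arch_simple by blast
      then have "f K x = 0" if "K \<ge> K0" for K using that by (simp add: f_def)
      then show "(\<lambda>K. f K x) \<longlonglongrightarrow> 0"
        by (intro tendsto_eventually) (auto simp: eventually_sequentially)
    qed
  qed (auto simp: f_def)
  then have "(\<lambda>K. \<integral>x. f K x \<partial>N) \<longlonglongrightarrow> 0" by simp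
  from order_tendstoD(2)[OF this assms] obtain K where K: "(\<integral>x. f K x \<partial>N) < \<epsilon>"
    by (auto simp: eventually_sequentially)
  have "(\<lambda>n. \<integral>x. f K x \<partial>distr M borel (scaled n)) \<longlonglongrightarrow> (\<integral>x. f K x \<partial>N)"
    by (rule weak_conv_imp_integral_bdd_continuous_conv[OF real_distribution_scaled
          real_distribution_N conv_scaled, where B = 1])
       (auto simp: f_def[abs_def] intro!: continuous_intros)
  then have "\<forall>\<^sub>F n in sequentially. (\<integral>x. f K x \<partial>distr M borel (scaled n)) < \<epsilon>"
    using K by (rule order_tendstoD(2))
  then have "\<forall>\<^sub>F n in sequentially.
      (\<integral>s. of_bool ((real K + 1) * real n powr \<kappa> \<le> real_of_int (Z n s)) \<partial>M) \<le> \<epsilon>"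
    using eventually_ge_at_top[of 1]
  proof eventually_elim
    case (elim n)
    have "(\<integral>s. of_bool ((real K + 1) * real n powr \<kappa> \<le> real_of_int (Z n s)) \<partial>M) \<le>
        (\<integral>s. f K (scaled n s) \<partial>M)"
    proof (rule integral_mono[OF integrable_walk
          integrable_scaled])
      fix s
      show "of_bool ((real K + 1) * real n powr \<kappa> \<le> real_of_int (Z n s)) \<le> f K (scaled n s)"
      proof (cases "(real K + 1) * real n powr \<kappa> \<le> real_of_int (Z n s)")
        case True
        then have "real K + 1 \<le> scaled n s" using elim(2) by (simp add: scaled_def field_simps)
        then show ?thesis by (simp add: f_def)
      qed (simp add: f_def)
    qed
    also have "\<dots> = (\<integral>x. f K x \<partial>distr M borel (scaled n))" by (subst integral_distr) auto
    finally show ?case using elim by simp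
  qed
  then show ?thesis by (intro exI[of _ "real K + 1"]) simp
qed

lemma scaled_exp_moment: "\<exists>a>0. \<exists>C. \<forall>n. expectation (\<lambda>s. exp (a * \<bar>scaled n s\<bar>)) \<le> C"
proof -
  obtain a C where a: "0 < a"
    and C: "\<And>n. 1 \<le> n \<Longrightarrow> (\<integral>s. exp (a * \<bar>real_of_int (Z n s)\<bar> / real n powr \<kappa>) \<partial>M) \<le> C"
    using exponential_moment[OF tight] by blast
  have "expectation (\<lambda>s. exp (a * \<bar>scaled n s\<bar>)) \<le> max C 1" for n
  proof (cases "n = 0")
    case True
    then show ?thesis by (simp add: scaled_def prob_space)
  next
    case False
    then show ?thesis using C[of n] by (simp add: scaled_def abs_divide)
  qed
  with a show ?thesis by blast
qed

text \<open>The exponential moment bounds the squares of the functions x and x^2 uniformly, which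
  supplies the hypothesis of \<open>weak_conv_moment\<close>.\<close>

lemma scaled_moment_limits:
  "integrable N (\<lambda>x. x\<^sup>2)"
  "(\<lambda>n. expectation (scaled n)) \<longlonglongrightarrow> (\<integral>x. x \<partial>N)"
  "(\<lambda>n. expectation (\<lambda>s. (scaled n s)\<^sup>2)) \<longlonglongrightarrow> (\<integral>x. x\<^sup>2 \<partial>N)"
proof -
  obtain a C where a: "0 < a" and C: "\<And>n. expectation (\<lambda>s. exp (a * \<bar>scaled n s\<bar>)) \<le> C"
    using scaled_exp_moment by blast
  have bound: "expectation (\<lambda>s. \<bar>scaled n s\<bar> ^ k) \<le> fact k / a ^ k * C" for n k
    by (rule abs_moment_le[OF _ a integrable_scaled C]) simp
  have int: "integrable (distr M borel (scaled n)) (\<lambda>x. (x ^ k)\<^sup>2)" for n k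
    by (subst integrable_distr_eq) (use integrable_scaled in auto)
  have le: "(\<integral>x. (x ^ k)\<^sup>2 \<partial>distr M borel (scaled n)) \<le> fact (2 * k) / a ^ (2 * k) * C" for n k
  proof -
    have "(\<integral>x. (x ^ k)\<^sup>2 \<partial>distr M borel (scaled n)) = expectation (\<lambda>s. \<bar>scaled n s\<bar> ^ (2 * k))"
      by (subst integral_distr) (auto simp: power_mult[symmetric] mult.commute power_even_abs)
    then show ?thesis using bound[of n "2 * k"] by simp
  qed
  have cont: "isCont (\<lambda>x::real. x ^ k) x" for k x by (intro continuous_intros)
  show "integrable N (\<lambda>x. x\<^sup>2)"
    using weak_conv_moment(1)[OF real_distribution_scaled real_distribution_N conv_scaled cont int
        le, of 1] by simp
  show "(\<lambda>n. expectation (scaled n)) \<longlonglongrightarrow> (\<integral>x. x \<partial>N)"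
    using weak_conv_moment(2)[OF real_distribution_scaled real_distribution_N conv_scaled cont int
        le, of 1]
    by (simp add: integral_distr)
  show "(\<lambda>n. expectation (\<lambda>s. (scaled n s)\<^sup>2)) \<longlonglongrightarrow> (\<integral>x. x\<^sup>2 \<partial>N)"
    using weak_conv_moment(2)[OF real_distribution_scaled real_distribution_N conv_scaled cont int
        le, of 2]
    by (simp add: integral_distr)
qed

lemma variance_N_pos: "0 < prob_space.variance N (\<lambda>x. x)"
  by (rule mittag_leffler_variance_pos[OF kappa b_pos N scaled_moment_limits(1)])

lemma centered_variance_limit:
  "(\<lambda>n. expectation (\<lambda>s. (centered n s)\<^sup>2)) \<longlonglongrightarrow> prob_space.variance N (\<lambda>x. x)"
proof -
  interpret N: real_distribution N by (rule real_distribution_N)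
  have int1: "integrable N (\<lambda>x. x)"
    by (rule N.square_integrable_imp_integrable[OF _ scaled_moment_limits(1)]) simp
  have "expectation (\<lambda>s. (centered n s)\<^sup>2) = expectation (\<lambda>s. (scaled n s)\<^sup>2) - (expectation (scaled
      n))\<^sup>2" for n
    unfolding centered_eq
    by (rule variance_eq) (rule integrable_scaled integrable_scaled)+
  moreover have "N.variance (\<lambda>x. x) = (\<integral>x. x\<^sup>2 \<partial>N) - (\<integral>x. x \<partial>N)\<^sup>2"
    by (rule N.variance_eq[OF int1 scaled_moment_limits(1)])
  ultimately show ?thesis
    by (simp only:) (intro tendsto_diff tendsto_power scaled_moment_limits)
qed

lemma centered_exp_moment: "\<exists>a>0. \<exists>C. \<forall>n. expectation (\<lambda>s. exp (a * \<bar>centered n s\<bar>)) \<le> C"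
proof -
  obtain a C where a: "0 < a" and C: "\<And>n. expectation (\<lambda>s. exp (a * \<bar>scaled n s\<bar>)) \<le> C"
    using scaled_exp_moment by blast
  have C0: "0 \<le> C" by (rule order_trans[OF _ C[of 0]]) simp
  have mean: "\<bar>expectation (scaled n)\<bar> \<le> C / a" for n
  proof -
    have "\<bar>expectation (scaled n)\<bar> \<le> expectation (\<lambda>s. \<bar>scaled n s\<bar> ^ 1)"
      using integral_abs_bound[of M "scaled n"] by simp
    also have "\<dots> \<le> fact 1 / a ^ 1 * C" by (rule abs_moment_le[OF _ a integrable_scaled C]) simp
    finally show ?thesis by simp
  qed
  have "expectation (\<lambda>s. exp (a * \<bar>centered n s\<bar>)) \<le> exp C * C" for n
  proof -
    have "expectation (\<lambda>s. exp (a * \<bar>centered n s\<bar>)) \<le> expectation (\<lambda>s. exp C * exp (a * \<bar>scaled n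
        s\<bar>))"
    proof (rule integral_mono)
      fix s
      have "\<bar>centered n s\<bar> \<le> \<bar>scaled n s\<bar> + C / a" unfolding centered_eq using mean[of n] by
          linarith
      then have "a * \<bar>centered n s\<bar> \<le> a * (\<bar>scaled n s\<bar> + C / a)" using a by (intro
          mult_left_mono) auto
      also have "\<dots> = C + a * \<bar>scaled n s\<bar>" using a by (simp add: field_simps)
      finally show "exp (a * \<bar>centered n s\<bar>) \<le> exp C * exp (a * \<bar>scaled n s\<bar>)"
        by (simp add: exp_add[symmetric])
    qed (rule integrable_centered integrable_scaled)+
    also have "\<dots> = exp C * expectation (\<lambda>s. exp (a * \<bar>scaled n s\<bar>))" by simp
    also have "\<dots> \<le> exp C * C" by (intro mult_left_mono C) simp
    finally show ?thesis .
  qed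
  with a show ?thesis by blast
qed

section \<open>Characteristic functions of the centered walk\<close>

abbreviation chi :: "nat \<Rightarrow> real \<Rightarrow> complex" where
  "chi n \<equiv> char (distr M borel (centered n))"

abbreviation chi_limit :: "real \<Rightarrow> complex" where
  "chi_limit \<equiv> char (distr N borel (\<lambda>x. x - (\<integral>x. x \<partial>N)))"

lemma chi_eq: "chi n u = expectation (\<lambda>s. iexp (u * centered n s))"
  by (simp add: char_def integral_distr)

lemma chi_le_1: "norm (chi n u) \<le> 1"
  by (rule real_distribution.cmod_char_le_1) (simp add: real_distribution_distr)

text \<open>Uniformity in \<open>n\<close> is essential, as increments of all lengths, short ones
  included, occur in the same row. The centering removes the linear term of the expansion.\<close>

lemma centered_bounds:
  "\<exists>C. (\<forall>n. 0 \<le> expectation (\<lambda>s. (centered n s)\<^sup>2) \<and> expectation (\<lambda>s. (centered n s)\<^sup>2) \<le> C) \<and>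
    (\<forall>n. expectation (\<lambda>s. \<bar>centered n s\<bar>) \<le> C) \<and>
    (\<forall>n u. norm (chi n u - (1 - u\<^sup>2 * expectation (\<lambda>s. (centered n s)\<^sup>2) / 2)) \<le> C * \<bar>u\<bar> ^ 3)"
proof -
  obtain a C where a: "0 < a" and C: "\<And>n. expectation (\<lambda>s. exp (a * \<bar>centered n s\<bar>)) \<le> C"
    using centered_exp_moment by blast
  have bound: "expectation (\<lambda>s. \<bar>centered n s\<bar> ^ k) \<le> fact k / a ^ k * C" for n k
    by (rule abs_moment_le[OF _ a integrable_centered C]) simp
  define D where "D = max (fact 1 / a ^ 1 * C) (max (fact 2 / a ^ 2 * C) (fact 3 / a ^ 3 * C))"
  show ?thesis
  proof (intro exI[of _ D] conjI allI)
    fix n u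
    show "0 \<le> expectation (\<lambda>s. (centered n s)\<^sup>2)" by simp
    show "expectation (\<lambda>s. (centered n s)\<^sup>2) \<le> D" using bound[of n 2] by (simp add: D_def)
    show "expectation (\<lambda>s. \<bar>centered n s\<bar>) \<le> D" using bound[of n 1] by (simp add: D_def)
    have "norm (chi n u - (1 - u\<^sup>2 * expectation (\<lambda>s. (centered n s)\<^sup>2) / 2)) \<le>
        u\<^sup>2 / 6 * expectation (\<lambda>s. min (6 * (centered n s)\<^sup>2) (\<bar>u\<bar> * \<bar>centered n s\<bar> ^ 3))"
      by (rule char_approx3')
         (use integrable_centered integrable_centered expectation_centered
           in \<open>auto simp: expectation_centered\<close>)
    also have "\<dots> \<le> u\<^sup>2 / 6 * expectation (\<lambda>s. \<bar>u\<bar> * \<bar>centered n s\<bar> ^ 3)"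
      by (intro mult_left_mono integral_mono integrable_centered
          integrable_centered) auto
    also have "\<dots> = \<bar>u\<bar> ^ 3 / 6 * expectation (\<lambda>s. \<bar>centered n s\<bar> ^ 3)"
    proof -
      have "\<bar>u\<bar> ^ 3 = u\<^sup>2 * \<bar>u\<bar>" by (simp add: power3_eq_cube power2_eq_square)
      then show ?thesis by simp
    qed
    also have "\<dots> \<le> \<bar>u\<bar> ^ 3 / 6 * D"
      using bound[of n 3] by (intro mult_left_mono) (auto simp: D_def)
    also have "\<dots> \<le> \<bar>u\<bar> ^ 3 * D"
    proof -
      have "0 \<le> expectation (\<lambda>s. \<bar>centered n s\<bar>)" by simp
      also have "\<dots> \<le> D" using bound[of n 1] by (simp add: D_def)
      finally have "0 \<le> D" .
      then have "0 \<le> \<bar>u\<bar> ^ 3 * D" by (intro mult_nonneg_nonneg) auto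
      moreover have "\<bar>u\<bar> ^ 3 / 6 * D = (\<bar>u\<bar> ^ 3 * D) / 6" by simp
      ultimately show ?thesis by linarith
    qed
    finally show "norm (chi n u - (1 - u\<^sup>2 * expectation (\<lambda>s. (centered n s)\<^sup>2) / 2)) \<le> D * \<bar>u\<bar> ^ 3"
      by (simp add: mult.commute)
  qed
qed

lemma chi_pointwise_limit: "(\<lambda>n. chi n u) \<longlonglongrightarrow> chi_limit u"
proof -
  interpret N: real_distribution N by (rule real_distribution_N)
  have "(\<lambda>n. iexp (- u * expectation (scaled n)) * char (distr M borel (scaled n)) u)
      \<longlonglongrightarrow> iexp (- u * (\<integral>x. x \<partial>N)) * char N u"
    by (intro tendsto_intros scaled_moment_limits
         levy_continuity1[OF real_distribution_scaled real_distribution_N conv_scaled])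
  moreover have "iexp (- u * expectation (scaled n)) * char (distr M borel (scaled n)) u = chi n
      u" for n
    unfolding chi_eq by (simp add: char_def integral_distr centered_eq ring_distribs exp_diff
        exp_minus field_simps)
  moreover have "iexp (- u * (\<integral>x. x \<partial>N)) * char N u = chi_limit u"
    by (simp add: char_def integral_distr ring_distribs exp_diff exp_minus field_simps)
  ultimately show ?thesis by simp
qed

text \<open>Bounded first absolute moments make the functions \<open>chi n\<close> equally
  Lipschitz, which upgrades the pointwise limit to one along moving arguments.\<close>

lemma chi_limit:
  assumes S: "filterlim S at_top sequentially" and u: "u \<longlonglongrightarrow> u'"
  shows "(\<lambda>j. chi (S j) (u j)) \<longlonglongrightarrow> chi_limit u'"
proof -
  obtain C where C: "\<And>n. expectation (\<lambda>s. \<bar>centered n s\<bar>) \<le> C"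
    using centered_bounds by blast
  have lip: "norm (chi n x - chi n y) \<le> C * \<bar>x - y\<bar>" for n x y
  proof -
    have "chi n x - chi n y = expectation (\<lambda>s. iexp (x * centered n s) - iexp (y * centered n s))"
      unfolding chi_eq
      by (rule Bochner_Integration.integral_diff[symmetric])
         (rule integrable_centered)+
    also have "norm \<dots> \<le> expectation (\<lambda>s. norm (iexp (x * centered n s) - iexp (y * centered n s)))"
      by (rule integral_norm_bound)
    also have "\<dots> \<le> expectation (\<lambda>s. \<bar>x - y\<bar> * \<bar>centered n s\<bar>)"
    proof (rule integral_mono)
      fix s
      define z where "z = centered n s"
      have "iexp (x * z) - iexp (y * z) = iexp (y * z) * (iexp ((x - y) * z) - 1)"
        by (simp add: algebra_simps exp_add[symmetric])
      then have "norm (iexp (x * z) - iexp (y * z)) = norm (iexp ((x - y) * z) - 1)"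
        by (simp add: norm_mult)
      also have "\<dots> \<le> \<bar>(x - y) * z\<bar>" using iexp_approx1[of "(x - y) * z" 0] by simp
      finally show "norm (iexp (x * centered n s) - iexp (y * centered n s)) \<le> \<bar>x - y\<bar> * \<bar>centered
          n s\<bar>"
        by (simp add: z_def abs_mult)
    qed (rule integrable_centered
          integrable_centered)+
    also have "\<dots> = \<bar>x - y\<bar> * expectation (\<lambda>s. \<bar>centered n s\<bar>)" by simp
    also have "\<dots> \<le> \<bar>x - y\<bar> * C" by (intro mult_left_mono C) simp
    finally show ?thesis by (simp add: mult.commute)
  qed
  have "(\<lambda>j. chi (S j) (u j) - chi (S j) u') \<longlonglongrightarrow> 0"
  proof (rule Lim_null_comparison)
    show "\<forall>\<^sub>F j in sequentially. norm (chi (S j) (u j) - chi (S j) u') \<le> C * \<bar>u j - u'\<bar>"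
      using lip by simp
    have "(\<lambda>j. C * \<bar>u j - u'\<bar>) \<longlonglongrightarrow> C * \<bar>u' - u'\<bar>" by (intro tendsto_intros u)
    then show "(\<lambda>j. C * \<bar>u j - u'\<bar>) \<longlonglongrightarrow> 0" by simp
  qed
  moreover have "(\<lambda>j. chi (S j) u') \<longlonglongrightarrow> chi_limit u'"
    by (rule filterlim_compose[OF chi_pointwise_limit S])
  ultimately show ?thesis using tendsto_add by fastforce
qed

text \<open>With mean zero the bound starts at second order. A product over increments is then
  controlled by the sum of squared weights, independently of the number of increments.\<close>

lemma centered_subgaussian:
  "\<exists>a>0. \<exists>C. \<forall>n x. \<bar>x\<bar> \<le> a \<longrightarrow> expectation (\<lambda>s. exp (x * centered n s)) \<le> exp (C * x\<^sup>2)"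
proof -
  obtain a C where a: "0 < a" and C: "\<And>n. expectation (\<lambda>s. exp (a * \<bar>centered n s\<bar>)) \<le> C"
    using centered_exp_moment by blast
  have "expectation (\<lambda>s. exp (x * centered n s)) \<le> exp (8 / a\<^sup>2 * C * x\<^sup>2)" if x: "\<bar>x\<bar> \<le> a / 2" for
      n x
  proof -
    have i: "integrable M (\<lambda>s. 1 + x * centered n s)" "integrable M (\<lambda>s. x\<^sup>2 * (8 / a\<^sup>2 * exp (a *
        \<bar>centered n s\<bar>)))"
      by (rule integrable_centered
          integrable_centered)+
    have "expectation (\<lambda>s. exp (x * centered n s)) \<le>
        expectation (\<lambda>s. 1 + x * centered n s + x\<^sup>2 * (8 / a\<^sup>2 * exp (a * \<bar>centered n s\<bar>)))"
      by (rule integral_mono[OF integrable_centered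
            Bochner_Integration.integrable_add[OF i] exp_le_quadratic[OF a x]])
    also have "\<dots> = 1 + x\<^sup>2 * (8 / a\<^sup>2 * expectation (\<lambda>s. exp (a * \<bar>centered n s\<bar>)))"
      unfolding Bochner_Integration.integral_add[OF i]
      using integrable_centered[of "\<lambda>y. y" n] expectation_centered[of n] by (simp add: prob_space)
    also have "\<dots> \<le> 1 + x\<^sup>2 * (8 / a\<^sup>2 * C)"
      by (intro add_left_mono mult_left_mono C) auto
    also have "\<dots> \<le> exp (8 / a\<^sup>2 * C * x\<^sup>2)"
      using exp_ge_add_one_self[of "8 / a\<^sup>2 * C * x\<^sup>2"] by (simp add: mult_ac)
    finally show ?thesis .
  qed
  then show ?thesis
    using a by (intro exI[of _ "a / 2"] conjI exI[of _ "8 / a\<^sup>2 * C"] allI impI) simp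
qed

end

section \<open>The walk in cooling random environment\<close>

text \<open>With finite support, ranks below \<open>m\<close> enumerate the support and all later
  entries are zero. This moves sums and products over increments to ranks.\<close>

lemma decr_reordering_enumeration:
  fixes x :: "nat \<Rightarrow> real"
  assumes "\<And>k. 0 \<le> x k" "finite {k. x k \<noteq> 0}"
  shows "antimono (decr_reordering x)" "0 \<le> decr_reordering x i"
    "\<exists>f m. bij_betw f {..<m} {k. x k \<noteq> 0} \<and> (\<forall>i<m. x (f i) = decr_reordering x i) \<and>
      (\<forall>i\<ge>m. decr_reordering x i = 0)"
proof -
  have re: "is_decr_reordering x (decr_reordering x)"
    unfolding decr_reordering_def by (rule theI'[OF decr_reordering_ex1[OF assms]])
  then show anti: "antimono (decr_reordering x)" and nn: "0 \<le> decr_reordering x i" for i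
    unfolding is_decr_reordering_def by auto
  define m where "m = card {k. 0 < x k}"
  have "{k. decr_reordering x k \<noteq> 0} = {k. 0 < decr_reordering x k}"
    using nn by (auto simp: less_le)
  also have "\<dots> = {..<m}"
    unfolding m_def by (rule superlevel_set_eq[OF assms(2) re]) simp
  finally have supp: "{k. decr_reordering x k \<noteq> 0} = {..<m}" .
  have supp_iff: "decr_reordering x k \<noteq> 0 \<longleftrightarrow> k < m" for k
    using eqset_imp_iff[OF supp, of k] by simp
  from re obtain f where f: "bij_betw f {k. decr_reordering x k \<noteq> 0} {k. x k \<noteq> 0}"
    "\<And>k. decr_reordering x k \<noteq> 0 \<Longrightarrow> x (f k) = decr_reordering x k"
    unfolding is_decr_reordering_def by blast
  show "\<exists>f m. bij_betw f {..<m} {k. x k \<noteq> 0} \<and> (\<forall>i<m. x (f i) = decr_reordering x i) \<and>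
      (\<forall>i\<ge>m. decr_reordering x i = 0)"
  proof (intro exI[of _ f] exI[of _ m] conjI allI impI)
    show "bij_betw f {..<m} {k. x k \<noteq> 0}" using f(1) by (simp only: supp)
    show "x (f i) = decr_reordering x i" if "i < m" for i by (rule f(2)) (simp only: supp_iff that)
    show "decr_reordering x i = 0" if "m \<le> i" for i using supp_iff[of i] that by simp
  qed
qed

text \<open>Uniform integrability concerns all \<open>j\<close>, but the moment bound holds only
  eventually. Each of the finitely many exceptional functions is bounded, so a level
  \<open>K\<close> above their bounds makes their tails vanish.\<close>

lemma uniformly_integrableI_bounded_square:
  fixes f :: "nat \<Rightarrow> 's \<Rightarrow> real"
  assumes "prob_space M" and meas [measurable]: "\<And>j. f j \<in> borel_measurable M"
    and bdd: "\<And>j. \<exists>B. AE s in M. \<bar>f j s\<bar> \<le> B"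
    and sq: "\<forall>\<^sub>F j in sequentially. (\<integral>s. (f j s)\<^sup>2 \<partial>M) \<le> D"
  shows "uniformly_integrable M f"
proof -
  interpret prob_space M by fact
  obtain B where B: "\<And>j. AE s in M. \<bar>f j s\<bar> \<le> B j" using bdd by metis
  have int: "integrable M (f j)" for j
    by (rule integrable_const_bound[of "f j" "B j"]) (use B[of j] in auto)
  have int2: "integrable M (\<lambda>s. (f j s)\<^sup>2)" for j
  proof (rule integrable_const_bound[where B = "(B j)\<^sup>2"])
    show "AE s in M. norm ((f j s)\<^sup>2) \<le> (B j)\<^sup>2"
      using B[of j]
    proof eventually_elim
      case (elim s)
      then have "\<bar>f j s\<bar> ^ 2 \<le> (B j) ^ 2" by (intro power_mono) auto
      then show ?case by simp
    qed
  qed measurable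
  obtain j0 where j0: "\<And>j. j \<ge> j0 \<Longrightarrow> (\<integral>s. (f j s)\<^sup>2 \<partial>M) \<le> D"
    using sq unfolding eventually_sequentially by blast
  show ?thesis
    unfolding uniformly_integrable_def
  proof (intro conjI allI impI int)
    fix \<epsilon> :: real assume \<epsilon>: "0 < \<epsilon>"
    define K where "K = Max (insert (\<bar>D\<bar> / \<epsilon> + 1) (B ` {..<j0}))"
    have K1: "\<bar>D\<bar> / \<epsilon> + 1 \<le> K" unfolding K_def by (intro Max_ge) auto
    have "0 \<le> \<bar>D\<bar> / \<epsilon>" using \<epsilon> by simp
    then have K: "0 < K" using K1 by linarith
    have small: "(\<integral>s. \<bar>f j s\<bar> * indicator {s. K < \<bar>f j s\<bar>} s \<partial>M) < \<epsilon>" for j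
    proof (cases "j < j0")
      case True
      then have "B j \<le> K" unfolding K_def by (intro Max_ge) auto
      have "(\<integral>s. \<bar>f j s\<bar> * indicator {s. K < \<bar>f j s\<bar>} s \<partial>M) = (\<integral>s. 0 \<partial>M)"
      proof (rule integral_cong_AE)
        show "AE s in M. \<bar>f j s\<bar> * indicator {s. K < \<bar>f j s\<bar>} s = 0"
          using B[of j] by eventually_elim (use \<open>B j \<le> K\<close> in \<open>auto simp: indicator_def\<close>)
      qed (auto simp: indicator_def)
      then show ?thesis using \<epsilon> by simp
    next
      case False
      have "(\<integral>s. \<bar>f j s\<bar> * indicator {s. K < \<bar>f j s\<bar>} s \<partial>M) \<le> (\<integral>s. (f j s)\<^sup>2 / K \<partial>M)"
      proof (rule integral_mono)
        show "integrable M (\<lambda>s. \<bar>f j s\<bar> * indicator {s. K < \<bar>f j s\<bar>} s)"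
          by (rule Bochner_Integration.integrable_bound[OF int[of j]]) (auto simp: indicator_def)
        fix s
        show "\<bar>f j s\<bar> * indicator {s. K < \<bar>f j s\<bar>} s \<le> (f j s)\<^sup>2 / K"
        proof (cases "K < \<bar>f j s\<bar>")
          case True
          then have "K * \<bar>f j s\<bar> \<le> \<bar>f j s\<bar> * \<bar>f j s\<bar>" by (intro mult_right_mono) auto
          then show ?thesis using True K by (simp add: field_simps power2_eq_square)
        qed (use K in simp)
      qed (use int2 in auto)
      also have "\<dots> = (\<integral>s. (f j s)\<^sup>2 \<partial>M) / K" by simp
      also have "\<dots> \<le> D / K" using False K j0[of j] by (intro divide_right_mono) auto
      also have "\<dots> < \<epsilon>"
      proof -
        have "\<epsilon> * (\<bar>D\<bar> / \<epsilon> + 1) \<le> \<epsilon> * K" using K1 \<epsilon> by (intro mult_left_mono) auto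
        moreover have "\<epsilon> * (\<bar>D\<bar> / \<epsilon> + 1) = \<bar>D\<bar> + \<epsilon>" using \<epsilon> by (simp add: distrib_left)
        ultimately have "D < \<epsilon> * K" using \<epsilon> by linarith
        then show ?thesis using K by (simp add: divide_less_eq)
      qed
      finally show ?thesis .
    qed
    then show "\<exists>K. \<forall>j. (\<integral>s. \<bar>f j s\<bar> * indicator {s. K < \<bar>f j s\<bar>} s \<partial>M) < \<epsilon>" by blast
  qed
qed

lemma powr_le_exp:
  fixes y q a :: real
  assumes "0 \<le> y" "0 \<le> q" "q \<le> real m" "0 < a"
  shows "y powr q \<le> (1 + fact m / a ^ m) * exp (a * y)"
proof -
  have "y powr q \<le> 1 + y ^ m"
  proof (cases "y \<le> 1")
    case True
    then have "y powr q \<le> 1 powr q" using assms by (intro powr_mono2) auto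
    moreover have "0 \<le> y ^ m" using assms by simp
    ultimately show ?thesis by (simp add: add_increasing2)
  next
    case False
    then have "y powr q \<le> y powr real m" using assms by (intro powr_mono) auto
    also have "\<dots> = y ^ m" using False by (simp add: powr_realpow)
    finally show ?thesis by simp
  qed
  also have "y ^ m \<le> fact m / a ^ m * exp (a * y)"
    using assms by (intro power_le_exp)
  also have "1 + fact m / a ^ m * exp (a * y) \<le> (1 + fact m / a ^ m) * exp (a * y)"
    using assms by (simp add: distrib_right)
  finally show ?thesis by simp
qed

section \<open>Normalized weights and the reduction to products\<close>

locale cooling_limit =
  cooling_walk \<alpha> T M \<omega> X ME \<eta> Z + E: regular_walk_limit \<alpha> ME \<eta> Z \<kappa> b N
  for \<alpha> T M \<omega> X ME \<eta> Z \<kappa> b N +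
  assumes var_ratio: "(\<lambda>n. prob_space.variance M (\<lambda>s. real_of_int (X n s)) / sum_sq \<kappa> T n)
         \<longlonglongrightarrow> prob_space.variance N (\<lambda>x. x)"
begin

abbreviation ix :: "nat \<Rightarrow> nat" where "ix n \<equiv> cooling_index T n"
abbreviation Tn :: "nat \<Rightarrow> nat \<Rightarrow> nat" where "Tn n k \<equiv> truncated_increment T n k"
abbreviation w :: "nat \<Rightarrow> nat \<Rightarrow> real" where "w n k \<equiv> weights \<kappa> T n k"
abbreviation V :: "nat \<Rightarrow> real" where "V n \<equiv> sqrt (sum_sq \<kappa> T n)"
abbreviation meanX :: "nat \<Rightarrow> real" where "meanX n \<equiv> W.expectation (\<lambda>s. real_of_int (X n s))"
abbreviation varX :: "nat \<Rightarrow> real" where "varX n \<equiv> W.variance (\<lambda>s. real_of_int (X n s))"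
abbreviation stdX :: "nat \<Rightarrow> 'a \<Rightarrow> real"
  where "stdX n \<equiv> standardized M (\<lambda>s. real_of_int (X n s))"
abbreviation v :: "nat \<Rightarrow> real" where "v n \<equiv> E.expectation (\<lambda>s. (E.centered n s)\<^sup>2)"

lemma sum_truncated_increment: "(\<Sum>k\<le>ix n. Tn n k) = n"
proof -
  have "(\<Sum>k<ix n. Tn n k) = cooling_map T (ix n)"
    by (simp add: cooling_map_def truncated_increment_simps)
  then show ?thesis
    using cooling_index_bounds(1)[OF cooling, of n]
    by (simp add: lessThan_Suc_atMost[symmetric] truncated_increment_simps(2))
qed

lemma sum_sq_eq: "sum_sq \<kappa> T n = (\<Sum>k\<le>ix n. real (Tn n k) powr (2 * \<kappa>))"
  unfolding sum_sq_def by (rule suminf_finite) (auto simp: truncated_increment_simps)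

text \<open>Ensures that \<open>V n\<close> tends to infinity even when all increments stay bounded.
  The truncated increments sum to \<open>n\<close> and are at most \<open>n\<close>, and a power p
  \<le> 1 of such an increment is at least the increment times n^(p - 1).\<close>

lemma sum_sq_ge: "real n powr min 1 (2 * \<kappa>) \<le> sum_sq \<kappa> T n"
proof (cases "n = 0")
  case True
  then show ?thesis by (simp add: sum_sq_eq sum_nonneg)
next
  case False
  define p where "p = min 1 (2 * \<kappa>)"
  have p: "0 < p" "p \<le> 1" "p \<le> 2 * \<kappa>" using E.kappa by (auto simp: p_def)
  have "real n powr p = real n * real n powr (p - 1)"
    using False by (simp add: powr_diff)
  also have "\<dots> = (\<Sum>k\<le>ix n. real (Tn n k) * real n powr (p - 1))"
    by (subst sum_truncated_increment[of n, symmetric]) (simp add: sum_distrib_right)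
  also have "\<dots> \<le> (\<Sum>k\<le>ix n. real (Tn n k) powr (2 * \<kappa>))"
  proof (rule sum_mono)
    fix k assume k: "k \<in> {..ix n}"
    show "real (Tn n k) * real n powr (p - 1) \<le> real (Tn n k) powr (2 * \<kappa>)"
    proof (cases "Tn n k = 0")
      case ne: False
      have "Tn n k \<le> (\<Sum>k\<le>ix n. Tn n k)" using k by (intro member_le_sum) auto
      then have "Tn n k \<le> n" by (simp only: sum_truncated_increment)
      then have "real n powr (p - 1) \<le> real (Tn n k) powr (p - 1)"
        using ne p by (intro powr_mono2') auto
      then have "real (Tn n k) * real n powr (p - 1) \<le> real (Tn n k) * real (Tn n k) powr (p - 1)"
        by (intro mult_left_mono) auto
      also have "\<dots> = real (Tn n k) powr p" using ne by (simp add: powr_diff)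
      also have "\<dots> \<le> real (Tn n k) powr (2 * \<kappa>)" using ne p by (intro powr_mono) auto
      finally show ?thesis .
    qed simp
  qed
  finally show ?thesis by (simp add: p_def sum_sq_eq)
qed

lemma sum_sq_pos: "1 \<le> n \<Longrightarrow> 0 < sum_sq \<kappa> T n"
  by (rule less_le_trans[OF _ sum_sq_ge]) simp

lemma V_at_top: "filterlim V at_top sequentially"
proof -
  have "filterlim (\<lambda>n. real n powr min 1 (2 * \<kappa>)) at_top sequentially"
  proof -
    have "0 < min 1 (2 * \<kappa>)" using E.kappa by simp
    then show ?thesis by real_asymp
  qed
  then have "filterlim (sum_sq \<kappa> T) at_top sequentially"
    by (rule filterlim_at_top_mono) (use sum_sq_ge in auto)
  then show ?thesis by (rule filterlim_compose[OF sqrt_at_top])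
qed

lemma weights_nonneg: "0 \<le> w n k"
  by (simp add: weights_def sum_sq_eq sum_nonneg)

lemma weights_support: "{k. w n k \<noteq> 0} \<subseteq> {..ix n}"
  by (auto simp: weights_def truncated_increment_def split: if_splits)

lemma finite_support: "finite {k. w n k \<noteq> 0}"
  by (rule finite_subset[OF weights_support]) simp

lemma powr_square: "(real m powr \<kappa>)\<^sup>2 = real m powr (2 * \<kappa>)"
  by (simp add: power2_eq_square powr_add[symmetric])

lemma sum_weights_sq:
  assumes "1 \<le> n"
  shows "(\<Sum>k\<le>ix n. (w n k)\<^sup>2) = 1"
proof -
  have "(\<Sum>k\<le>ix n. (w n k)\<^sup>2) = (\<Sum>k\<le>ix n. real (Tn n k) powr (2 * \<kappa>)) / sum_sq \<kappa> T n"
    using sum_sq_pos[OF assms] by (simp add: weights_def power_divide powr_square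
        sum_divide_distrib)
  then show ?thesis using sum_sq_pos[OF assms] by (simp add: sum_sq_eq)
qed

text \<open>The final increment may be empty, which happens when \<open>n\<close> is a cooling time.
  Its weight is then 0 and \<open>Z\<close> is at 0 almost surely, so its factor is the mean of
  \<open>h 0\<close> on both sides.\<close>

lemma integral_normalized:
  fixes h :: "real \<Rightarrow> 'z::{real_normed_field, banach, second_countable_topology}"
  assumes h: "\<And>x y. h (x + y) = h x * h y" "h 0 = 1"
  shows "(\<integral>s. h ((real_of_int (X n s) - meanX n) / V n) \<partial>M) =
    (\<Prod>k\<le>ix n. \<integral>u. h (w n k * E.centered (Tn n k) u) \<partial>ME)"
proof -
  define EZ where "EZ k = E.expectation (\<lambda>u. real_of_int (Z k u))" for k
  have hsum: "h (\<Sum>k\<in>A. f k) = (\<Prod>k\<in>A. h (f k))" if "finite A" for A :: "nat set" and f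
    using that by (induction A rule: finite_induct) (auto simp: h)
  have "(\<integral>s. h ((real_of_int (X n s) - meanX n) / V n) \<partial>M) =
      (\<integral>s. h (- meanX n / V n) * h (real_of_int (X n s) / V n) \<partial>M)"
    by (intro Bochner_Integration.integral_cong refl) (simp add: h(1)[symmetric]
        diff_divide_distrib)
  also have "\<dots> = h (- meanX n / V n) * (\<integral>s. h (real_of_int (X n s) / V n) \<partial>M)"
    by simp
  also have "(\<integral>s. h (real_of_int (X n s) / V n) \<partial>M) =
      (\<Prod>k\<le>ix n. \<integral>u. h (real_of_int (Z (Tn n k) u) / V n) \<partial>ME)"
    by (rule integral_multiplicative[where g = "\<lambda>x. h (real_of_int x / V n)"])
       (simp_all add: h add_divide_distrib)
  also have "- meanX n / V n = (\<Sum>k\<le>ix n. - EZ (Tn n k) / V n)"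
    unfolding expectation_additive EZ_def by (simp add: sum_divide_distrib sum_negf)
  also have "h (\<Sum>k\<le>ix n. - EZ (Tn n k) / V n) * (\<Prod>k\<le>ix n. \<integral>u. h (real_of_int (Z (Tn n k) u) / V n)
      \<partial>ME)
     = (\<Prod>k\<le>ix n. \<integral>u. h (- EZ (Tn n k) / V n) * h (real_of_int (Z (Tn n k) u) / V n) \<partial>ME)"
    by (simp add: hsum prod.distrib)
  also have "\<dots> = (\<Prod>k\<le>ix n. \<integral>u. h (w n k * E.centered (Tn n k) u) \<partial>ME)"
  proof (intro prod.cong refl)
    fix k
    have "(\<integral>u. h (- EZ (Tn n k) / V n) * h (real_of_int (Z (Tn n k) u) / V n) \<partial>ME) =
      (\<integral>u. h ((real_of_int (Z (Tn n k) u) - EZ (Tn n k)) / V n) \<partial>ME)"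
      by (intro Bochner_Integration.integral_cong refl) (simp add: h(1)[symmetric]
          diff_divide_distrib)
    also have "\<dots> = (\<integral>u. h (w n k * E.centered (Tn n k) u) \<partial>ME)"
    proof (cases "Tn n k = 0")
      case True
      have Z0: "AE u in ME. Z 0 u = 0" using E.AE_nearest_neighbour by eventually_elim blast
      then have "EZ 0 = E.expectation (\<lambda>u. 0)"
        unfolding EZ_def by (intro integral_cong_AE) (auto elim!: eventually_mono)
      then have EZ0: "EZ 0 = 0" by simp
      have "(\<integral>u. h ((real_of_int (Z 0 u) - EZ 0) / V n) \<partial>ME) = (\<integral>u. h 0 \<partial>ME)"
      proof (rule integral_cong_AE)
        show "AE u in ME. h ((real_of_int (Z 0 u) - EZ 0) / V n) = h 0"
          using Z0 by eventually_elim (simp add: EZ0)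
        show "(\<lambda>u. h ((real_of_int (Z 0 u) - EZ 0) / V n)) \<in> borel_measurable ME"
          by (rule borel_measurable_integrable)
             (rule E.integrable_walk)
      qed simp
      then show ?thesis using True by (simp add: weights_def)
    next
      case False
      then have "w n k * E.centered (Tn n k) u = (real_of_int (Z (Tn n k) u) - EZ (Tn n k)) / V n"
          for u
        by (simp add: weights_def E.centered_def EZ_def)
      then show ?thesis by simp
    qed
    finally show "(\<integral>u. h (- EZ (Tn n k) / V n) * h (real_of_int (Z (Tn n k) u) / V n) \<partial>ME) =
      (\<integral>u. h (w n k * E.centered (Tn n k) u) \<partial>ME)" .
  qed
  finally show ?thesis .
qed

text \<open>Reads the variance hypothesis as convergence of an average of the normalized variances
  \<open>v\<close>, taken with the squared weights, which have total mass 1.\<close>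

lemma variance_ratio_eq:
  assumes "1 \<le> n"
  shows "varX n / sum_sq \<kappa> T n = (\<Sum>k\<le>ix n. v (Tn n k) * (w n k)\<^sup>2)"
  unfolding variance_additive sum_divide_distrib
proof (intro sum.cong refl)
  fix k
  show "E.variance (\<lambda>u. real_of_int (Z (Tn n k) u)) / sum_sq \<kappa> T n = v (Tn n k) * (w n k)\<^sup>2"
  proof (cases "Tn n k = 0")
    case True
    have Z0: "AE u in ME. Z 0 u = 0" using E.AE_nearest_neighbour by eventually_elim blast
    then have EZ0: "E.expectation (\<lambda>u. real_of_int (Z 0 u)) = E.expectation (\<lambda>u. 0)"
      by (intro integral_cong_AE) (auto elim!: eventually_mono)
    have "E.variance (\<lambda>u. real_of_int (Z 0 u)) = E.expectation (\<lambda>u. 0)"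
      unfolding EZ0 using Z0 by (intro integral_cong_AE) (auto elim!: eventually_mono)
    then show ?thesis using True by (simp add: weights_def)
  next
    case False
    then have "v (Tn n k) = E.variance (\<lambda>u. real_of_int (Z (Tn n k) u)) / real (Tn n k) powr (2 *
        \<kappa>)"
      by (simp add: E.centered_def power_divide powr_square)
    then show ?thesis using False sum_sq_pos[OF assms] by (simp add: weights_def power_divide
        powr_square)
  qed
qed

text \<open>Conversion between \<open>V n\<close>, the natural normalization for the weights, and
  the standard deviation of the walk.\<close>

definition ratio :: "nat \<Rightarrow> real" where "ratio n = V n / sqrt (varX n)"

lemma ratio_limit: "ratio \<longlonglongrightarrow> 1 / sqrt (prob_space.variance N (\<lambda>x. x))"
proof -
  have "(\<lambda>n. 1 / sqrt (varX n / sum_sq \<kappa> T n)) \<longlonglongrightarrow> 1 / sqrt (prob_space.variance N (\<lambda>x. x))"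
    using E.variance_N_pos by (intro tendsto_intros var_ratio) auto
  then show ?thesis by (simp add: ratio_def[abs_def] real_sqrt_divide)
qed

lemma standardized_eq:
  assumes "1 \<le> n"
  shows "stdX n s = ratio n * ((real_of_int (X n s) - meanX n) / V n)"
  using sum_sq_pos[OF assms] by (simp add: standardized_def ratio_def)

lemma standardized_measurable [measurable]:
  "stdX n \<in> borel_measurable M"
  unfolding standardized_def[abs_def] by measurable

lemma char_standardized:
  assumes "1 \<le> n"
  shows "char (distr M borel (stdX n)) t =
    (\<Prod>k\<le>ix n. E.chi (Tn n k) (t * ratio n * w n k))"
proof -
  have "char (distr M borel (stdX n)) t =
      (\<integral>s. iexp (t * stdX n s) \<partial>M)"
    by (simp add: char_def integral_distr)
  also have "\<dots> = (\<integral>s. iexp (t * ratio n * ((real_of_int (X n s) - meanX n) / V n)) \<partial>M)"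
    by (simp only: standardized_eq[OF assms] mult.assoc)
  also have "\<dots> = (\<Prod>k\<le>ix n. \<integral>u. iexp (t * ratio n * (w n k * E.centered (Tn n k) u)) \<partial>ME)"
    by (rule integral_normalized[where h = "\<lambda>x. iexp (t * ratio n * x)"])
       (simp_all add: exp_add[symmetric] distrib_left)
  finally show ?thesis by (simp add: E.chi_eq mult.assoc)
qed

text \<open>All weights are at most 1, so the bound for single increments is available for each
  factor, and the squared weights sum to 1, so the product of the bounds is again
  \<open>exp (C * x\<^sup>2)\<close> with the same constants.\<close>

lemma normalized_subgaussian:
  "\<exists>a>0. \<exists>C. \<forall>n\<ge>1. \<forall>x. \<bar>x\<bar> \<le> a \<longrightarrow>
    W.expectation (\<lambda>s. exp (x * ((real_of_int (X n s) - meanX n) / V n))) \<le> exp (C * x\<^sup>2)"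
proof -
  obtain a C where a: "0 < a"
    and C: "\<And>n x. \<bar>x\<bar> \<le> a \<Longrightarrow> E.expectation (\<lambda>s. exp (x * E.centered n s)) \<le> exp (C * x\<^sup>2)"
    using E.centered_subgaussian by blast
  have "W.expectation (\<lambda>s. exp (x * ((real_of_int (X n s) - meanX n) / V n))) \<le> exp (C * x\<^sup>2)"
    if n: "1 \<le> n" and x: "\<bar>x\<bar> \<le> a" for n x
  proof -
    have "W.expectation (\<lambda>s. exp (x * ((real_of_int (X n s) - meanX n) / V n))) =
        (\<Prod>k\<le>ix n. E.expectation (\<lambda>u. exp (x * (w n k * E.centered (Tn n k) u))))"
      by (rule integral_normalized[where h = "\<lambda>y. exp (x * y)"]) (simp_all add: exp_add
          distrib_left)
    also have "\<dots> \<le> (\<Prod>k\<le>ix n. exp (C * (x * w n k)\<^sup>2))"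
    proof (intro prod_mono conjI)
      fix k assume k: "k \<in> {..ix n}"
      have "(w n k)\<^sup>2 \<le> (\<Sum>k\<le>ix n. (w n k)\<^sup>2)" using k by (intro member_le_sum) auto
      then have "w n k \<le> 1" using sum_weights_sq[OF n] weights_nonneg[of n k] by (simp add:
          abs_square_le_1)
      then have "\<bar>x\<bar> * w n k \<le> a * 1" using x a weights_nonneg[of n k] by (intro mult_mono) auto
      then have "\<bar>x * w n k\<bar> \<le> a" using weights_nonneg[of n k] by (simp add: abs_mult)
      from C[OF this, of "Tn n k"]
      show "E.expectation (\<lambda>u. exp (x * (w n k * E.centered (Tn n k) u))) \<le> exp (C * (x * w n k)\<^sup>2)"
        by (simp add: mult.assoc)
    qed simp
    also have "\<dots> = exp (\<Sum>k\<le>ix n. C * (x * w n k)\<^sup>2)" by (simp add: exp_sum)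
    also have "(\<Sum>k\<le>ix n. C * (x * w n k)\<^sup>2) = C * x\<^sup>2 * (\<Sum>k\<le>ix n. (w n k)\<^sup>2)"
      by (simp add: sum_distrib_left power_mult_distrib mult.assoc)
    finally show ?thesis using sum_weights_sq[OF n] by simp
  qed
  with a show ?thesis by blast
qed

lemma uniformly_integrable_standardized:
  assumes r: "filterlim r at_top sequentially" and p: "0 < p"
  shows "uniformly_integrable M (\<lambda>j s. \<bar>stdX (r j) s\<bar> powr p)"
proof -
  obtain a C where a: "0 < a" and C: "\<And>n x. 1 \<le> n \<Longrightarrow> \<bar>x\<bar> \<le> a \<Longrightarrow>
      W.expectation (\<lambda>s. exp (x * ((real_of_int (X n s) - meanX n) / V n))) \<le> exp (C * x\<^sup>2)"
    using normalized_subgaussian by blast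
  \<comment> \<open>An upper bound for \<open>ratio\<close> along all but finitely many members of
    the subsequence; early times, where the variance might even vanish, are not covered by
    it.\<close>
  define R where "R = 1 / sqrt (prob_space.variance N (\<lambda>x. x)) + 1"
  have R: "0 < R" using E.variance_N_pos by (simp add: R_def add_pos_pos)
  have "(\<lambda>j. ratio (r j)) \<longlonglongrightarrow> 1 / sqrt (prob_space.variance N (\<lambda>x. x))"
    by (rule filterlim_compose[OF ratio_limit r])
  then have ev_R: "\<forall>\<^sub>F j in sequentially. ratio (r j) < R"
    by (rule order_tendstoD(2)) (simp add: R_def)
  have ev_1: "\<forall>\<^sub>F j in sequentially. 1 \<le> r j" using r by (simp add: filterlim_at_top)
  \<comment> \<open>The square of the power \<open>p\<close> is a power \<open>2 * p\<close>,
    dominated up to the constant \<open>c\<close> by the exponential at rate \<open>a / R\<close>.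
    That rate is matched to \<open>R\<close> so that the exponential moment of \<open>U\<close> at
    \<open>a\<close> suffices.\<close>
  obtain m where m: "2 * p \<le> real m" using real_arch_simple by blast
  define c where "c = 1 + fact m / (a / R) ^ m"
  have c: "0 \<le> c" using a R by (simp add: c_def add_nonneg_nonneg)
  show ?thesis
  proof (rule uniformly_integrableI_bounded_square[OF W.prob_space_axioms])
    fix j
    define g where "g z = \<bar>(real_of_int z - meanX (r j)) / sqrt (varX (r j))\<bar> powr p" for z
    show "\<exists>B. AE s in M. \<bar>\<bar>stdX (r j) s\<bar> powr p\<bar> \<le> B"
    proof (intro exI)
      show "AE s in M. \<bar>\<bar>stdX (r j) s\<bar> powr p\<bar>
          \<le> Max (g ` {- int (r j)..int (r j)})"
        using W.AE_walk_bound
      proof eventually_elim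
        case (elim s)
        then have "\<bar>X (r j) s\<bar> \<le> int (r j)" by blast
        then have "g (X (r j) s) \<le> Max (g ` {- int (r j)..int (r j)})"
          by (intro Max_ge imageI) auto
        then show ?case by (simp add: g_def standardized_def)
      qed
    qed
  next
    show "\<forall>\<^sub>F j in sequentially. (\<integral>s. (\<bar>stdX (r j) s\<bar> powr p)\<^sup>2 \<partial>M)
        \<le> c * (2 * exp (C * a\<^sup>2))"
      using ev_R ev_1
    proof eventually_elim
      case (elim j)
      define U where "U s = (real_of_int (X (r j) s) - meanX (r j)) / V (r j)" for s
      have int: "integrable M (\<lambda>s. c * (exp (a * U s) + exp (- a * U s)))"
        unfolding U_def by (rule W.integrable_walk)
      have int': "integrable M (\<lambda>s. exp (x * U s))" for x
        unfolding U_def by (rule W.integrable_walk)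
      have "(\<integral>s. (\<bar>stdX (r j) s\<bar> powr p)\<^sup>2 \<partial>M)
          \<le> (\<integral>s. c * (exp (a * U s) + exp (- a * U s)) \<partial>M)"
      proof (rule integral_mono[OF _ int])
        show "integrable M (\<lambda>s. (\<bar>stdX (r j) s\<bar> powr p)\<^sup>2)"
          unfolding standardized_def
          by (rule W.integrable_walk)
        fix s
        define y where "y = \<bar>stdX (r j) s\<bar>"
        have "y = ratio (r j) * \<bar>U s\<bar>"
          using elim(2) W.variance_positive[of "\<lambda>s. real_of_int (X (r j) s)"] sum_sq_pos[OF elim(2)]
          by (simp add: y_def standardized_eq U_def ratio_def abs_mult)
        also have "\<dots> \<le> R * \<bar>U s\<bar>" using elim(1) by (intro mult_right_mono) auto
        finally have yU: "a / R * y \<le> a * \<bar>U s\<bar>" using a R by (simp add: field_simps)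
        have "(y powr p)\<^sup>2 = y powr (2 * p)" by (simp add: power2_eq_square powr_add[symmetric])
        also have "\<dots> \<le> c * exp (a / R * y)"
          unfolding c_def using p m a R by (intro powr_le_exp) (auto simp: y_def)
        also have "\<dots> \<le> c * exp (a * \<bar>U s\<bar>)" using c yU by (intro mult_left_mono) auto
        also have "\<dots> \<le> c * (exp (a * U s) + exp (- a * U s))"
          using c by (intro mult_left_mono) (auto simp: abs_if)
        finally show "(\<bar>stdX (r j) s\<bar> powr p)\<^sup>2
            \<le> c * (exp (a * U s) + exp (- a * U s))" by (simp add: y_def)
      qed
      also have "\<dots> = c * (W.expectation (\<lambda>s. exp (a * U s)) + W.expectation (\<lambda>s. exp (- a * U s)))"
        using int'[of a] int'[of "- a"] by simp
      also have "\<dots> \<le> c * (2 * exp (C * a\<^sup>2))"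
        using C[OF elim(2), of a] C[OF elim(2), of "- a"] a c unfolding U_def
        by (intro mult_left_mono) auto
      finally show ?case .
    qed
  qed measurable
qed

text \<open>Rows are reordered by decreasing weight, so that \<open>array_char_limit\<close> applies
  rank by rank; its limit is the characteristic function of the sum of the series and the
  independent Gaussian.\<close>

theorem law_limit:
  assumes r: "filterlim r at_top sequentially" and l2: "summable (\<lambda>k. (lam k)\<^sup>2)"
    and lim: "\<And>k. (\<lambda>j. decr_reordering (weights \<kappa> T (r j)) k) \<longlonglongrightarrow> lam k"
    and Q: "prob_space Q" and Y_indep: "prob_space.indep_vars Q (\<lambda>_. borel) Y UNIV"
    and Y_law: "\<And>k. distr Q borel (Y k) = N"
    and Phi_law: "distributed Q lborel \<Phi> std_normal_density"
    and Phi_indep: "prob_space.indep_var Q borel (tensor_sum Q Y lam) borel \<Phi>"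
  shows "(\<Sum>k. (lam k)\<^sup>2) \<le> 1"
    and "converges_in_law M (\<lambda>j. stdX (r j))
      Q (\<lambda>q. tensor_sum Q Y lam q + gauss_coeff lam * \<Phi> q)"
proof -
  interpret Q: prob_space Q by fact
  interpret N: real_distribution N by (rule E.real_distribution_N)
  define \<sigma> where "\<sigma> = sqrt (N.variance (\<lambda>x. x))"
  have \<sigma>: "0 < \<sigma>" "\<sigma>\<^sup>2 = N.variance (\<lambda>x. x)" using E.variance_N_pos by (auto simp: \<sigma>_def)
  define y where "y j = decr_reordering (weights \<kappa> T (r j))" for j
  note enum = decr_reordering_enumeration[of "weights \<kappa> T (r _)", OF weights_nonneg
      finite_support, folded y_def]
  obtain f m where f: "\<And>j. bij_betw (f j) {..<m j} {k. w (r j) k \<noteq> 0}"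
    and yf: "\<And>j i. i < m j \<Longrightarrow> w (r j) (f j i) = y j i" and y_supp: "\<And>j i. m j \<le> i \<Longrightarrow> y j i = 0"
    using enum(3) by metis
  \<comment> \<open>Lengths listed in the order of decreasing weight. The default 0 beyond the
    support meets weight 0 only, where every factor is 1.\<close>
  define S where "S j i = (if i < m j then Tn (r j) (f j i) else 0)" for j i
  have reindex_prod: "(\<Prod>k\<le>ix (r j). F (Tn (r j) k) (w (r j) k)) = (\<Prod>i<m j. F (S j i) (y j i))"
    if "\<And>n. F n 0 = 1" for F :: "nat \<Rightarrow> real \<Rightarrow> complex" and j
  proof -
    have "(\<Prod>k\<le>ix (r j). F (Tn (r j) k) (w (r j) k)) = (\<Prod>k\<in>{k. w (r j) k \<noteq> 0}. F (Tn (r j) k) (w (r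
        j) k))"
      using weights_support[of "r j"] that by (intro prod.mono_neutral_right) auto
    also have "\<dots> = (\<Prod>i<m j. F (Tn (r j) (f j i)) (w (r j) (f j i)))"
      by (rule prod.reindex_bij_betw[OF f, symmetric])
    finally show ?thesis by (simp add: S_def yf)
  qed
  have reindex_sum: "(\<Sum>k\<le>ix (r j). F (Tn (r j) k) (w (r j) k)) = (\<Sum>i<m j. F (S j i) (y j i))"
    if "\<And>n. F n 0 = 0" for F :: "nat \<Rightarrow> real \<Rightarrow> real" and j
  proof -
    have "(\<Sum>k\<le>ix (r j). F (Tn (r j) k) (w (r j) k)) = (\<Sum>k\<in>{k. w (r j) k \<noteq> 0}. F (Tn (r j) k) (w (r
        j) k))"
      using weights_support[of "r j"] that by (intro sum.mono_neutral_right) auto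
    also have "\<dots> = (\<Sum>i<m j. F (Tn (r j) (f j i)) (w (r j) (f j i)))"
      by (rule sum.reindex_bij_betw[OF f, symmetric])
    finally show ?thesis by (simp add: S_def yf)
  qed
  have ev_1: "\<forall>\<^sub>F j in sequentially. 1 \<le> r j" using r by (simp add: filterlim_at_top)
  have y_eq: "\<forall>\<^sub>F j in sequentially. \<forall>i<m j. real (S j i) powr \<kappa> = y j i * V (r j)"
    using ev_1
  proof eventually_elim
    case (elim j)
    show ?case
      using sum_sq_pos[OF elim] by (auto simp: S_def yf[symmetric] weights_def)
  qed
  have sq: "\<forall>\<^sub>F j in sequentially. (\<Sum>i<m j. (y j i)\<^sup>2) = 1"
    using ev_1
  proof eventually_elim
    case (elim j)
    then show ?case using sum_weights_sq[OF elim] reindex_sum[of "\<lambda>_ x. x\<^sup>2" j] by simp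
  qed
  have y_lim: "(\<lambda>j. y j i) \<longlonglongrightarrow> lam i" for i using lim by (simp add: y_def)
  \<comment> \<open>Fatou's lemma for the squared weights. Mass can escape into infinitely many
    small weights, and this deficit becomes the variance of the Gaussian part.\<close>
  show le1: "(\<Sum>k. (lam k)\<^sup>2) \<le> 1"
  proof (rule suminf_le_const[OF l2])
    fix K
    show "(\<Sum>i<K. (lam i)\<^sup>2) \<le> 1"
    proof (rule tendsto_upperbound)
      show "(\<lambda>j. \<Sum>i<K. (y j i)\<^sup>2) \<longlonglongrightarrow> (\<Sum>i<K. (lam i)\<^sup>2)" by (intro tendsto_intros y_lim)
      show "\<forall>\<^sub>F j in sequentially. (\<Sum>i<K. (y j i)\<^sup>2) \<le> 1"
        using sq
      proof eventually_elim
        case (elim j)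
        have "(\<Sum>i<K. (y j i)\<^sup>2) \<le> (\<Sum>i<max K (m j). (y j i)\<^sup>2)" by (intro sum_mono2) auto
        also have "\<dots> = (\<Sum>i<m j. (y j i)\<^sup>2)" by (rule sum.mono_neutral_right) (auto simp: y_supp)
        finally show ?case using elim by simp
      qed
    qed simp
  qed
  have var: "(\<lambda>j. \<Sum>i<m j. v (S j i) * (y j i)\<^sup>2) \<longlonglongrightarrow> \<sigma>\<^sup>2"
  proof -
    have "(\<lambda>j. varX (r j) / sum_sq \<kappa> T (r j)) \<longlonglongrightarrow> \<sigma>\<^sup>2"
      unfolding \<sigma>(2) by (rule filterlim_compose[OF var_ratio r])
    moreover have "\<forall>\<^sub>F j in sequentially. varX (r j) / sum_sq \<kappa> T (r j) = (\<Sum>i<m j. v (S j i) * (y j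
        i)\<^sup>2)"
      using ev_1
    proof eventually_elim
      case (elim j)
      then show ?case using variance_ratio_eq[OF elim] reindex_sum[of "\<lambda>n x. v n * x\<^sup>2" j] by simp
    qed
    ultimately show ?thesis by (rule Lim_transform_eventually)
  qed
  obtain C where C: "\<And>n. 0 \<le> v n \<and> v n \<le> C"
    "\<And>n u. norm (E.chi n u - (1 - u\<^sup>2 * v n / 2)) \<le> C * \<bar>u\<bar> ^ 3"
    using E.centered_bounds by blast
  have chi_0: "E.chi n 0 = 1" for n using C(2)[of n 0] by simp
  \<comment> \<open>\<open>chi_limit\<close> belongs to the law centered but not rescaled, so
    standardizing divides the argument by \<open>\<sigma>\<close>. The same factor is the limit of
    \<open>ratio\<close>, which explains the argument \<open>t / \<sigma>\<close> below.\<close>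
  have std_N: "char (distr N borel (standardized N (\<lambda>x. x))) u = E.chi_limit (u / \<sigma>)" for u
    by (simp add: char_def integral_distr standardized_def[abs_def] \<sigma>_def)
  have char_Phi: "char (distr Q borel (\<lambda>q. c * \<Phi> q)) t = exp (- ((c * t)\<^sup>2 / 2))" for c t
  proof -
    have [measurable]: "\<Phi> \<in> borel_measurable Q" using Phi_law by (simp add: distributed_def)
    have "distr Q borel \<Phi> = distr Q lborel \<Phi>" by (rule distr_cong) auto
    also have "\<dots> = std_normal_distribution" using Phi_law by (simp add: distributed_def)
    finally have *: "distr Q borel \<Phi> = std_normal_distribution" .
    have "char (distr Q borel (\<lambda>q. c * \<Phi> q)) t = char (distr Q borel \<Phi>) (c * t)"
      by (simp add: char_def integral_distr mult_ac)
    also have "\<dots> = exp (- ((c * t)\<^sup>2 / 2))" unfolding * char_std_normal_distribution by (simp add: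
        exp_of_real)
    finally show ?thesis .
  qed
  have char_lim: "(\<lambda>j. char (distr M borel (stdX (r j))) t)
      \<longlonglongrightarrow> char (distr Q borel (\<lambda>q. tensor_sum Q Y lam q + gauss_coeff lam * \<Phi> q)) t" for t
  proof -
    have "(\<lambda>j. \<Prod>i<m j. E.chi (S j i) (t * ratio (r j) * y j i)) \<longlonglongrightarrow>
        char (distr Q borel (tensor_sum Q Y lam)) t * exp (- ((t / \<sigma>)\<^sup>2 * \<sigma>\<^sup>2 * (1 - (\<Sum>i. (lam i)\<^sup>2))
            / 2))"
    proof (rule array_char_limit[where \<phi> = E.chi and v = v and C = C and \<phi>' = E.chi_limit and V =
        "\<lambda>j. V (r j)"
          and \<kappa> = \<kappa> and t' = "t / \<sigma>"])
      show "v \<longlonglongrightarrow> \<sigma>\<^sup>2" unfolding \<sigma>(2) by (rule E.centered_variance_limit)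
      show "E.chi_limit 0 = 1"
        by (rule real_distribution.char_zero) (simp add: N.real_distribution_distr)
      show "filterlim (\<lambda>j. V (r j)) at_top sequentially" by (rule filterlim_compose[OF V_at_top r])
      have "(\<lambda>j. t * ratio (r j)) \<longlonglongrightarrow> t * (1 / \<sigma>)"
        unfolding \<sigma>_def by (intro tendsto_intros filterlim_compose[OF ratio_limit r])
      then show "(\<lambda>j. t * ratio (r j)) \<longlonglongrightarrow> t / \<sigma>" by simp
      show "(\<lambda>K. \<Prod>i<K. E.chi_limit (t / \<sigma> * lam i)) \<longlonglongrightarrow> char (distr Q borel (tensor_sum Q Y lam)) t"
        using tensor_sum_char(2)[OF Q Y_indep Y_law E.scaled_moment_limits(1) l2, of t]
        by (simp add: std_N)
      show "antimono (y j)" for j by (rule enum(1))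
      show "0 \<le> y j i" for j i by (rule enum(2))
    qed (use C E.chi_le_1 E.chi_limit E.kappa y_supp y_eq sq y_lim var l2 in auto)
    moreover have "\<forall>\<^sub>F j in sequentially. (\<Prod>i<m j. E.chi (S j i) (t * ratio (r j) * y j i)) =
        char (distr M borel (stdX (r j))) t"
      using ev_1
    proof eventually_elim
      case (elim j)
      then show ?case
        using char_standardized[OF elim, of t] reindex_prod[of "\<lambda>n x. E.chi n (t * ratio (r j) *
            x)" j]
        by (simp add: chi_0)
    qed
    moreover have "char (distr Q borel (\<lambda>q. tensor_sum Q Y lam q + gauss_coeff lam * \<Phi> q)) t =
        char (distr Q borel (tensor_sum Q Y lam)) t * exp (- ((t / \<sigma>)\<^sup>2 * \<sigma>\<^sup>2 * (1 - (\<Sum>i. (lam i)\<^sup>2))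
            / 2))"
    proof -
      have "Q.indep_var borel (tensor_sum Q Y lam) borel (\<lambda>q. gauss_coeff lam * \<Phi> q)"
        using Q.indep_var_compose[OF Phi_indep, of "\<lambda>x. x" borel "\<lambda>x. gauss_coeff lam * x" borel]
        by (simp add: comp_def)
      from Q.char_distr_add[OF this, of t]
      have "char (distr Q borel (\<lambda>q. tensor_sum Q Y lam q + gauss_coeff lam * \<Phi> q)) t =
          char (distr Q borel (tensor_sum Q Y lam)) t * exp (- ((gauss_coeff lam * t)\<^sup>2 / 2))"
        by (simp only: char_Phi)
      moreover have "(gauss_coeff lam * t)\<^sup>2 = (t / \<sigma>)\<^sup>2 * \<sigma>\<^sup>2 * (1 - (\<Sum>i. (lam i)\<^sup>2))"
        using le1 \<sigma>(1) by (simp add: gauss_coeff_def power_mult_distrib power_divide)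
      ultimately show ?thesis by simp
    qed
    ultimately show ?thesis by (simp add: Lim_transform_eventually)
  qed
  have meas: "(\<lambda>q. tensor_sum Q Y lam q + gauss_coeff lam * \<Phi> q) \<in> borel_measurable Q"
  proof -
    have [measurable]: "\<Phi> \<in> borel_measurable Q" using Phi_law by (simp add: distributed_def)
    have [measurable]: "tensor_sum Q Y lam \<in> borel_measurable Q" by (rule Q.indep_var_rv1[OF
        Phi_indep])
    show ?thesis by measurable
  qed
  show "converges_in_law M (\<lambda>j. stdX (r j))
      Q (\<lambda>q. tensor_sum Q Y lam q + gauss_coeff lam * \<Phi> q)"
    unfolding converges_in_law_def
  proof (rule levy_continuity[OF _ _ char_lim])
    show "real_distribution (distr M borel (stdX (r n)))" for n
      by (simp add: W.real_distribution_distr)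
    show "real_distribution (distr Q borel (\<lambda>q. tensor_sum Q Y lam q + gauss_coeff lam * \<Phi> q))"
      by (rule Q.real_distribution_distr[OF meas])
  qed
qed

end

theorem corollary1p11:
  fixes \<kappa> b :: real and \<alpha> N :: "real measure"
    and ME :: "'e measure" and \<eta> :: "int \<Rightarrow> 'e \<Rightarrow> real" and Z :: "nat \<Rightarrow> 'e \<Rightarrow> int"
    and T :: "nat \<Rightarrow> nat"
    and M :: "'s measure" and \<omega> :: "nat \<times> int \<Rightarrow> 's \<Rightarrow> real" and X :: "nat \<Rightarrow> 's \<Rightarrow> int"
    and r :: "nat \<Rightarrow> nat" and lam :: "nat \<Rightarrow> real"
    and Q :: "'q measure" and Y :: "nat \<Rightarrow> 'q \<Rightarrow> real" and \<Phi> :: "'q \<Rightarrow> real"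
  assumes kappa: "0 < \<kappa>" "\<kappa> < 1"
    and regular: "kappa_regular \<kappa> \<alpha>"
    \<comment> \<open>\<open>b = b(\<mu>)\<close> and the Mittag-Leffler law \<open>N\<close>, the limit law of \<open>Z\<^sub>n / n\<^sup>\<kappa>\<close>\<close>
    and b_pos: "0 < b"
    and N: "mittag_leffler_law \<kappa> b N"
    and Z: "rwre \<alpha> ME \<eta> Z"
    and b: "weak_conv_m (\<lambda>n. distr ME borel (\<lambda>s. real_of_int (Z n s) / real n powr \<kappa>)) N"
    and cooling: "cooling_increments T"
    and X: "rwcre \<alpha> T M \<omega> X"
    and var_ratio:
      "(\<lambda>n. prob_space.variance M (\<lambda>s. real_of_int (X n s)) / sum_sq \<kappa> T n)
         \<longlonglongrightarrow> prob_space.variance N (\<lambda>x. x)"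
    and subseq: "filterlim r at_top sequentially"
    and l2: "summable (\<lambda>k. (lam k)\<^sup>2)"
    and lim: "\<And>k. (\<lambda>j. decr_reordering (weights \<kappa> T (r j)) k) \<longlonglongrightarrow> lam k"
    \<comment> \<open>i.i.d. copies \<open>Y\<^sub>k\<close> of the Mittag-Leffler variable and an independent standard Gaussian\<close>
    and Q: "prob_space Q"
    and Y_indep: "prob_space.indep_vars Q (\<lambda>_. borel) Y UNIV"
    and Y_law: "\<And>k. distr Q borel (Y k) = N"
    and Phi_law: "distributed Q lborel \<Phi> std_normal_density"
    and Phi_indep: "prob_space.indep_var Q borel (tensor_sum Q Y lam) borel \<Phi>"
  shows "gauss_coeff lam \<in> {0..1} \<and>
    converges_in_law M (\<lambda>j. standardized M (\<lambda>s. real_of_int (X (r j) s)))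
      Q (\<lambda>q. tensor_sum Q Y lam q + gauss_coeff lam * \<Phi> q) \<and>
    (\<forall>p>0. converges_in_law_Lp p M (\<lambda>j. standardized M (\<lambda>s. real_of_int (X (r j) s)))
      Q (\<lambda>q. tensor_sum Q Y lam q + gauss_coeff lam * \<Phi> q))"
proof -
  interpret cooling_limit \<alpha> T M \<omega> X ME \<eta> Z \<kappa> b N
    by unfold_locales
       (use assms in \<open>auto simp: rwre_def rwcre_def kappa_regular_def\<close>)
  note limit = law_limit[OF subseq l2 lim Q Y_indep Y_law Phi_law Phi_indep]
  have "0 \<le> (\<Sum>k. (lam k)\<^sup>2)" by (rule suminf_nonneg[OF l2]) simp
  then have "gauss_coeff lam \<in> {0..1}"
    using limit(1) by (simp add: gauss_coeff_def real_le_lsqrt)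
  then show ?thesis
    using limit(2) uniformly_integrable_standardized[OF subseq]
    by (simp add: converges_in_law_Lp_def)
qed

end
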